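(* Let $j\in\mathbb R$, and let $\mathcal E(\rho,\rho_x)$ and $e(v,v_y)$ be smooth energies, strongly convex in $\rho_x$ and $v_y$ respectively, related by $\mathcal E(\rho,\rho_x)=\rho\,e(1/\rho,-\rho_x/\rho^3)$. Consider the systems $$(\mathrm{EKE}j)\quad\begin{cases}\partial_t\rho+\partial_xq=0,\\ \partial_tq+\partial_x\Phi=0,\quad \Phi=(q+j)^2/\rho+\rho\,\mathsf E\mathcal E[\rho]+\mathsf L\mathcal E[\rho],\end{cases}$$ $$(\mathrm{EKL}j)\quad\begin{cases}\partial_sv=\partial_yz,\\ \partial_sz=\partial_y\Psi,\quad\Psi=\mathsf Ee[v]-2jz-j^2v.\end{cases}$$ Assume that $\underline\rho$ and $\underline v$ are smooth periodic functions on $\mathbb R$, of respective periods $\Xi$ and $\Upsilon=\int_0^\Xi\underline\rho\,dx$, bounded and bounded from below by positive constants, related by $$\underline\rho(x)=1/\underline v(\underline Y(x))=\underline Y'(x)\qquad(x\in\mathbb R)$$ for some function $\underline Y$, and such that $(\underline\rho,0)$ and $(\underline v,0)$ are stationary solutions of $(\mathrm{EKE}j)$ and $(\mathrm{EKL}j)$ respectively. Then the linearizations of $(\mathrm{EKE}j)$ about $(\underline\rho,0)$ and of $(\mathrm{EKL}j)$ about $(\underline v,0)$ have identical spectra.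
   Context: For $\mathcal E=\mathcal E(\rho,\rho_x)$: $\mathsf E\mathcal E[\rho]=\partial_\rho\mathcal E-\mathrm D_x(\partial_{\rho_x}\mathcal E)$ (variational derivative) and $\mathsf L\mathcal E[\rho]=\rho_x\partial_{\rho_x}\mathcal E-\mathcal E$; similarly for $e=e(v,v_y)$ with $y$ in place of $x$. These are the Euler–Korteweg system in Eulerian coordinates, resp. mass Lagrangian coordinates, written in frames moving with the wave. The linearized systems read $\partial_t(\dot\rho,\dot q)^{\mathsf T}=\mathscr L_E(\dot\rho,\dot q)^{\mathsf T}$ and $\partial_s(\dot v,\dot z)^{\mathsf T}=\mathscr L_L(\dot v,\dot z)^{\mathsf T}$, where $\mathscr L_E$ is a differential operator in $x$ with $\Xi$-periodic coefficients and $\mathscr L_L$ is a differential operator in $y$ with $\Upsilon$-periodic coefficients. The claim is that $\mathscr L_E$ and $\mathscr L_L$ have the same spectrum, where spectrum is the whole spectrum in the space of square integrable functions on $\mathbb R$; equivalently, the spectrum of $\mathscr L_E$ is the set of $\nu\in\mathbb C$ for which there are $\alpha\in\mathbb R$ and a nontrivial $(\dot\rho,\dot q)$ with $\mathscr L_E(\dot\rho,\dot q)^{\mathsf T}=\nu(\dot\rho,\dot q)^{\mathsf T}$ and $(\dot\rho,\dot q)(x+\Xi)=e^{i\alpha}(\dot\rho,\dot q)(x)$ for all $x$; similarly for $\mathscr L_L$ with $(\dot v,\dot z)(y+\Upsilon)=e^{i\alpha}(\dot v,\dot z)(y)$. *)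

theory Defs
  imports "HOL-Analysis.Analysis"
begin

section \<open>Smoothness and strong convexity\<close>

definition pd1 :: "(real \<Rightarrow> real \<Rightarrow> real) \<Rightarrow> real \<Rightarrow> real \<Rightarrow> real" where
  "pd1 f = (\<lambda>a b. deriv (\<lambda>r. f r b) a)"

definition pd2 :: "(real \<Rightarrow> real \<Rightarrow> real) \<Rightarrow> real \<Rightarrow> real \<Rightarrow> real" where
  "pd2 f = (\<lambda>a b. deriv (\<lambda>s. f a s) b)"

text \<open>\<open>C\<^sup>\<infinity>\<close> on an open set \<open>S\<close>: all iterated partial derivatives, in any order, exist and are
  jointly continuous on \<open>S\<close>.\<close>

coinductive smooth2_on :: "(real \<times> real) set \<Rightarrow> (real \<Rightarrow> real \<Rightarrow> real) \<Rightarrow> bool"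
  for S :: "(real \<times> real) set" where
  "\<lbrakk>continuous_on S (\<lambda>(a, b). f a b);
    \<forall>(a, b)\<in>S. (\<lambda>r. f r b) field_differentiable at a \<and> (\<lambda>s. f a s) field_differentiable at b;
    smooth2_on S (pd1 f); smooth2_on S (pd2 f)\<rbrakk> \<Longrightarrow> smooth2_on S f"

definition smooth_fn :: "(real \<Rightarrow> real) \<Rightarrow> bool" where
  "smooth_fn f \<longleftrightarrow> (\<forall>n x. (deriv ^^ n) f field_differentiable at x)"

definition strongly_convex :: "(real \<Rightarrow> real) \<Rightarrow> bool" where
  "strongly_convex f \<longleftrightarrow> (\<exists>c>0. convex_on UNIV (\<lambda>s. f s - c / 2 * s\<^sup>2))"

text \<open>The first argument of an energy is a density or a specific volume, hence positive.\<close>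

definition admissible_energy :: "(real \<Rightarrow> real \<Rightarrow> real) \<Rightarrow> bool" where
  "admissible_energy E \<longleftrightarrow>
     smooth2_on ({0<..} \<times> UNIV) E \<and> (\<forall>r>0. strongly_convex (E r))"


section \<open>The nonlinear systems\<close>

definition euler :: "(real \<Rightarrow> real \<Rightarrow> real) \<Rightarrow> (real \<Rightarrow> real) \<Rightarrow> real \<Rightarrow> real" where
  "euler E u x = pd1 E (u x) (deriv u x) - deriv (\<lambda>\<xi>. pd2 E (u \<xi>) (deriv u \<xi>)) x"

definition legendre :: "(real \<Rightarrow> real \<Rightarrow> real) \<Rightarrow> (real \<Rightarrow> real) \<Rightarrow> real \<Rightarrow> real" where
  "legendre E u x = deriv u x * pd2 E (u x) (deriv u x) - E (u x) (deriv u x)"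

definition EKE_flux ::
    "(real \<Rightarrow> real \<Rightarrow> real) \<Rightarrow> real \<Rightarrow> (real \<Rightarrow> real) \<Rightarrow> (real \<Rightarrow> real) \<Rightarrow> real \<Rightarrow> real" where
  "EKE_flux E j \<rho> q x = (q x + j)\<^sup>2 / \<rho> x + \<rho> x * euler E \<rho> x + legendre E \<rho> x"

definition EKL_flux ::
    "(real \<Rightarrow> real \<Rightarrow> real) \<Rightarrow> real \<Rightarrow> (real \<Rightarrow> real) \<Rightarrow> (real \<Rightarrow> real) \<Rightarrow> real \<Rightarrow> real" where
  "EKL_flux e j v z y = euler e v y - 2 * j * z y - j\<^sup>2 * v y"

text \<open>In \<open>EKE_solution E j \<rho> q\<close> and \<open>EKL_solution e j v z\<close> the unknowns take the time variable as
  first argument.\<close>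

definition EKE_solution ::
    "(real \<Rightarrow> real \<Rightarrow> real) \<Rightarrow> real \<Rightarrow> (real \<Rightarrow> real \<Rightarrow> real) \<Rightarrow> (real \<Rightarrow> real \<Rightarrow> real) \<Rightarrow> bool" where
  "EKE_solution E j \<rho> q \<longleftrightarrow> (\<forall>t x.
     (\<exists>a b. ((\<lambda>\<tau>. \<rho> \<tau> x) has_real_derivative a) (at t) \<and>
            ((\<lambda>\<xi>. q t \<xi>) has_real_derivative b) (at x) \<and> a + b = 0) \<and>
     (\<exists>a b. ((\<lambda>\<tau>. q \<tau> x) has_real_derivative a) (at t) \<and>
            ((\<lambda>\<xi>. EKE_flux E j (\<rho> t) (q t) \<xi>) has_real_derivative b) (at x) \<and> a + b = 0))"

definition EKL_solution ::
    "(real \<Rightarrow> real \<Rightarrow> real) \<Rightarrow> real \<Rightarrow> (real \<Rightarrow> real \<Rightarrow> real) \<Rightarrow> (real \<Rightarrow> real \<Rightarrow> real) \<Rightarrow> bool" where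
  "EKL_solution e j v z \<longleftrightarrow> (\<forall>s y.
     (\<exists>a b. ((\<lambda>\<tau>. v \<tau> y) has_real_derivative a) (at s) \<and>
            ((\<lambda>\<eta>. z s \<eta>) has_real_derivative b) (at y) \<and> a = b) \<and>
     (\<exists>a b. ((\<lambda>\<tau>. z \<tau> y) has_real_derivative a) (at s) \<and>
            ((\<lambda>\<eta>. EKL_flux e j (v s) (z s) \<eta>) has_real_derivative b) (at y) \<and> a = b))"


section \<open>Linearized expressions\<close>

text \<open>The linearizations act on \<open>h\<close>, \<open>r\<close>, \<open>q\<close>, \<open>w\<close>, \<open>z\<close> through a derivation \<open>D\<close>. For real
  smooth perturbations \<open>D\<close> is the ordinary derivative, and the lemmas at the end of this theory
  verify that the expressions then are the directional derivatives of the nonlinear ones; the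
  operators on square integrable functions use the weak derivative.\<close>

definition lin_euler ::
    "((real \<Rightarrow> 'a) \<Rightarrow> real \<Rightarrow> 'a) \<Rightarrow> (real \<Rightarrow> real \<Rightarrow> real) \<Rightarrow> (real \<Rightarrow> real) \<Rightarrow> (real \<Rightarrow> 'a) \<Rightarrow>
      real \<Rightarrow> 'a::real_normed_field" where
  "lin_euler D E u h x =
     of_real (pd1 (pd1 E) (u x) (deriv u x)) * h x + of_real (pd2 (pd1 E) (u x) (deriv u x)) * D h x
     - D (\<lambda>\<xi>. of_real (pd1 (pd2 E) (u \<xi>) (deriv u \<xi>)) * h \<xi>
               + of_real (pd2 (pd2 E) (u \<xi>) (deriv u \<xi>)) * D h \<xi>) x"

definition lin_legendre ::
    "((real \<Rightarrow> 'a) \<Rightarrow> real \<Rightarrow> 'a) \<Rightarrow> (real \<Rightarrow> real \<Rightarrow> real) \<Rightarrow> (real \<Rightarrow> real) \<Rightarrow> (real \<Rightarrow> 'a) \<Rightarrow>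
      real \<Rightarrow> 'a::real_normed_field" where
  "lin_legendre D E u h x =
     of_real (pd2 E (u x) (deriv u x)) * D h x
     + of_real (deriv u x) * (of_real (pd1 (pd2 E) (u x) (deriv u x)) * h x
                              + of_real (pd2 (pd2 E) (u x) (deriv u x)) * D h x)
     - (of_real (pd1 E (u x) (deriv u x)) * h x + of_real (pd2 E (u x) (deriv u x)) * D h x)"

definition lin_EKE_flux ::
    "((real \<Rightarrow> 'a) \<Rightarrow> real \<Rightarrow> 'a) \<Rightarrow> (real \<Rightarrow> real \<Rightarrow> real) \<Rightarrow> real \<Rightarrow> (real \<Rightarrow> real) \<Rightarrow>
      (real \<Rightarrow> 'a) \<Rightarrow> (real \<Rightarrow> 'a) \<Rightarrow> real \<Rightarrow> 'a::real_normed_field" where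
  "lin_EKE_flux D E j \<rho> r q x =
     of_real (2 * j / \<rho> x) * q x - of_real (j\<^sup>2 / (\<rho> x)\<^sup>2) * r x
     + of_real (euler E \<rho> x) * r x + of_real (\<rho> x) * lin_euler D E \<rho> r x
     + lin_legendre D E \<rho> r x"

definition lin_EKL_flux ::
    "((real \<Rightarrow> 'a) \<Rightarrow> real \<Rightarrow> 'a) \<Rightarrow> (real \<Rightarrow> real \<Rightarrow> real) \<Rightarrow> real \<Rightarrow> (real \<Rightarrow> real) \<Rightarrow>
      (real \<Rightarrow> 'a) \<Rightarrow> (real \<Rightarrow> 'a) \<Rightarrow> real \<Rightarrow> 'a::real_normed_field" where
  "lin_EKL_flux D e j v w z y = lin_euler D e v w y - of_real (2 * j) * z y - of_real (j\<^sup>2) * w y"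


section \<open>Square integrable functions and Sobolev spaces on the line\<close>

definition L2 :: "(real \<Rightarrow> complex) set" where
  "L2 = {f. f \<in> borel_measurable lborel \<and> integrable lborel (\<lambda>x. (cmod (f x))\<^sup>2)}"

definition L2_norm2 :: "(real \<Rightarrow> complex) \<times> (real \<Rightarrow> complex) \<Rightarrow> real" where
  "L2_norm2 U = sqrt ((LINT x|lborel. (cmod (fst U x))\<^sup>2) + (LINT x|lborel. (cmod (snd U x))\<^sup>2))"

text \<open>Weak differentiability in one dimension: \<open>f\<close> agrees almost everywhere with a locally
  absolutely continuous function whose derivative is \<open>g\<close>.\<close>

definition has_weak_deriv :: "(real \<Rightarrow> complex) \<Rightarrow> (real \<Rightarrow> complex) \<Rightarrow> bool" where
  "has_weak_deriv f g \<longleftrightarrow> (\<exists>h. (AE x in lborel. f x = h x) \<and>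
     (\<forall>a b. a \<le> b \<longrightarrow> set_integrable lborel {a..b} g \<and> h b - h a = (LINT x:{a..b}|lborel. g x)))"

text \<open>The weak derivative is determined only almost everywhere, so \<open>wderiv\<close> picks an arbitrary
  representative; everything below depends on it only up to null sets.\<close>

definition wderiv :: "(real \<Rightarrow> complex) \<Rightarrow> real \<Rightarrow> complex" where
  "wderiv f = (SOME g. has_weak_deriv f g)"

fun sobolev :: "nat \<Rightarrow> (real \<Rightarrow> complex) set" where
  "sobolev 0 = L2"
| "sobolev (Suc k) = {f \<in> L2. \<exists>g \<in> sobolev k. has_weak_deriv f g}"


section \<open>Spectrum\<close>

type_synonym pair_fn = "(real \<Rightarrow> complex) \<times> (real \<Rightarrow> complex)"

definition solves_resolvent_eq ::
    "(pair_fn \<Rightarrow> pair_fn) \<Rightarrow> complex \<Rightarrow> pair_fn \<Rightarrow> pair_fn \<Rightarrow> bool" where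
  "solves_resolvent_eq A \<nu> U F \<longleftrightarrow> (AE x in lborel.
     fst (A U) x - \<nu> * fst U x = fst F x \<and> snd (A U) x - \<nu> * snd U x = snd F x)"

text \<open>The resolvent set of the unbounded operator \<open>A\<close> with domain \<open>Dom\<close> in
  \<open>L\<^sup>2(\<real>) \<times> L\<^sup>2(\<real>)\<close>: those \<open>\<nu>\<close> for which \<open>A - \<nu>\<close> is a bijection from the domain onto the whole
  space with bounded inverse, functions being identified when they agree almost everywhere.\<close>

definition resolvent_set :: "pair_fn set \<Rightarrow> (pair_fn \<Rightarrow> pair_fn) \<Rightarrow> complex set" where
  "resolvent_set Dom A = {\<nu>. \<exists>C. \<forall>F \<in> L2 \<times> L2.
     (\<exists>U \<in> Dom. solves_resolvent_eq A \<nu> U F \<and> L2_norm2 U \<le> C * L2_norm2 F \<and>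
        (\<forall>V \<in> Dom. solves_resolvent_eq A \<nu> V F \<longrightarrow>
           (AE x in lborel. fst V x = fst U x \<and> snd V x = snd U x)))}"

definition L2_spectrum :: "pair_fn set \<Rightarrow> (pair_fn \<Rightarrow> pair_fn) \<Rightarrow> complex set" where
  "L2_spectrum Dom A = - resolvent_set Dom A"


section \<open>The linearized operators\<close>

text \<open>Both operators are of order three in the first unknown and of order one in the second.\<close>

definition lin_domain :: "pair_fn set" where
  "lin_domain = sobolev 3 \<times> sobolev 1"

definition EKE_lin :: "(real \<Rightarrow> real \<Rightarrow> real) \<Rightarrow> real \<Rightarrow> (real \<Rightarrow> real) \<Rightarrow> pair_fn \<Rightarrow> pair_fn" where
  "EKE_lin E j \<rho> = (\<lambda>(r, q). (\<lambda>x. - wderiv q x, \<lambda>x. - wderiv (lin_EKE_flux wderiv E j \<rho> r q) x))"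

definition EKL_lin :: "(real \<Rightarrow> real \<Rightarrow> real) \<Rightarrow> real \<Rightarrow> (real \<Rightarrow> real) \<Rightarrow> pair_fn \<Rightarrow> pair_fn" where
  "EKL_lin e j v = (\<lambda>(w, z). (\<lambda>y. wderiv z y, \<lambda>y. wderiv (lin_EKL_flux wderiv e j v w z) y))"


section \<open>The linearized expressions are directional derivatives\<close>

lemma smooth2_onD:
  assumes "smooth2_on S f"
  shows "continuous_on S (\<lambda>(a, b). f a b)"
    and "(a, b) \<in> S \<Longrightarrow> ((\<lambda>r. f r b) has_real_derivative pd1 f a b) (at a)"
    and "(a, b) \<in> S \<Longrightarrow> ((\<lambda>s. f a s) has_real_derivative pd2 f a b) (at b)"
    and "smooth2_on S (pd1 f)" "smooth2_on S (pd2 f)"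
  using assms by (auto elim: smooth2_on.cases simp: pd1_def pd2_def
      elim!: smooth2_on.cases[of S f] intro!: field_differentiable_derivI)

lemma smooth2_chain:
  assumes f: "smooth2_on ({0<..} \<times> UNIV) f" and pos: "0 < p t"
    and p: "(p has_real_derivative p') (at t)" and s: "(s has_real_derivative s') (at t)"
  shows "((\<lambda>t. f (p t) (s t)) has_real_derivative
           pd1 f (p t) (s t) * p' + pd2 f (p t) (s t) * s') (at t)"
proof -
  let ?S = "{0::real<..} \<times> (UNIV :: real set)"
  have "((\<lambda>(x, y). f x y) has_derivative
          (\<lambda>(tx, ty). tx * pd1 f (p t) (s t) + ty * pd2 f (p t) (s t)))
          (at (p t, s t) within {0<..} \<times> UNIV)"
  proof -
    have "((\<lambda>(x, y). f x y) has_derivative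
          (\<lambda>(tx, ty). (\<lambda>h. h * pd1 f (p t) (s t)) tx + blinfun_apply (blinfun_scaleR_left (pd2 f (p t) (s t))) ty))
          (at (p t, s t) within {0<..} \<times> UNIV)"
    proof (rule has_derivative_partialsI)
      show "((\<lambda>x. f x (s t)) has_derivative (\<lambda>h. h * pd1 f (p t) (s t))) (at (p t) within {0<..})"
        using smooth2_onD(2)[OF f, of "p t" "s t"] pos
        by (auto simp: has_field_derivative_def mult_commute_abs intro: has_derivative_at_withinI)
      show "((\<lambda>y. f x y) has_derivative blinfun_apply (blinfun_scaleR_left (pd2 f x y))) (at y within UNIV)"
        if "x \<in> {0<..}" "y \<in> UNIV" for x y
        using smooth2_onD(3)[OF f, of x y] that
        by (simp add: has_field_derivative_def mult_commute_abs)
      have "continuous_on ?S (\<lambda>(x, y). pd2 f x y)"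
        using smooth2_onD(1)[OF smooth2_onD(5)[OF f]] .
      then have "((\<lambda>(x, y). pd2 f x y) \<longlongrightarrow> pd2 f (p t) (s t)) (at (p t, s t) within ?S)"
        using pos by (auto simp: continuous_on_def)
      then have "((\<lambda>z. blinfun_scaleR_left (case z of (x, y) \<Rightarrow> pd2 f x y)) \<longlongrightarrow>
          (blinfun_scaleR_left (pd2 f (p t) (s t)) :: real \<Rightarrow>\<^sub>L real)) (at (p t, s t) within ?S)"
        by (intro tendsto_intros)
      then show "continuous (at (p t, s t) within ?S)
          (\<lambda>(x, y). (blinfun_scaleR_left (pd2 f x y) :: real \<Rightarrow>\<^sub>L real))"
        by (simp add: continuous_within case_prod_unfold)
    qed auto
    then show ?thesis by (simp add: case_prod_unfold)
  qed
  moreover have "open ?S" by (intro open_Times) auto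
  ultimately have "((\<lambda>(x, y). f x y) has_derivative
          (\<lambda>(tx, ty). tx * pd1 f (p t) (s t) + ty * pd2 f (p t) (s t))) (at (p t, s t))"
    using at_within_open[of "(p t, s t)" ?S] pos by (simp only: mem_Times_iff fst_conv snd_conv) simp
  moreover have "((\<lambda>t. (p t, s t)) has_derivative (\<lambda>h. (h * p', h * s'))) (at t)"
    using has_derivative_Pair[OF p[unfolded has_field_derivative_def] s[unfolded has_field_derivative_def]]
    by (simp only: mult.commute)
  ultimately have "((\<lambda>(x, y). f x y) \<circ> (\<lambda>t. (p t, s t)) has_derivative
      (\<lambda>(tx, ty). tx * pd1 f (p t) (s t) + ty * pd2 f (p t) (s t)) \<circ> (\<lambda>h. (h * p', h * s'))) (at t)"
    by (intro diff_chain_at) auto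
  then have "((\<lambda>t. f (p t) (s t)) has_derivative
      (\<lambda>h. h * p' * pd1 f (p t) (s t) + h * s' * pd2 f (p t) (s t))) (at t)"
    by (simp add: o_def)
  then show ?thesis
    unfolding has_field_derivative_def
    by (rule has_derivative_eq_rhs) (simp add: fun_eq_iff algebra_simps)
qed

lemma double_difference:
  assumes f: "smooth2_on ({0<..} \<times> UNIV) f" and "0 < a" "0 < d"
  shows "\<exists>\<xi> \<eta>. a < \<xi> \<and> \<xi> < a + d \<and> b < \<eta> \<and> \<eta> < b + d \<and>
    f (a + d) (b + d) - f (a + d) b - f a (b + d) + f a b = d * d * pd2 (pd1 f) \<xi> \<eta>"
    and "\<exists>\<xi> \<eta>. a < \<xi> \<and> \<xi> < a + d \<and> b < \<eta> \<and> \<eta> < b + d \<and>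
    f (a + d) (b + d) - f (a + d) b - f a (b + d) + f a b = d * d * pd1 (pd2 f) \<xi> \<eta>"
proof -
  have "\<exists>z. a < z \<and> z < a + d \<and> (f (a + d) (b + d) - f (a + d) b) - (f a (b + d) - f a b) =
      (a + d - a) * (pd1 f z (b + d) - pd1 f z b)"
    using assms by (intro MVT2) (auto intro!: derivative_eq_intros smooth2_onD(2)[OF f])
  then obtain \<xi> where \<xi>: "a < \<xi>" "\<xi> < a + d"
    "(f (a + d) (b + d) - f (a + d) b) - (f a (b + d) - f a b) = d * (pd1 f \<xi> (b + d) - pd1 f \<xi> b)"
    by auto
  have "\<exists>z. b < z \<and> z < b + d \<and> pd1 f \<xi> (b + d) - pd1 f \<xi> b = (b + d - b) * pd2 (pd1 f) \<xi> z"
    using assms \<xi> by (intro MVT2) (auto intro!: smooth2_onD(3)[OF smooth2_onD(4)[OF f]])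
  then obtain \<eta> where "b < \<eta>" "\<eta> < b + d"
    "pd1 f \<xi> (b + d) - pd1 f \<xi> b = d * pd2 (pd1 f) \<xi> \<eta>"
    by auto
  with \<xi> show "\<exists>\<xi> \<eta>. a < \<xi> \<and> \<xi> < a + d \<and> b < \<eta> \<and> \<eta> < b + d \<and>
    f (a + d) (b + d) - f (a + d) b - f a (b + d) + f a b = d * d * pd2 (pd1 f) \<xi> \<eta>"
    by (intro exI[of _ \<xi>] exI[of _ \<eta>]) (simp add: algebra_simps)
  have "\<exists>z. b < z \<and> z < b + d \<and> (f (a + d) (b + d) - f a (b + d)) - (f (a + d) b - f a b) =
      (b + d - b) * (pd2 f (a + d) z - pd2 f a z)"
    using assms by (intro MVT2) (auto intro!: derivative_eq_intros smooth2_onD(3)[OF f])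
  then obtain \<eta> where \<eta>: "b < \<eta>" "\<eta> < b + d"
    "(f (a + d) (b + d) - f a (b + d)) - (f (a + d) b - f a b) = d * (pd2 f (a + d) \<eta> - pd2 f a \<eta>)"
    by auto
  have "\<exists>z. a < z \<and> z < a + d \<and> pd2 f (a + d) \<eta> - pd2 f a \<eta> = (a + d - a) * pd1 (pd2 f) z \<eta>"
    using assms \<eta> by (intro MVT2) (auto intro!: smooth2_onD(2)[OF smooth2_onD(5)[OF f]])
  then obtain \<xi> where "a < \<xi>" "\<xi> < a + d"
    "pd2 f (a + d) \<eta> - pd2 f a \<eta> = d * pd1 (pd2 f) \<xi> \<eta>"
    by auto
  with \<eta> show "\<exists>\<xi> \<eta>. a < \<xi> \<and> \<xi> < a + d \<and> b < \<eta> \<and> \<eta> < b + d \<and>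
    f (a + d) (b + d) - f (a + d) b - f a (b + d) + f a b = d * d * pd1 (pd2 f) \<xi> \<eta>"
    by (intro exI[of _ \<xi>] exI[of _ \<eta>]) (simp add: algebra_simps)
qed

lemma pd_commute:
  assumes f: "smooth2_on ({0<..} \<times> UNIV) f" and a: "0 < a"
  shows "pd2 (pd1 f) a b = pd1 (pd2 f) a b"
proof -
  let ?d = "\<lambda>n. 1 / real (Suc n)"
  have "\<forall>n. \<exists>z. fst z \<in> {a<..<a + ?d n} \<times> {b<..<b + ?d n} \<and> snd z \<in> {a<..<a + ?d n} \<times> {b<..<b + ?d n} \<and>
      (\<lambda>(\<xi>, \<eta>). pd2 (pd1 f) \<xi> \<eta>) (fst z) = (\<lambda>(\<xi>, \<eta>). pd1 (pd2 f) \<xi> \<eta>) (snd z)"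
  proof
    fix n
    have d: "0 < ?d n" by simp
    obtain p q where "a < p" "p < a + ?d n" "b < q" "q < b + ?d n"
      "f (a + ?d n) (b + ?d n) - f (a + ?d n) b - f a (b + ?d n) + f a b = ?d n * ?d n * pd2 (pd1 f) p q"
      using double_difference(1)[OF f a d, of b] by blast
    moreover obtain p' q' where "a < p'" "p' < a + ?d n" "b < q'" "q' < b + ?d n"
      "f (a + ?d n) (b + ?d n) - f (a + ?d n) b - f a (b + ?d n) + f a b = ?d n * ?d n * pd1 (pd2 f) p' q'"
      using double_difference(2)[OF f a d, of b] by blast
    moreover from calculation have "pd2 (pd1 f) p q = pd1 (pd2 f) p' q'"
      using d by (metis mult_cancel_left mult_eq_0_iff less_numeral_extra(3))
    ultimately show "\<exists>z. fst z \<in> {a<..<a + ?d n} \<times> {b<..<b + ?d n} \<and> snd z \<in> {a<..<a + ?d n} \<times> {b<..<b + ?d n} \<and>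
      (\<lambda>(\<xi>, \<eta>). pd2 (pd1 f) \<xi> \<eta>) (fst z) = (\<lambda>(\<xi>, \<eta>). pd1 (pd2 f) \<xi> \<eta>) (snd z)"
      by (intro exI[of _ "((p, q), (p', q'))"]) auto
  qed
  then obtain Z where Z: "\<And>n. fst (Z n) \<in> {a<..<a + ?d n} \<times> {b<..<b + ?d n}"
    "\<And>n. snd (Z n) \<in> {a<..<a + ?d n} \<times> {b<..<b + ?d n}"
    "\<And>n. (\<lambda>(\<xi>, \<eta>). pd2 (pd1 f) \<xi> \<eta>) (fst (Z n)) = (\<lambda>(\<xi>, \<eta>). pd1 (pd2 f) \<xi> \<eta>) (snd (Z n))"
    by metis
  have squeeze: "w \<longlonglongrightarrow> (a, b)" if w: "\<And>n. w n \<in> {a<..<a + ?d n} \<times> {b<..<b + ?d n}" for w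
  proof -
    have lim: "(\<lambda>n. c + ?d n) \<longlonglongrightarrow> c" for c
      using tendsto_add[OF tendsto_const LIMSEQ_Suc[OF lim_1_over_n], of c] by simp
    have "a < fst (w n) \<and> fst (w n) < a + ?d n \<and> b < snd (w n) \<and> snd (w n) < b + ?d n" for n
      using w[of n] by (auto simp: mem_Times_iff)
    then have "(\<lambda>n. fst (w n)) \<longlonglongrightarrow> a" "(\<lambda>n. snd (w n)) \<longlonglongrightarrow> b"
      by (auto intro!: tendsto_sandwich[OF _ _ tendsto_const lim] always_eventually less_imp_le)
    then show ?thesis using tendsto_Pair by force
  qed
  have cont: "(\<lambda>n. g (w n)) \<longlonglongrightarrow> g (a, b)"
    if "continuous_on ({0<..} \<times> UNIV) g" "\<And>n. w n \<in> {a<..<a + ?d n} \<times> {b<..<b + ?d n}"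
    for g :: "real \<times> real \<Rightarrow> real" and w
  proof (rule continuous_on_tendsto_compose[OF that(1) squeeze[OF that(2)]])
    have "w n \<in> {0<..} \<times> UNIV" for n
      using that(2)[of n] a by (auto simp: mem_Times_iff)
    then show "\<forall>\<^sub>F n in sequentially. w n \<in> {0<..} \<times> UNIV" by simp
  qed (use a in auto)
  have "(\<lambda>n. (\<lambda>(\<xi>, \<eta>). pd2 (pd1 f) \<xi> \<eta>) (fst (Z n))) \<longlonglongrightarrow> (\<lambda>(\<xi>, \<eta>). pd2 (pd1 f) \<xi> \<eta>) (a, b)"
    by (rule cont[OF smooth2_onD(1)[OF smooth2_onD(5)[OF smooth2_onD(4)[OF f]]] Z(1)])
  moreover have "(\<lambda>n. (\<lambda>(\<xi>, \<eta>). pd1 (pd2 f) \<xi> \<eta>) (snd (Z n))) \<longlonglongrightarrow> (\<lambda>(\<xi>, \<eta>). pd1 (pd2 f) \<xi> \<eta>) (a, b)"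
    by (rule cont[OF smooth2_onD(1)[OF smooth2_onD(4)[OF smooth2_onD(5)[OF f]]] Z(2)])
  ultimately show ?thesis using Z(3) LIMSEQ_unique by fastforce
qed

lemma smooth_fnD:
  assumes "smooth_fn f"
  shows "(f has_real_derivative deriv f x) (at x)" "smooth_fn (deriv f)"
proof -
  have "(deriv ^^ 0) f field_differentiable at x" using assms unfolding smooth_fn_def by blast
  then show "(f has_real_derivative deriv f x) (at x)" by (simp add: field_differentiable_derivI)
  show "smooth_fn (deriv f)" unfolding smooth_fn_def
  proof (intro allI)
    fix n x
    have "(deriv ^^ Suc n) f field_differentiable at x" using assms unfolding smooth_fn_def by blast
    then show "(deriv ^^ n) (deriv f) field_differentiable at x" by (simp add: funpow_swap1)
  qed
qed

context
  fixes E :: "real \<Rightarrow> real \<Rightarrow> real" and u h :: "real \<Rightarrow> real"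
  assumes E: "smooth2_on ({0<..} \<times> UNIV) E"
    and u: "smooth_fn u" and h: "smooth_fn h" and pos: "\<And>x. 0 < u x"
begin

lemma deriv_perturb: "deriv (\<lambda>\<xi>. u \<xi> + \<epsilon> * h \<xi>) x = deriv u x + \<epsilon> * deriv h x"
  by (rule DERIV_imp_deriv)
    (auto intro!: derivative_eq_intros smooth_fnD(1)[OF u] smooth_fnD(1)[OF h])

lemma perturb_pos: "\<forall>\<^sub>F \<epsilon> in nhds 0. 0 < u x + \<epsilon> * h x"
proof -
  have "((\<lambda>\<epsilon>. u x + \<epsilon> * h x) \<longlongrightarrow> u x + 0 * h x) (nhds 0)"
    by (intro tendsto_intros) (simp add: filterlim_ident)
  then show ?thesis using pos[of x] by (simp add: order_tendsto_iff)
qed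

lemma has_deriv_along:
  assumes f: "smooth2_on ({0<..} \<times> UNIV) f"
  shows "((\<lambda>\<epsilon>. f (u x + \<epsilon> * h x) (deriv u x + \<epsilon> * deriv h x)) has_real_derivative
      pd1 f (u x) (deriv u x) * h x + pd2 f (u x) (deriv u x) * deriv h x) (at 0)"
proof -
  have "((\<lambda>\<epsilon>. u x + \<epsilon> * h x) has_real_derivative h x) (at 0)"
    "((\<lambda>\<epsilon>. deriv u x + \<epsilon> * deriv h x) has_real_derivative deriv h x) (at 0)"
    by (auto intro!: derivative_eq_intros)
  from smooth2_chain[OF f _ this] pos[of x] show ?thesis by simp
qed

lemma has_deriv_space:
  assumes f: "smooth2_on ({0<..} \<times> UNIV) f" and "0 < u x + \<epsilon> * h x"
  shows "((\<lambda>\<xi>. f (u \<xi> + \<epsilon> * h \<xi>) (deriv u \<xi> + \<epsilon> * deriv h \<xi>)) has_real_derivative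
      pd1 f (u x + \<epsilon> * h x) (deriv u x + \<epsilon> * deriv h x) * (deriv u x + \<epsilon> * deriv h x)
      + pd2 f (u x + \<epsilon> * h x) (deriv u x + \<epsilon> * deriv h x) *
          (deriv (deriv u) x + \<epsilon> * deriv (deriv h) x)) (at x)"
  using assms
  by (intro smooth2_chain[OF f])
    (auto intro!: derivative_eq_intros smooth_fnD[OF u] smooth_fnD[OF h]
        smooth_fnD(1)[OF smooth_fnD(2)[OF u]] smooth_fnD(1)[OF smooth_fnD(2)[OF h]])

lemma lin_legendre_correct:
  "((\<lambda>\<epsilon>. legendre E (\<lambda>\<xi>. u \<xi> + \<epsilon> * h \<xi>) x) has_real_derivative lin_legendre deriv E u h x) (at 0)"
  unfolding legendre_def lin_legendre_def deriv_perturb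
  by (auto intro!: derivative_eq_intros has_deriv_along[OF E]
      has_deriv_along[OF smooth2_onD(5)[OF E]])

lemma lin_euler_correct:
  "((\<lambda>\<epsilon>. euler E (\<lambda>\<xi>. u \<xi> + \<epsilon> * h \<xi>) x) has_real_derivative lin_euler deriv E u h x) (at 0)"
proof -
  note E2 = smooth2_onD(5)[OF E]
  note E12 = smooth2_onD(4)[OF E2] and E22 = smooth2_onD(5)[OF E2]
  let ?f = "\<lambda>\<epsilon>. pd1 E (u x + \<epsilon> * h x) (deriv u x + \<epsilon> * deriv h x)
      - (pd1 (pd2 E) (u x + \<epsilon> * h x) (deriv u x + \<epsilon> * deriv h x) * (deriv u x + \<epsilon> * deriv h x)
      + pd2 (pd2 E) (u x + \<epsilon> * h x) (deriv u x + \<epsilon> * deriv h x) *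
          (deriv (deriv u) x + \<epsilon> * deriv (deriv h) x))"
  have space: "deriv (\<lambda>\<xi>. of_real (pd1 (pd2 E) (u \<xi>) (deriv u \<xi>)) * h \<xi>
               + of_real (pd2 (pd2 E) (u \<xi>) (deriv u \<xi>)) * deriv h \<xi>) x =
      (pd1 (pd1 (pd2 E)) (u x) (deriv u x) * deriv u x
        + pd2 (pd1 (pd2 E)) (u x) (deriv u x) * deriv (deriv u) x) * h x
      + pd1 (pd2 E) (u x) (deriv u x) * deriv h x
      + ((pd1 (pd2 (pd2 E)) (u x) (deriv u x) * deriv u x
        + pd2 (pd2 (pd2 E)) (u x) (deriv u x) * deriv (deriv u) x) * deriv h x
      + pd2 (pd2 E) (u x) (deriv u x) * deriv (deriv h) x)"
    using has_deriv_space[OF E12, of x 0] has_deriv_space[OF E22, of x 0] pos[of x]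
    by (intro DERIV_imp_deriv)
      (auto intro!: derivative_eq_intros smooth_fnD(1)[OF h] smooth_fnD(1)[OF smooth_fnD(2)[OF h]])
  have "(?f has_real_derivative lin_euler deriv E u h x) (at 0)"
    unfolding lin_euler_def space
    by (rule derivative_eq_intros has_deriv_along[OF smooth2_onD(4)[OF E]] has_deriv_along[OF E12]
        has_deriv_along[OF E22] refl)+
      (simp add: pd_commute[OF E2 pos] algebra_simps)
  moreover have "\<forall>\<^sub>F \<epsilon> in nhds 0. euler E (\<lambda>\<xi>. u \<xi> + \<epsilon> * h \<xi>) x = ?f \<epsilon>"
    using perturb_pos[of x]
  proof eventually_elim
    case (elim \<epsilon>)
    then show ?case
      unfolding euler_def deriv_perturb by (simp add: DERIV_imp_deriv[OF has_deriv_space[OF E2 elim]])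
  qed
  ultimately show ?thesis by (subst DERIV_cong_ev[OF refl _ refl])
qed

theorem lin_EKE_flux_correct:
  "((\<lambda>\<epsilon>. EKE_flux E j (\<lambda>\<xi>. u \<xi> + \<epsilon> * h \<xi>) (\<lambda>\<xi>. \<epsilon> * q \<xi>) x) has_real_derivative
     lin_EKE_flux deriv E j u h q x) (at 0)"
proof -
  have "((\<lambda>\<epsilon>. (\<epsilon> * q x + j)\<^sup>2 / (u x + \<epsilon> * h x)) has_real_derivative
      2 * j / u x * q x - j\<^sup>2 / (u x)\<^sup>2 * h x) (at 0)"
    using pos[of x]
    by (auto intro!: derivative_eq_intros simp: power2_eq_square diff_divide_distrib)
  moreover have "((\<lambda>\<epsilon>. (u x + \<epsilon> * h x) * euler E (\<lambda>\<xi>. u \<xi> + \<epsilon> * h \<xi>) x) has_real_derivative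
      euler E u x * h x + u x * lin_euler deriv E u h x) (at 0)"
    by (rule derivative_eq_intros lin_euler_correct refl)+ simp
  ultimately show ?thesis
    unfolding EKE_flux_def lin_EKE_flux_def
    by (rule DERIV_cong[OF DERIV_add[OF DERIV_add lin_legendre_correct]]) simp
qed

theorem lin_EKL_flux_correct:
  "((\<lambda>\<epsilon>. EKL_flux E j (\<lambda>\<xi>. u \<xi> + \<epsilon> * h \<xi>) (\<lambda>\<xi>. \<epsilon> * q \<xi>) x) has_real_derivative
     lin_EKL_flux deriv E j u h q x) (at 0)"
  unfolding EKL_flux_def lin_EKL_flux_def
  by (rule derivative_eq_intros lin_euler_correct refl)+ simp

end

end

theory Submission
  imports Defs
begin

text \<open>
  For \<open>\<nu> = 0\<close> the first equation \<open>q' = F\<close> has no square integrable solution when \<open>F\<close> has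
  nonzero mean, so \<open>0\<close> lies in both spectra. For \<open>\<nu> \<noteq> 0\<close> one may assume that the first component
  of the right-hand side vanishes: with \<open>K = (1 + d/dx)\<^sup>-\<^sup>1\<close> one has \<open>F - K\<^sup>3 F = ((K + K\<^sup>2 + K\<^sup>3) F)'\<close>,
  which solves the first equation inside the domain. The first unknown is then \<open>- q' / \<nu>\<close>, resp.
  \<open>z' / \<nu>\<close>, and a scalar equation for \<open>q\<close>, resp. \<open>z\<close>, remains. The substitution
  \<open>q = \<rho> (z \<circ> Y)\<close> turns one scalar equation into the other, because the nonlinear fluxes satisfy
  \<open>\<Phi>[\<rho>] = - \<Psi>[v] \<circ> Y\<close> whenever \<open>v \<circ> Y = 1 / \<rho>\<close> and \<open>Y' = \<rho>\<close>; linearizing this identity, the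
  displacement of \<open>Y\<close> only contributes a multiple of \<open>\<Psi>[v]'\<close>, which is zero for a stationary
  solution.
\<close>

section \<open>Weak derivatives\<close>

text \<open>Let \<open>N\<close> be a displacement of \<open>Y\<close>, so that
  \<open>r = N'\<close>. Linearizing \<open>v \<circ> Y = 1 / \<rho>\<close> gives
  \<open>w \<circ> Y = - r / \<rho>\<^sup>2 - (v' \<circ> Y) N\<close>. Thus \<open>w\<close>
  depends on \<open>r\<close> through an antiderivative, which in general is not a bounded operation
  on square integrable functions, so the two operators cannot simply be conjugated on pairs. If the
  first component of the right-hand side vanishes and \<open>\<nu> \<noteq> 0\<close>, however, the
  first equation supplies the local expression \<open>N = - q / \<nu>\<close>; this is the reason
  for normalizing the data and passing to a scalar equation. Inserting it and solving for
  \<open>w\<close> gives \<open>w = ((q / \<rho>) \<circ> X)' / \<nu>\<close> with \<open>X\<close>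
  inverse to \<open>Y\<close>, and comparison with \<open>w = z' / \<nu>\<close> is the origin of
  the substitution. The third power of \<open>K\<close> is needed because the correction it
  contributes to the first unknown must lie in \<open>sobolev 3\<close>. Since \<open>wderiv\<close>
  is an arbitrary representative, the computations use explicit weak derivatives and return to
  \<open>wderiv\<close> only almost everywhere.\<close>

definition antiderivative :: "(real \<Rightarrow> complex) \<Rightarrow> (real \<Rightarrow> complex) \<Rightarrow> bool" where
  "antiderivative h g \<longleftrightarrow> (\<forall>a b. a \<le> b \<longrightarrow>
     set_integrable lborel {a..b} g \<and> h b - h a = (LINT x:{a..b}|lborel. g x))"

lemma has_weak_deriv_antiderivative:
  "has_weak_deriv f g \<longleftrightarrow> (\<exists>h. (AE x in lborel. f x = h x) \<and> antiderivative h g)"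
  unfolding has_weak_deriv_def antiderivative_def ..

lemma antiderivativeD:
  assumes "antiderivative h g" "a \<le> b"
  shows "set_integrable lborel {a..b} g" "h b - h a = (LINT x:{a..b}|lborel. g x)"
    "g integrable_on {a..b}" "h b - h a = integral {a..b} g"
  using assms set_borel_integral_eq_integral[of "{a..b}" g]
  unfolding antiderivative_def by auto

lemma antiderivative_integrable_on:
  assumes "antiderivative h g" shows "g integrable_on {a..b}"
  using antiderivativeD(3)[OF assms, of a b] by (cases "a \<le> b") auto

lemma antiderivative_continuous:
  assumes h: "antiderivative h g" shows "continuous_on UNIV h"
proof -
  have "continuous (at x) h" for x
  proof -
    have "continuous_on {x-1..x+1} (\<lambda>y. h (x-1) + integral {x-1..y} g)"
      by (intro continuous_intros indefinite_integral_continuous_1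
          antiderivative_integrable_on[OF h])
    moreover have "h (x-1) + integral {x-1..y} g = h y" if "y \<in> {x-1..x+1}" for y
      using antiderivativeD(4)[OF h, of "x-1" y] that by (auto simp: algebra_simps)
    ultimately have "continuous_on {x-1..x+1} h" by (rule continuous_on_eq)
    then show ?thesis by (rule continuous_on_interior) simp
  qed
  then show ?thesis by (simp add: continuous_at_imp_continuous_on)
qed

text \<open>\<open>g\<close> is the pointwise limit of its truncations to \<open>[-n, n]\<close>,
  each of which is integrable and hence Borel measurable.\<close>

lemma antiderivative_measurable:
  assumes h: "antiderivative h g" shows "g \<in> borel_measurable borel"
proof (rule borel_measurable_LIMSEQ_metric)
  fix n :: nat
  have "set_integrable lborel {- real n..real n} g"
    using antiderivativeD(1)[OF h] by simp
  then show "(\<lambda>x. indicator {- real n..real n} x *\<^sub>R g x) \<in> borel_measurable borel"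
    unfolding set_integrable_def using borel_measurable_integrable by fastforce
next
  fix x :: real
  obtain N :: nat where "\<bar>x\<bar> \<le> real N" using real_arch_simple by blast
  then have "\<forall>\<^sub>F n in sequentially. indicator {- real n..real n} x *\<^sub>R g x = g x"
    by (intro eventually_sequentiallyI[of N]) (auto simp: indicator_def)
  then show "(\<lambda>n. indicator {- real n..real n} x *\<^sub>R g x) \<longlonglongrightarrow> g x"
    by (rule tendsto_eventually)
qed

text \<open>\<open>negligible\<close> refers to Lebesgue null sets; one that is also Borel, as
  \<open>meas\<close> provides, is a null set of \<open>lborel\<close>.\<close>

lemma AE_lborel_negligible:
  assumes N: "negligible N" and P: "\<And>x::real. x \<notin> N \<Longrightarrow> P x"
    and meas: "{x. \<not> P x} \<in> sets borel"
  shows "AE x in lborel. P x"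
proof -
  have "negligible {x. \<not> P x}" using P by (intro negligible_subset[OF N]) auto
  then have "{x. \<not> P x} \<in> null_sets lebesgue" by (simp add: negligible_iff_null_sets)
  then have "{x. \<not> P x} \<in> null_sets lborel" using meas by (auto simp: null_sets_def)
  then show ?thesis by (auto intro: AE_I')
qed

text \<open>Two continuous functions differ on an open set, and a nonempty open set is not
  null.\<close>

lemma AE_lborel_continuous_eq:
  fixes f g :: "real \<Rightarrow> complex"
  assumes ae: "AE x in lborel. f x = g x"
    and "continuous_on UNIV f" "continuous_on UNIV g"
  shows "f = g"
proof -
  have op: "open {x. f x \<noteq> g x}"
    using assms(2,3) by (rule open_Collect_neq)
  have "{x. f x \<noteq> g x} \<in> sets borel" using op by simp
  moreover have "emeasure lborel {x. f x \<noteq> g x} = 0"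
    using ae op by (subst (asm) AE_iff_measurable[where N = "{x. f x \<noteq> g x}"]) auto
  ultimately have "{x. f x \<noteq> g x} \<in> null_sets lebesgue"
    by (simp add: null_sets_def)
  then have "negligible {x. f x \<noteq> g x}" by (simp add: negligible_iff_null_sets)
  then have "{x. f x \<noteq> g x} = {}" using open_not_negligible[OF op] by blast
  then show ?thesis by auto
qed

text \<open>Lebesgue differentiation: all interval integrals of \<open>g - g'\<close> vanish, hence
  so do its averages over shrinking intervals, and these converge to \<open>g - g'\<close> off a
  null set.\<close>

lemma antiderivative_unique:
  assumes "antiderivative h g" "antiderivative h g'"
  shows "AE x in lborel. g x = g' x"
proof -
  have [measurable]: "g \<in> borel_measurable borel" "g' \<in> borel_measurable borel"
    using assms antiderivative_measurable by auto
  have int: "(\<lambda>x. g x - g' x) integrable_on cbox a b" for a b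
    using antiderivative_integrable_on[OF assms(1)] antiderivative_integrable_on[OF assms(2)]
    by (auto intro: integrable_diff)
  have zero: "integral (cbox a b) (\<lambda>x. g x - g' x) = 0" for a b
  proof (cases "a \<le> b")
    case True
    then show ?thesis
      using antiderivativeD(4)[OF assms(1) True] antiderivativeD(4)[OF assms(2) True]
        antiderivative_integrable_on[OF assms(1)] antiderivative_integrable_on[OF assms(2)]
      by (simp add: Henstock_Kurzweil_Integration.integral_diff)
  qed auto
  obtain N where N: "negligible N" "\<And>x e. \<lbrakk>x \<notin> N; 0 < e\<rbrakk> \<Longrightarrow>
     \<exists>d>0. \<forall>h. 0 < h \<and> h < d \<longrightarrow>
       norm(integral (cbox x (x + h *\<^sub>R One)) (\<lambda>x. g x - g' x) /\<^sub>R h ^ DIM(real) - (g x - g' x)) < e"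
    by (rule integrable_ccontinuous_explicit[OF int]) blast
  show ?thesis
  proof (rule AE_lborel_negligible[OF N(1)])
    fix x assume x: "x \<notin> N"
    have "norm (g x - g' x) < e" if e: "e > 0" for e
    proof -
      obtain d where "d > 0" and d: "\<forall>h. 0 < h \<and> h < d \<longrightarrow>
          norm(integral (cbox x (x + h *\<^sub>R One)) (\<lambda>x. g x - g' x) /\<^sub>R h ^ DIM(real) - (g x - g' x)) < e"
        using N(2)[OF x e] by (elim exE conjE)
      then show ?thesis using d[rule_format, of "d/2"]
        unfolding zero scaleR_zero_right diff_0 norm_minus_cancel by simp
    qed
    then show "g x = g' x" by (metis less_irrefl right_minus_eq zero_less_norm_iff)
  qed measurable
qed

text \<open>The locally absolutely continuous representatives of \<open>f\<close> are continuous and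
  agree almost everywhere, hence everywhere; this reduces the claim to one function
  \<open>h\<close>.\<close>

lemma has_weak_deriv_unique:
  assumes "has_weak_deriv f g" "has_weak_deriv f g'"
  shows "AE x in lborel. g x = g' x"
proof -
  obtain h h' where h: "AE x in lborel. f x = h x" "antiderivative h g"
    and h': "AE x in lborel. f x = h' x" "antiderivative h' g'"
    using assms unfolding has_weak_deriv_antiderivative by blast
  have "AE x in lborel. h x = h' x" using h(1) h'(1) by eventually_elim simp
  then have "h = h'" using h(2) h'(2) by (intro AE_lborel_continuous_eq antiderivative_continuous)
  then show ?thesis using h(2) h'(2) antiderivative_unique by blast
qed

lemma has_weak_deriv_cong_left:
  assumes "AE x in lborel. f x = f' x"
  shows "has_weak_deriv f g \<longleftrightarrow> has_weak_deriv f' g"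
proof -
  have "(AE x in lborel. f x = h x) \<longleftrightarrow> (AE x in lborel. f' x = h x)" for h
    by (rule eventually_subst) (use assms in eventually_elim, simp)
  then show ?thesis unfolding has_weak_deriv_def by simp
qed

text \<open>Both arguments have the same set of weak derivatives, so \<open>SOME\<close> picks the
  same one. The conclusion is an equality of functions and can be used for rewriting.\<close>

lemma wderiv_cong:
  assumes "AE x in lborel. f x = f' x"
  shows "wderiv f = wderiv f'"
  unfolding wderiv_def has_weak_deriv_cong_left[OF assms] ..

lemma has_weak_deriv_measurable:
  assumes "has_weak_deriv f g" shows "g \<in> borel_measurable borel"
  using assms antiderivative_measurable unfolding has_weak_deriv_antiderivative by blast

lemma has_weak_deriv_wderiv:
  assumes "has_weak_deriv f g" shows "has_weak_deriv f (wderiv f)"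
  unfolding wderiv_def by (rule someI[of "has_weak_deriv f", OF assms])

lemma wderiv_AE:
  assumes "has_weak_deriv f g" shows "AE x in lborel. wderiv f x = g x"
  using has_weak_deriv_unique[OF has_weak_deriv_wderiv[OF assms] assms] .

lemma antiderivative_cong_right:
  assumes h: "antiderivative h g" and ae: "AE x in lborel. g x = g' x"
    and [measurable]: "g' \<in> borel_measurable borel"
  shows "antiderivative h g'"
proof -
  have [measurable]: "g \<in> borel_measurable borel" by (rule antiderivative_measurable[OF h])
  show ?thesis unfolding antiderivative_def
  proof (intro allI impI conjI)
    fix a b :: real assume ab: "a \<le> b"
    have ae': "AE x in lborel. indicator {a..b} x *\<^sub>R g x = indicator {a..b} x *\<^sub>R g' x"
      using ae by eventually_elim simp
    show "set_integrable lborel {a..b} g'"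
      using antiderivativeD(1)[OF h ab] integrable_cong_AE[OF _ _ ae']
      unfolding set_integrable_def by simp
    show "h b - h a = (LINT x:{a..b}|lborel. g' x)"
      using antiderivativeD(2)[OF h ab] integral_cong_AE[OF _ _ ae']
      unfolding set_lebesgue_integral_def by simp
  qed
qed

lemma has_weak_deriv_cong_right:
  assumes "has_weak_deriv f g" "AE x in lborel. g x = g' x" "g' \<in> borel_measurable borel"
  shows "has_weak_deriv f g'"
  using assms antiderivative_cong_right unfolding has_weak_deriv_antiderivative by blast

lemma antiderivative_add:
  assumes "antiderivative h g" "antiderivative h' g'"
  shows "antiderivative (\<lambda>x. h x + h' x) (\<lambda>x. g x + g' x)"
  unfolding antiderivative_def
proof (intro allI impI conjI)
  fix a b :: real assume ab: "a \<le> b"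
  note 1 = antiderivativeD[OF assms(1) ab] and 2 = antiderivativeD[OF assms(2) ab]
  show "set_integrable lborel {a..b} (\<lambda>x. g x + g' x)" using 1 2 by (simp add: set_integral_add)
  show "h b + h' b - (h a + h' a) = (LINT x:{a..b}|lborel. g x + g' x)"
    using 1 2 by (simp add: set_integral_add algebra_simps)
qed

lemma antiderivative_cmult:
  assumes "antiderivative h g"
  shows "antiderivative (\<lambda>x. c * h x) (\<lambda>x. c * g x)"
  using assms unfolding antiderivative_def by (auto simp flip: right_diff_distrib)

lemma has_weak_deriv_add:
  assumes "has_weak_deriv f g" "has_weak_deriv f' g'"
  shows "has_weak_deriv (\<lambda>x. f x + f' x) (\<lambda>x. g x + g' x)"
proof -
  obtain h h' where h: "AE x in lborel. f x = h x" "antiderivative h g"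
    and h': "AE x in lborel. f' x = h' x" "antiderivative h' g'"
    using assms unfolding has_weak_deriv_antiderivative by blast
  have "AE x in lborel. f x + f' x = h x + h' x" using h(1) h'(1) by eventually_elim simp
  then show ?thesis unfolding has_weak_deriv_antiderivative
    by (intro exI[of _ "\<lambda>x. h x + h' x"] conjI antiderivative_add[OF h(2) h'(2)])
qed

lemma has_weak_deriv_cmult:
  assumes "has_weak_deriv f g"
  shows "has_weak_deriv (\<lambda>x. c * f x) (\<lambda>x. c * g x)"
proof -
  obtain h where h: "AE x in lborel. f x = h x" "antiderivative h g"
    using assms unfolding has_weak_deriv_antiderivative by blast
  have "AE x in lborel. c * f x = c * h x" using h(1) by eventually_elim simp
  then show ?thesis unfolding has_weak_deriv_antiderivative
    by (intro exI[of _ "\<lambda>x. c * h x"] conjI antiderivative_cmult[OF h(2)])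
qed

text \<open>\<open>h\<close> need not be differentiable everywhere, so the rule is obtained from
  Fubini on the triangle \<open>a \<le> t \<le> x \<le> b\<close> for \<open>c' x * g t\<close>.
  Integrating first in \<open>t\<close> gives \<open>c' x * (h x - h a)\<close>, first in
  \<open>x\<close> gives \<open>(c b - c t) * g t\<close>; equating the two integrals is integration
  by parts.\<close>

lemma antiderivative_mult:
  fixes c c' :: "real \<Rightarrow> real"
  assumes h: "antiderivative h g"
    and c: "\<And>x. (c has_real_derivative c' x) (at x)" and c': "continuous_on UNIV c'"
  shows "antiderivative (\<lambda>x. of_real (c x) * h x) (\<lambda>x. of_real (c' x) * h x + of_real (c x) * g x)"
  unfolding antiderivative_def
proof (intro allI impI)
  fix a b :: real assume ab: "a \<le> b"
  have cc: "continuous_on UNIV c" using c by (meson DERIV_isCont continuous_at_imp_continuous_on)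
  have hc: "continuous_on UNIV h" by (rule antiderivative_continuous[OF h])
  have [measurable]: "g \<in> borel_measurable borel" by (rule antiderivative_measurable[OF h])
  have [measurable]: "c \<in> borel_measurable borel" "c' \<in> borel_measurable borel" "h \<in> borel_measurable borel"
    using cc c' hc by (auto intro: borel_measurable_continuous_onI)
  have sub: "continuous_on S c" "continuous_on S c'" "continuous_on S h" for S
    using cc c' hc by (auto intro: continuous_on_subset)
  have ig: "integrable lborel (\<lambda>t. indicator {a..b} t *\<^sub>R g t)"
    using antiderivativeD(1)[OF h ab] by (simp add: set_integrable_def)
  have bound: "\<exists>C. \<forall>x\<in>{a..b}. \<bar>f x\<bar> \<le> C" if "continuous_on {a..b} f" for f :: "real \<Rightarrow> real"
  proof -
    have "bounded (f ` {a..b})" using that by (intro compact_imp_bounded compact_continuous_image) auto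
    then show ?thesis by (auto simp: bounded_iff)
  qed
  obtain C where C: "\<And>x. x \<in> {a..b} \<Longrightarrow> \<bar>c x\<bar> \<le> C" using bound[OF sub(1)] by blast
  obtain C' where C': "\<And>x. x \<in> {a..b} \<Longrightarrow> \<bar>c' x\<bar> \<le> C'" using bound[OF sub(2)] by blast
  have icg: "set_integrable lborel {a..b} (\<lambda>x. of_real (c x) * g x)"
    unfolding set_integrable_def
  proof (rule Bochner_Integration.integrable_bound[OF integrable_mult_right[OF ig, of "of_real C"]])
    show "AE x in lborel. norm (indicator {a..b} x *\<^sub>R (of_real (c x) * g x))
        \<le> norm (of_real C * (indicator {a..b} x *\<^sub>R g x))"
      using C by (intro AE_I2) (fastforce simp: norm_mult indicator_def intro: mult_right_mono)
  qed simp
  have ich: "set_integrable lborel {a..b} (\<lambda>x. of_real (c' x) * h x)"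
    by (intro borel_integrable_atLeastAtMost' continuous_intros sub)
  define k where "k x t = (if a \<le> t \<and> t \<le> x \<and> x \<le> b then of_real (c' x) * g t else 0)" for x t
  have [measurable]: "case_prod k \<in> borel_measurable (lborel \<Otimes>\<^sub>M lborel)"
    unfolding k_def by measurable
  have ftc: "(LINT x:{t..b}|lborel. of_real (c' x) :: complex) = of_real (c b) - of_real (c t)" if "t \<le> b" for t
    unfolding set_lebesgue_integral_def
    by (rule integral_FTC_atLeastAtMost[OF that])
      (auto intro!: continuous_intros sub has_vector_derivative_of_real has_field_derivative_at_within c)
  have int_t: "(LINT t|lborel. k x t) = indicator {a..b} x *\<^sub>R (of_real (c' x) * (h x - h a))" for x
  proof (cases "x \<in> {a..b}")
    case True
    then have "k x t = of_real (c' x) * (indicator {a..x} t *\<^sub>R g t)" for t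
      by (auto simp: k_def indicator_def)
    then have "(LINT t|lborel. k x t) = of_real (c' x) * (LINT t|lborel. indicator {a..x} t *\<^sub>R g t)"
      by (simp only: integral_mult_right_zero)
    then show ?thesis using True antiderivativeD(2)[OF h, of a x]
      by (simp add: set_lebesgue_integral_def)
  next
    case False
    then have "k x t = 0" for t by (auto simp: k_def)
    then show ?thesis using False by simp
  qed
  have int_x: "(LINT x|lborel. k x t) = indicator {a..b} t *\<^sub>R (of_real (c b - c t) * g t)" for t
  proof (cases "t \<in> {a..b}")
    case True
    then have "k x t = (indicator {t..b} x *\<^sub>R of_real (c' x)) * g t" for x
      by (auto simp: k_def indicator_def)
    then have "(LINT x|lborel. k x t) = (LINT x|lborel. indicator {t..b} x *\<^sub>R of_real (c' x)) * g t"
      by (simp only: integral_mult_left_zero)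
    then show ?thesis using True ftc[of t]
      by (simp add: set_lebesgue_integral_def)
  next
    case False
    then have "k x t = 0" for x by (auto simp: k_def)
    then show ?thesis using False by simp
  qed
  interpret lborel_pair: pair_sigma_finite lborel lborel ..
  \<comment> \<open>\<open>?D\<close> dominates \<open>k\<close> on the square and is a product of
    functions of one variable each, so its integrability follows from iterated integrals.\<close>
  have "integrable (lborel \<Otimes>\<^sub>M lborel)
      (\<lambda>p. of_real (C' * indicator {a..b} (fst p)) * (indicator {a..b} (snd p) *\<^sub>R g (snd p)))"
    (is "integrable _ ?D")
  proof (rule lborel_pair.Fubini_integrable)
    have "(\<lambda>x. LINT y|lborel. norm (?D (x, y))) =
       (\<lambda>x. \<bar>C'\<bar> * indicator {a..b} x * (LINT y|lborel. norm (indicator {a..b} y *\<^sub>R g y)))"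
      unfolding integral_mult_right_zero[symmetric]
      by (intro ext Bochner_Integration.integral_cong) (auto simp: norm_mult abs_mult)
    moreover have "integrable lborel (indicator {a..b} :: real \<Rightarrow> real)"
      by (simp add: integrable_indicator_iff emeasure_lborel_Icc_eq)
    ultimately show "integrable lborel (\<lambda>x. LINT y|lborel. norm (?D (x, y)))" by simp
    show "AE x in lborel. integrable lborel (\<lambda>y. ?D (x, y))"
      using integrable_mult_right[OF ig] by (intro AE_I2) simp
  qed measurable
  then have ik: "integrable (lborel \<Otimes>\<^sub>M lborel) (case_prod k)"
  proof (rule Bochner_Integration.integrable_bound)
    show "AE p in lborel \<Otimes>\<^sub>M lborel. norm (case_prod k p) \<le> norm (?D p)"
    proof (rule AE_I2)
      fix p
      show "norm (case_prod k p) \<le> norm (?D p)"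
        using C'[of "fst p"] by (cases p) (auto simp: k_def norm_mult indicator_def intro!: mult_right_mono)
    qed
  qed simp
  have fub: "(LINT t:{a..b}|lborel. of_real (c b - c t) * g t) = (LINT x:{a..b}|lborel. of_real (c' x) * (h x - h a))"
    using lborel_pair.Fubini_integral[OF ik] unfolding int_t int_x set_lebesgue_integral_def .
  have ic': "set_integrable lborel {a..b} (\<lambda>x. of_real (c' x) :: complex)"
    by (intro borel_integrable_atLeastAtMost' continuous_intros sub)
  have "(LINT t:{a..b}|lborel. of_real (c b - c t) * g t) =
      of_real (c b) * (LINT t:{a..b}|lborel. g t) - (LINT t:{a..b}|lborel. of_real (c t) * g t)"
    using icg antiderivativeD(1)[OF h ab]
    by (simp add: left_diff_distrib set_integral_diff)
  moreover have "(LINT x:{a..b}|lborel. of_real (c' x) * (h x - h a)) =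
      (LINT x:{a..b}|lborel. of_real (c' x) * h x) - (of_real (c b) - of_real (c a)) * h a"
    using ich ic' ftc[OF ab] by (simp add: right_diff_distrib set_integral_diff)
  ultimately have eq: "of_real (c b) * h b - of_real (c a) * h a =
     (LINT x:{a..b}|lborel. of_real (c' x) * h x) + (LINT t:{a..b}|lborel. of_real (c t) * g t)"
    using fub antiderivativeD(2)[OF h ab] by algebra
  show "set_integrable lborel {a..b} (\<lambda>x. of_real (c' x) * h x + of_real (c x) * g x) \<and>
     of_real (c b) * h b - of_real (c a) * h a = (LINT x:{a..b}|lborel. of_real (c' x) * h x + of_real (c x) * g x)"
    unfolding eq using ich icg by (simp add: set_integral_add)
qed

lemma has_weak_deriv_mult:
  fixes c c' :: "real \<Rightarrow> real"
  assumes "has_weak_deriv f g" and f: "f \<in> borel_measurable borel"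
    and c: "\<And>x. (c has_real_derivative c' x) (at x)" and c': "continuous_on UNIV c'"
  shows "has_weak_deriv (\<lambda>x. of_real (c x) * f x) (\<lambda>x. of_real (c' x) * f x + of_real (c x) * g x)"
proof -
  obtain h where h: "AE x in lborel. f x = h x" "antiderivative h g"
    using assms unfolding has_weak_deriv_antiderivative by blast
  have "continuous_on UNIV c" using c by (meson DERIV_isCont continuous_at_imp_continuous_on)
  then have [measurable]: "c \<in> borel_measurable borel" "c' \<in> borel_measurable borel"
    "f \<in> borel_measurable borel" "g \<in> borel_measurable borel"
    using c' f antiderivative_measurable[OF h(2)] by (auto intro: borel_measurable_continuous_onI)
  have "AE x in lborel. of_real (c' x) * h x + of_real (c x) * g x = of_real (c' x) * f x + of_real (c x) * g x"
    using h(1) by eventually_elim simp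
  then have "antiderivative (\<lambda>x. of_real (c x) * h x) (\<lambda>x. of_real (c' x) * f x + of_real (c x) * g x)"
    by (rule antiderivative_cong_right[OF antiderivative_mult[OF h(2) c c']]) measurable
  moreover have "AE x in lborel. of_real (c x) * f x = of_real (c x) * h x"
    using h(1) by eventually_elim simp
  ultimately show ?thesis
    unfolding has_weak_deriv_antiderivative by (intro exI[of _ "\<lambda>x. of_real (c x) * h x"] conjI)
qed

section \<open>Change of variables\<close>

text \<open>The inverse and its derivative are part of the data, so that the hypotheses are
  symmetric under exchanging \<open>Y\<close>, \<open>\<rho>\<close> with \<open>X\<close>,
  \<open>v\<close>; through \<open>swap\<close> each result holds in both directions.\<close>

locale line_diffeo =
  fixes Y X \<rho> v :: "real \<Rightarrow> real"
  assumes Y_X: "\<And>y. Y (X y) = y" and X_Y: "\<And>x. X (Y x) = x"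
    and Y_deriv: "\<And>x. (Y has_real_derivative \<rho> x) (at x)"
    and X_deriv: "\<And>y. (X has_real_derivative v y) (at y)"
    and \<rho>_pos: "\<And>x. 0 < \<rho> x" and v_pos: "\<And>y. 0 < v y"
    and \<rho>_cont: "continuous_on UNIV \<rho>" and v_cont: "continuous_on UNIV v"
begin

lemma swap: "line_diffeo X Y v \<rho>"
  by unfold_locales (use Y_X X_Y Y_deriv X_deriv \<rho>_pos v_pos \<rho>_cont v_cont in auto)

lemma Y_continuous: "continuous_on UNIV Y"
  using Y_deriv by (meson DERIV_isCont continuous_at_imp_continuous_on)

lemma measurable_Y [measurable]: "Y \<in> borel_measurable borel"
  using Y_continuous by (rule borel_measurable_continuous_onI)

lemma measurable_\<rho> [measurable]: "\<rho> \<in> borel_measurable borel"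
  using \<rho>_cont by (rule borel_measurable_continuous_onI)

lemma Y_strict_mono: "strict_mono Y"
  by (rule strict_monoI, rule DERIV_pos_imp_increasing) (use Y_deriv \<rho>_pos in blast)+

lemma Y_less_iff [simp]: "Y a < Y b \<longleftrightarrow> a < b" and Y_le_iff [simp]: "Y a \<le> Y b \<longleftrightarrow> a \<le> b"
  using Y_strict_mono by (simp_all add: strict_mono_less strict_mono_less_eq)

text \<open>It suffices to compare the measures of bounded open intervals. The preimage of
  \<open>(l, u)\<close> is \<open>(X l, X u)\<close>, over which \<open>\<rho> = Y'\<close>
  integrates to \<open>u - l\<close>. The substitution rules below are transfers along this
  identity.\<close>

lemma lborel_eq_distr: "lborel = distr (density lborel (\<lambda>x. ennreal (\<rho> x))) borel Y"
proof (rule lborel_eqI)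
  fix l u :: real assume "\<And>b. b \<in> Basis \<Longrightarrow> l \<bullet> b \<le> u \<bullet> b"
  then have lu: "l \<le> u" by simp
  then have X: "X l \<le> X u" using Y_le_iff[of "X l" "X u"] by (simp add: Y_X)
  have "Y -` {l<..<u} = {X l<..<X u}"
    using Y_less_iff[of "X l"] Y_less_iff[of _ "X u"] by (auto simp: Y_X)
  then have "emeasure (distr (density lborel (\<lambda>x. ennreal (\<rho> x))) borel Y) {l<..<u} =
      (\<integral>\<^sup>+x. ennreal (\<rho> x) * indicator {X l<..<X u} x \<partial>lborel)"
    by (simp add: emeasure_distr emeasure_density)
  also have "\<dots> = ennreal (u - l)"
  proof (rule nn_integral_has_integral_lebesgue')
    have "(\<rho> has_integral (Y (X u) - Y (X l))) {X l..X u}"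
      using X by (rule fundamental_theorem_of_calculus)
        (auto intro!: has_field_derivative_at_within[OF Y_deriv]
          simp flip: has_real_derivative_iff_has_vector_derivative)
    then show "(\<rho> has_integral (u - l)) {X l<..<X u}" by (simp add: Y_X has_integral_Icc_iff_Ioo)
  qed (simp add: \<rho>_pos less_imp_le)
  finally show "emeasure (distr (density lborel (\<lambda>x. ennreal (\<rho> x))) borel Y) (box l u) = (\<Prod>b\<in>Basis. (u - l) \<bullet> b)"
    by simp
qed simp

lemma AE_comp:
  assumes "AE y in lborel. P y" shows "AE x in lborel. P (Y x)"
proof -
  have "AE x in density lborel (\<lambda>x. ennreal (\<rho> x)). P (Y x)"
    by (rule AE_distrD[where M' = borel and P = P]) (simp, subst lborel_eq_distr[symmetric], rule assms)
  then show ?thesis by (simp add: AE_density \<rho>_pos)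
qed

lemma integrable_comp:
  fixes f :: "real \<Rightarrow> 'b :: {banach, second_countable_topology}"
  assumes [measurable]: "f \<in> borel_measurable borel"
  shows "integrable lborel f \<longleftrightarrow> integrable lborel (\<lambda>x. \<rho> x *\<^sub>R f (Y x))"
  by (subst lborel_eq_distr, subst integrable_distr_eq)
    (simp_all add: integrable_density \<rho>_pos less_imp_le)

lemma integral_comp:
  fixes f :: "real \<Rightarrow> 'b :: {banach, second_countable_topology}"
  assumes [measurable]: "f \<in> borel_measurable borel"
  shows "integral\<^sup>L lborel f = integral\<^sup>L lborel (\<lambda>x. \<rho> x *\<^sub>R f (Y x))"
  by (subst lborel_eq_distr, subst integral_distr)
    (simp_all add: integral_density \<rho>_pos less_imp_le)

lemma antiderivative_comp:
  assumes h: "antiderivative h g"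
  shows "antiderivative (\<lambda>x. h (Y x)) (\<lambda>x. of_real (\<rho> x) * g (Y x))"
  unfolding antiderivative_def
proof (intro allI impI)
  fix a b :: real assume "a \<le> b"
  then have ab: "Y a \<le> Y b" by simp
  have [measurable]: "g \<in> borel_measurable borel" by (rule antiderivative_measurable[OF h])
  have eq: "\<rho> x *\<^sub>R (indicator {Y a..Y b} (Y x) *\<^sub>R g (Y x)) = indicator {a..b} x *\<^sub>R (of_real (\<rho> x) * g (Y x))" for x
    by (auto simp: indicator_def scaleR_conv_of_real)
  show "set_integrable lborel {a..b} (\<lambda>x. of_real (\<rho> x) * g (Y x)) \<and>
     h (Y b) - h (Y a) = (LINT x:{a..b}|lborel. of_real (\<rho> x) * g (Y x))"
    using antiderivativeD(1,2)[OF h ab]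
      integrable_comp[of "\<lambda>y. indicator {Y a..Y b} y *\<^sub>R g y"]
      integral_comp[of "\<lambda>y. indicator {Y a..Y b} y *\<^sub>R g y"]
    unfolding set_integrable_def set_lebesgue_integral_def eq by simp
qed

lemma has_weak_deriv_comp:
  assumes "has_weak_deriv f g"
  shows "has_weak_deriv (\<lambda>x. f (Y x)) (\<lambda>x. of_real (\<rho> x) * g (Y x))"
proof -
  obtain h where h: "AE x in lborel. f x = h x" "antiderivative h g"
    using assms unfolding has_weak_deriv_antiderivative by blast
  show ?thesis unfolding has_weak_deriv_antiderivative
    by (intro exI[of _ "\<lambda>x. h (Y x)"] conjI AE_comp[OF h(1)] antiderivative_comp[OF h(2)])
qed

end

section \<open>Square integrable functions\<close>

definition sqnorm :: "(real \<Rightarrow> complex) \<Rightarrow> real" where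
  "sqnorm f = (LINT x|lborel. (cmod (f x))\<^sup>2)"

lemma sqnorm_nonneg [simp]: "0 \<le> sqnorm f"
  unfolding sqnorm_def by (rule integral_nonneg_AE) simp

lemma L2_iff: "f \<in> L2 \<longleftrightarrow> f \<in> borel_measurable borel \<and> integrable lborel (\<lambda>x. (cmod (f x))\<^sup>2)"
  by (simp add: L2_def)

lemma L2_measurable: "f \<in> L2 \<Longrightarrow> f \<in> borel_measurable borel"
  by (simp add: L2_iff)

lemma L2_norm2_eq: "L2_norm2 U = sqrt (sqnorm (fst U) + sqnorm (snd U))"
  unfolding L2_norm2_def sqnorm_def ..

lemma L2_dominated:
  assumes g: "g \<in> L2" and f[measurable]: "f \<in> borel_measurable borel"
    and le: "AE x in lborel. cmod (f x) \<le> C * cmod (g x)"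
  shows "f \<in> L2" "sqnorm f \<le> C\<^sup>2 * sqnorm g"
proof -
  have ig: "integrable lborel (\<lambda>x. C\<^sup>2 * (cmod (g x))\<^sup>2)" using g by (simp add: L2_iff)
  have le2: "AE x in lborel. (cmod (f x))\<^sup>2 \<le> C\<^sup>2 * (cmod (g x))\<^sup>2"
    using le
  proof eventually_elim
    case (elim x)
    then show ?case using power_mono[OF elim, of 2] by (simp add: power_mult_distrib)
  qed
  have if2: "integrable lborel (\<lambda>x. (cmod (f x))\<^sup>2)"
    by (rule Bochner_Integration.integrable_bound[OF ig]) (use le2 in \<open>auto elim: eventually_mono\<close>)
  then show "f \<in> L2" by (simp add: L2_iff)
  show "sqnorm f \<le> C\<^sup>2 * sqnorm g"
    using integral_mono_AE[OF if2 ig le2] by (simp add: sqnorm_def)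
qed

lemma L2_cong:
  assumes "f \<in> L2" "AE x in lborel. f x = g x" "g \<in> borel_measurable borel"
  shows "g \<in> L2"
  using assms(2) by (intro L2_dominated[OF assms(1,3), of 1]) (auto elim: eventually_mono)

lemma sqnorm_cong:
  assumes "AE x in lborel. f x = g x" "f \<in> borel_measurable borel" "g \<in> borel_measurable borel"
  shows "sqnorm f = sqnorm g"
  unfolding sqnorm_def using assms(2,3)
  by (intro integral_cong_AE) (use assms(1) in \<open>auto elim: eventually_mono\<close>)

lemma L2_add:
  assumes f: "f \<in> L2" and g: "g \<in> L2"
  shows "(\<lambda>x. f x + g x) \<in> L2" "sqnorm (\<lambda>x. f x + g x) \<le> 2 * sqnorm f + 2 * sqnorm g"
proof -
  have [measurable]: "f \<in> borel_measurable borel" "g \<in> borel_measurable borel"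
    using f g by (auto simp: L2_iff)
  have i: "integrable lborel (\<lambda>x. 2 * (cmod (f x))\<^sup>2 + 2 * (cmod (g x))\<^sup>2)"
    using f g by (simp add: L2_iff)
  have le: "(cmod (f x + g x))\<^sup>2 \<le> 2 * (cmod (f x))\<^sup>2 + 2 * (cmod (g x))\<^sup>2" for x
  proof -
    have "(cmod (f x + g x))\<^sup>2 \<le> (cmod (f x) + cmod (g x))\<^sup>2"
      by (intro power_mono norm_triangle_ineq) simp
    also have "\<dots> \<le> 2 * (cmod (f x))\<^sup>2 + 2 * (cmod (g x))\<^sup>2"
      using sum_squares_bound[of "cmod (f x)" "cmod (g x)"] by (simp add: power2_sum)
    finally show ?thesis .
  qed
  have i': "integrable lborel (\<lambda>x. (cmod (f x + g x))\<^sup>2)"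
    by (rule Bochner_Integration.integrable_bound[OF i]) (use le in \<open>auto intro!: AE_I2\<close>)
  then show "(\<lambda>x. f x + g x) \<in> L2" by (simp add: L2_iff)
  show "sqnorm (\<lambda>x. f x + g x) \<le> 2 * sqnorm f + 2 * sqnorm g"
    using integral_mono[OF i' i le] f g by (simp add: sqnorm_def L2_iff)
qed

lemma L2_mult:
  assumes f: "f \<in> L2" and [measurable]: "k \<in> borel_measurable borel" and k: "\<And>x. cmod (k x) \<le> C"
  shows "(\<lambda>x. k x * f x) \<in> L2" "sqnorm (\<lambda>x. k x * f x) \<le> C\<^sup>2 * sqnorm f"
proof -
  have [measurable]: "f \<in> borel_measurable borel" using f by (simp add: L2_iff)
  have "AE x in lborel. cmod (k x * f x) \<le> C * cmod (f x)"
    using k by (intro AE_I2) (simp add: norm_mult mult_right_mono)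
  from L2_dominated[OF f _ this] show "(\<lambda>x. k x * f x) \<in> L2" "sqnorm (\<lambda>x. k x * f x) \<le> C\<^sup>2 * sqnorm f"
    by simp_all
qed

lemma L2_cmult: "f \<in> L2 \<Longrightarrow> (\<lambda>x. c * f x) \<in> L2"
  using L2_mult(1)[of f "\<lambda>_. c" "cmod c"] by simp

lemma L2_uminus: "f \<in> L2 \<Longrightarrow> (\<lambda>x. - f x) \<in> L2"
  using L2_cmult[of f "-1"] by simp

lemma L2_diff: "f \<in> L2 \<Longrightarrow> g \<in> L2 \<Longrightarrow> (\<lambda>x. f x - g x) \<in> L2"
  using L2_add(1)[of f "\<lambda>x. - g x"] L2_uminus[of g] by simp

lemma L2_zero: "(\<lambda>x. 0) \<in> L2"
  by (simp add: L2_iff)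

section \<open>Convolution with the one-sided exponential\<close>

text \<open>\<open>exp_avg\<close> is the operator \<open>(1 + d/dx)\<^sup>-\<^sup>1\<close>.\<close>

definition exp_kernel :: "real \<Rightarrow> real \<Rightarrow> real" where
  "exp_kernel x t = (if t \<le> x then exp (t - x) else 0)"

definition exp_avg :: "(real \<Rightarrow> complex) \<Rightarrow> real \<Rightarrow> complex" where
  "exp_avg F x = (LINT t|lborel. of_real (exp_kernel x t) * F t)"

lemma measurable_exp_kernel [measurable]:
  assumes [measurable]: "f \<in> borel_measurable M" "g \<in> borel_measurable M"
  shows "(\<lambda>p. exp_kernel (f p) (g p)) \<in> borel_measurable M"
  unfolding exp_kernel_def by measurable

lemma exp_kernel_nonneg: "0 \<le> exp_kernel x t" and exp_kernel_le_1: "exp_kernel x t \<le> 1"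
  by (auto simp: exp_kernel_def)

lemma nn_integral_exp_kernel_aux: "(\<integral>\<^sup>+s. ennreal (exp_kernel s 0) \<partial>lborel) = 1"
proof -
  have "(\<integral>\<^sup>+s. ennreal (exp (- s)) * indicator {0..} s \<partial>lborel) = ennreal (0 - (- exp (- 0)))"
  proof (rule nn_integral_FTC_atLeast)
    have "((\<lambda>s::real. - exp (- s)) \<longlongrightarrow> - 0) at_top"
      by (intro tendsto_minus filterlim_compose[OF exp_at_bot] filterlim_uminus_at_bot_at_top)
    then show "((\<lambda>s::real. - exp (- s)) \<longlongrightarrow> 0) at_top" by simp
  qed (auto intro!: derivative_eq_intros)
  moreover have "ennreal (exp_kernel s 0) = ennreal (exp (- s)) * indicator {0..} s" for s
    by (auto simp: exp_kernel_def indicator_def)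
  ultimately show ?thesis by simp
qed

lemma nn_integral_exp_kernel:
  shows "(\<integral>\<^sup>+x. ennreal (exp_kernel x t) \<partial>lborel) = 1"
    and "(\<integral>\<^sup>+t. ennreal (exp_kernel x t) \<partial>lborel) = 1"
proof -
  have "(\<integral>\<^sup>+x. ennreal (exp_kernel x t) \<partial>lborel) = (\<integral>\<^sup>+s. ennreal (exp_kernel (t + 1 * s) t) \<partial>lborel)"
    by (subst nn_integral_real_affine[of _ 1 t]) auto
  also have "\<dots> = (\<integral>\<^sup>+s. ennreal (exp_kernel s 0) \<partial>lborel)"
    by (intro nn_integral_cong) (auto simp: exp_kernel_def)
  finally show "(\<integral>\<^sup>+x. ennreal (exp_kernel x t) \<partial>lborel) = 1" by (simp add: nn_integral_exp_kernel_aux)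
  have "(\<integral>\<^sup>+t. ennreal (exp_kernel x t) \<partial>lborel) = (\<integral>\<^sup>+s. ennreal (exp_kernel x (x + (-1) * s)) \<partial>lborel)"
    by (subst nn_integral_real_affine[of _ "-1" x]) auto
  also have "\<dots> = (\<integral>\<^sup>+s. ennreal (exp_kernel s 0) \<partial>lborel)"
    by (intro nn_integral_cong) (auto simp: exp_kernel_def)
  finally show "(\<integral>\<^sup>+t. ennreal (exp_kernel x t) \<partial>lborel) = 1" by (simp add: nn_integral_exp_kernel_aux)
qed

text \<open>The kernel \<open>k\<close> is split as \<open>sqrt k * (sqrt k * |F|)\<close>; the
  square of the first factor integrates to one.\<close>

lemma exp_kernel_Cauchy_Schwarz:
  assumes [measurable]: "F \<in> borel_measurable borel"
  shows "(\<integral>\<^sup>+t. ennreal (cmod (of_real (exp_kernel x t) * F t)) \<partial>lborel)\<^sup>2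
    \<le> (\<integral>\<^sup>+t. ennreal (exp_kernel x t * (cmod (F t))\<^sup>2) \<partial>lborel)"
proof -
  have "(\<integral>\<^sup>+t. ennreal (cmod (of_real (exp_kernel x t) * F t)) \<partial>lborel) =
      (\<integral>\<^sup>+t. ennreal (sqrt (exp_kernel x t)) * ennreal (sqrt (exp_kernel x t) * cmod (F t)) \<partial>lborel)"
    by (intro nn_integral_cong) (simp add: exp_kernel_nonneg norm_mult flip: ennreal_mult mult.assoc)
  then have "(\<integral>\<^sup>+t. ennreal (cmod (of_real (exp_kernel x t) * F t)) \<partial>lborel)\<^sup>2 \<le>
     (\<integral>\<^sup>+t. (ennreal (sqrt (exp_kernel x t)))\<^sup>2 \<partial>lborel) *
     (\<integral>\<^sup>+t. (ennreal (sqrt (exp_kernel x t) * cmod (F t)))\<^sup>2 \<partial>lborel)"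
    using Cauchy_Schwarz_nn_integral[of "\<lambda>t. ennreal (sqrt (exp_kernel x t))" lborel
        "\<lambda>t. ennreal (sqrt (exp_kernel x t) * cmod (F t))"] by simp
  also have "\<dots> = (\<integral>\<^sup>+t. ennreal (exp_kernel x t * (cmod (F t))\<^sup>2) \<partial>lborel)"
    by (simp add: ennreal_power exp_kernel_nonneg power_mult_distrib nn_integral_exp_kernel)
  finally show ?thesis .
qed

lemma exp_kernel_integrable:
  assumes F: "F \<in> L2"
  shows "integrable lborel (\<lambda>t. of_real (exp_kernel x t) * F t)"
proof (rule integrableI_bounded)
  have [measurable]: "F \<in> borel_measurable borel" using F by (rule L2_measurable)
  show "(\<lambda>t. of_real (exp_kernel x t) * F t) \<in> borel_measurable lborel" by simp
  have "(\<integral>\<^sup>+t. ennreal (exp_kernel x t * (cmod (F t))\<^sup>2) \<partial>lborel) \<le> (\<integral>\<^sup>+t. ennreal ((cmod (F t))\<^sup>2) \<partial>lborel)"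
    by (intro nn_integral_mono ennreal_leI) (simp add: exp_kernel_le_1 mult_left_le_one_le exp_kernel_nonneg)
  also have "\<dots> < \<infinity>" using F by (simp add: L2_iff nn_integral_eq_integral)
  finally have "(\<integral>\<^sup>+t. ennreal (cmod (of_real (exp_kernel x t) * F t)) \<partial>lborel)\<^sup>2 < \<infinity>"
    using exp_kernel_Cauchy_Schwarz[of F x] by (auto intro: le_less_trans)
  then show "(\<integral>\<^sup>+t. ennreal (cmod (of_real (exp_kernel x t) * F t)) \<partial>lborel) < \<infinity>"
    by (auto simp: power2_eq_square ennreal_mult_less_top)
qed

text \<open>Young's inequality for a kernel of mass one: after the pointwise Cauchy-Schwarz bound,
  Tonelli allows integrating the kernel over its first variable, which again gives one.\<close>

lemma exp_avg_L2:
  assumes F: "F \<in> L2"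
  shows "exp_avg F \<in> L2" "sqnorm (exp_avg F) \<le> sqnorm F"
proof -
  have [measurable]: "F \<in> borel_measurable borel" using F by (rule L2_measurable)
  have [measurable]: "exp_avg F \<in> borel_measurable borel"
    unfolding exp_avg_def by measurable
  have "(\<integral>\<^sup>+x. ennreal ((cmod (exp_avg F x))\<^sup>2) \<partial>lborel) \<le>
      (\<integral>\<^sup>+x. \<integral>\<^sup>+t. ennreal (exp_kernel x t * (cmod (F t))\<^sup>2) \<partial>lborel \<partial>lborel)"
  proof (rule nn_integral_mono)
    fix x
    have "ennreal (cmod (exp_avg F x)) \<le> (\<integral>\<^sup>+t. ennreal (cmod (of_real (exp_kernel x t) * F t)) \<partial>lborel)"
      unfolding exp_avg_def by (rule integral_norm_bound_ennreal[OF exp_kernel_integrable[OF F]])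
    then have "(ennreal (cmod (exp_avg F x)))\<^sup>2 \<le> (\<integral>\<^sup>+t. ennreal (cmod (of_real (exp_kernel x t) * F t)) \<partial>lborel)\<^sup>2"
      by (rule power_mono) simp
    also have "\<dots> \<le> (\<integral>\<^sup>+t. ennreal (exp_kernel x t * (cmod (F t))\<^sup>2) \<partial>lborel)"
      by (rule exp_kernel_Cauchy_Schwarz) simp
    finally show "ennreal ((cmod (exp_avg F x))\<^sup>2) \<le> (\<integral>\<^sup>+t. ennreal (exp_kernel x t * (cmod (F t))\<^sup>2) \<partial>lborel)"
      by (simp add: ennreal_power)
  qed
  also have "\<dots> = (\<integral>\<^sup>+t. \<integral>\<^sup>+x. ennreal (exp_kernel x t * (cmod (F t))\<^sup>2) \<partial>lborel \<partial>lborel)"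
    by (rule lborel_pair.Fubini') measurable
  also have "\<dots> = (\<integral>\<^sup>+t. ennreal ((cmod (F t))\<^sup>2) \<partial>lborel)"
    by (simp add: ennreal_mult exp_kernel_nonneg nn_integral_multc nn_integral_exp_kernel)
  also have "\<dots> = ennreal (sqnorm F)"
    using F by (simp add: L2_iff nn_integral_eq_integral sqnorm_def)
  finally have le: "(\<integral>\<^sup>+x. ennreal ((cmod (exp_avg F x))\<^sup>2) \<partial>lborel) \<le> ennreal (sqnorm F)" .
  have i: "integrable lborel (\<lambda>x. (cmod (exp_avg F x))\<^sup>2)"
  proof (rule integrableI_bounded)
    show "(\<integral>\<^sup>+x. ennreal (norm ((cmod (exp_avg F x))\<^sup>2)) \<partial>lborel) < \<infinity>"
      using le by (simp add: le_less_trans)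
  qed simp
  then show "exp_avg F \<in> L2" by (simp add: L2_iff)
  show "sqnorm (exp_avg F) \<le> sqnorm F"
    using le i by (simp add: nn_integral_eq_integral) (simp add: sqnorm_def)
qed

text \<open>The variables separate, \<open>exp (t - x) = exp (- x) * exp t\<close>, so
  \<open>exp_avg F\<close> is \<open>exp (- x)\<close> times an antiderivative \<open>G\<close> of
  \<open>exp t * F t\<close>, and the product rule applies.\<close>

lemma exp_avg_weak_deriv:
  assumes F: "F \<in> L2"
  shows "has_weak_deriv (exp_avg F) (\<lambda>x. F x - exp_avg F x)"
proof -
  have [measurable]: "F \<in> borel_measurable borel" using F by (rule L2_measurable)
  define G where "G x = (LINT t|lborel. indicator {..x} t *\<^sub>R (of_real (exp t) * F t))" for x
  have int: "integrable lborel (\<lambda>t. indicator {..x} t *\<^sub>R (of_real (exp t) * F t))" for x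
  proof -
    have "of_real (exp x) * (of_real (exp_kernel x t) * F t) = indicator {..x} t *\<^sub>R (of_real (exp t) * F t)" for t
      by (auto simp: exp_kernel_def exp_diff)
    then show ?thesis using integrable_mult_right[OF exp_kernel_integrable[OF F, of x], of "of_real (exp x)"] by simp
  qed
  have avg: "exp_avg F x = of_real (exp (- x)) * G x" for x
  proof -
    have "of_real (exp_kernel x t) * F t = of_real (exp (- x)) * (indicator {..x} t *\<^sub>R (of_real (exp t) * F t))" for t
      by (auto simp: exp_kernel_def exp_diff exp_minus field_simps)
    then show ?thesis unfolding exp_avg_def G_def by (simp only: integral_mult_right_zero)
  qed
  have "antiderivative G (\<lambda>t. of_real (exp t) * F t)"
    unfolding antiderivative_def
  proof (intro allI impI conjI)
    fix a b :: real assume ab: "a \<le> b"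
    have "set_integrable lborel {..b} (\<lambda>t. of_real (exp t) * F t)"
      using int by (simp add: set_integrable_def)
    then show "set_integrable lborel {a..b} (\<lambda>t. of_real (exp t) * F t)"
      by (rule set_integrable_subset) auto
    have "G b - G a = (LINT t|lborel. indicator {..b} t *\<^sub>R (of_real (exp t) * F t) - indicator {..a} t *\<^sub>R (of_real (exp t) * F t))"
      unfolding G_def using int by simp
    \<comment> \<open>The difference of the two indicators is that of \<open>{a<..b}\<close>, and
      the endpoint \<open>a\<close> is a null set.\<close>
    also have "\<dots> = (LINT x:{a..b}|lborel. of_real (exp x) * F x)"
      unfolding set_lebesgue_integral_def
      by (rule integral_cong_AE) (use AE_lborel_singleton[of a] ab in \<open>auto simp: indicator_def elim!: eventually_mono\<close>)
    finally show "G b - G a = (LINT x:{a..b}|lborel. of_real (exp x) * F x)" .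
  qed
  then have "antiderivative (\<lambda>x. of_real (exp (- x)) * G x)
      (\<lambda>x. of_real (- exp (- x)) * G x + of_real (exp (- x)) * (of_real (exp x) * F x))"
    by (rule antiderivative_mult) (auto intro!: derivative_eq_intros continuous_intros)
  moreover have "of_real (- exp (- x)) * G x + of_real (exp (- x)) * (of_real (exp x) * F x) = F x - exp_avg F x" for x
    by (simp add: avg exp_minus)
  moreover have "(\<lambda>x. of_real (exp (- x)) * G x) = exp_avg F" by (rule ext) (simp add: avg)
  ultimately have "antiderivative (exp_avg F) (\<lambda>x. F x - exp_avg F x)"
    by (simp only:)
  then show ?thesis unfolding has_weak_deriv_antiderivative by (intro exI[of _ "exp_avg F"]) simp
qed

section \<open>Sobolev spaces\<close>

lemma sobolev_L2: "f \<in> sobolev k \<Longrightarrow> f \<in> L2"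
  by (cases k) auto

lemma sobolev_SucI: "f \<in> L2 \<Longrightarrow> has_weak_deriv f g \<Longrightarrow> g \<in> sobolev k \<Longrightarrow> f \<in> sobolev (Suc k)"
  by auto

lemma sobolev_cong:
  assumes "f \<in> sobolev k" "AE x in lborel. f x = g x" "g \<in> borel_measurable borel"
  shows "g \<in> sobolev k"
  using assms by (cases k) (auto intro: L2_cong simp: has_weak_deriv_cong_left)

lemma sobolev_SucD:
  assumes "f \<in> sobolev (Suc k)"
  shows "f \<in> L2" "has_weak_deriv f (wderiv f)" "wderiv f \<in> sobolev k"
proof -
  obtain g where g: "g \<in> sobolev k" "has_weak_deriv f g" and "f \<in> L2" using assms by auto
  then show "f \<in> L2" "has_weak_deriv f (wderiv f)" by (auto intro: has_weak_deriv_wderiv)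
  have "AE x in lborel. g x = wderiv f x" using wderiv_AE[OF g(2)] by (auto elim: eventually_mono)
  then show "wderiv f \<in> sobolev k"
    using g(1) has_weak_deriv_measurable[OF \<open>has_weak_deriv f (wderiv f)\<close>] by (auto intro: sobolev_cong)
qed

lemma sobolev_add: "f \<in> sobolev k \<Longrightarrow> g \<in> sobolev k \<Longrightarrow> (\<lambda>x. f x + g x) \<in> sobolev k"
proof (induction k arbitrary: f g)
  case (Suc k)
  show ?case
    by (rule sobolev_SucI[OF L2_add(1) has_weak_deriv_add])
      (use sobolev_SucD[OF Suc.prems(1)] sobolev_SucD[OF Suc.prems(2)] Suc.IH in auto)
qed (simp add: L2_add)

lemma sobolev_cmult: "f \<in> sobolev k \<Longrightarrow> (\<lambda>x. c * f x) \<in> sobolev k"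
proof (induction k arbitrary: f)
  case (Suc k)
  show ?case
    by (rule sobolev_SucI[OF L2_cmult has_weak_deriv_cmult])
      (use sobolev_SucD[OF Suc.prems(1)] Suc.IH in auto)
qed (simp add: L2_cmult)

lemma sobolev_diff: "f \<in> sobolev k \<Longrightarrow> g \<in> sobolev k \<Longrightarrow> (\<lambda>x. f x - g x) \<in> sobolev k"
  using sobolev_add[of f k "\<lambda>x. -1 * g x"] sobolev_cmult[of g k "-1"] by simp

lemma sobolev_Suc_subset: "sobolev (Suc k) \<subseteq> sobolev k"
proof (induction k)
  case (Suc k)
  show ?case
  proof
    fix f assume f: "f \<in> sobolev (Suc (Suc k))"
    show "f \<in> sobolev (Suc k)"
      by (rule sobolev_SucI[OF sobolev_SucD(1,2)[OF f]]) (use sobolev_SucD(3)[OF f] Suc in blast)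
  qed
qed auto

lemma sobolev_antimono: "k \<le> l \<Longrightarrow> sobolev l \<subseteq> sobolev k"
  using lift_Suc_antimono_le[of sobolev, OF sobolev_Suc_subset] by blast

lemma has_weak_deriv_zero: "has_weak_deriv (\<lambda>x. 0) (\<lambda>x. 0)"
  unfolding has_weak_deriv_def
  by (intro exI[of _ "\<lambda>x. 0"]) (simp add: set_integrable_def set_lebesgue_integral_def)

lemma sobolev_zero: "(\<lambda>x. 0) \<in> sobolev k"
  by (induction k) (auto simp: L2_zero intro: has_weak_deriv_zero)

lemma exp_avg_sobolev:
  assumes "F \<in> sobolev k" shows "exp_avg F \<in> sobolev (Suc k)"
  using assms
proof (induction k arbitrary: F)
  case 0
  then show ?case
    by (intro sobolev_SucI[OF exp_avg_L2(1) exp_avg_weak_deriv]) (auto intro: L2_diff exp_avg_L2)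
next
  case (Suc k)
  have "F \<in> sobolev k" using Suc.prems sobolev_Suc_subset by blast
  then show ?case
    by (intro sobolev_SucI[OF exp_avg_L2(1) exp_avg_weak_deriv])
      (auto intro!: sobolev_diff Suc.IH Suc.prems sobolev_L2 simp del: sobolev.simps)
qed

section \<open>The resolvent problem and its scalar reduction\<close>

text \<open>The scalar counterpart of lying in the resolvent set. The bound includes the derivative
  because the eliminated unknown is a multiple of it, and order four puts that derivative into
  \<open>sobolev 3\<close>.\<close>

definition reduced_solvable :: "((real \<Rightarrow> complex) \<Rightarrow> real \<Rightarrow> complex) \<Rightarrow> bool" where
  "reduced_solvable S \<longleftrightarrow> (\<exists>C\<ge>0. \<forall>f\<in>L2. \<exists>q\<in>sobolev 4. (AE x in lborel. S q x = f x) \<and>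
     sqnorm q + sqnorm (wderiv q) \<le> C * sqnorm f \<and>
     (\<forall>p\<in>sobolev 4. (AE x in lborel. S p x = f x) \<longrightarrow> (AE x in lborel. p x = q x)))"

text \<open>Squared norms add over the two components, so all estimates are made in that form; the
  square root is taken here once and for all.\<close>

lemma resolvent_setI:
  assumes "C \<ge> 0" and "\<And>F1 F2. F1 \<in> L2 \<Longrightarrow> F2 \<in> L2 \<Longrightarrow>
     \<exists>r q. (r, q) \<in> Dom \<and> solves_resolvent_eq A \<nu> (r, q) (F1, F2) \<and>
       sqnorm r + sqnorm q \<le> C * (sqnorm F1 + sqnorm F2) \<and>
       (\<forall>V\<in>Dom. solves_resolvent_eq A \<nu> V (F1, F2) \<longrightarrow>
          (AE x in lborel. fst V x = r x \<and> snd V x = q x))"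
  shows "\<nu> \<in> resolvent_set Dom A"
  unfolding resolvent_set_def
proof (intro CollectI exI[of _ "sqrt C"] ballI)
  fix F :: pair_fn assume "F \<in> L2 \<times> L2"
  then obtain F1 F2 where F: "F = (F1, F2)" "F1 \<in> L2" "F2 \<in> L2" by auto
  obtain r q where rq: "(r, q) \<in> Dom" "solves_resolvent_eq A \<nu> (r, q) (F1, F2)"
    "sqnorm r + sqnorm q \<le> C * (sqnorm F1 + sqnorm F2)"
    "\<forall>V\<in>Dom. solves_resolvent_eq A \<nu> V (F1, F2) \<longrightarrow>
          (AE x in lborel. fst V x = r x \<and> snd V x = q x)"
    using assms(2)[OF F(2,3)] by blast
  show "\<exists>U\<in>Dom. solves_resolvent_eq A \<nu> U F \<and> L2_norm2 U \<le> sqrt C * L2_norm2 F \<and>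
     (\<forall>V\<in>Dom. solves_resolvent_eq A \<nu> V F \<longrightarrow> (AE x in lborel. fst V x = fst U x \<and> snd V x = snd U x))"
    using rq by (intro bexI[of _ "(r, q)"]) (auto simp: L2_norm2_eq F(1) simp flip: real_sqrt_mult)
qed

text \<open>The constant in \<open>resolvent_set\<close> carries no sign; squaring the estimate
  yields one that is nonnegative.\<close>

lemma resolvent_setE:
  assumes "\<nu> \<in> resolvent_set Dom A"
  obtains C where "C \<ge> 0" and "\<And>F1 F2. F1 \<in> L2 \<Longrightarrow> F2 \<in> L2 \<Longrightarrow>
     \<exists>r q. (r, q) \<in> Dom \<and> solves_resolvent_eq A \<nu> (r, q) (F1, F2) \<and>
       sqnorm r + sqnorm q \<le> C * (sqnorm F1 + sqnorm F2) \<and>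
       (\<forall>V\<in>Dom. solves_resolvent_eq A \<nu> V (F1, F2) \<longrightarrow>
          (AE x in lborel. fst V x = r x \<and> snd V x = q x))"
proof -
  obtain C where C: "\<And>F. F \<in> L2 \<times> L2 \<Longrightarrow>
     \<exists>U \<in> Dom. solves_resolvent_eq A \<nu> U F \<and> L2_norm2 U \<le> C * L2_norm2 F \<and>
        (\<forall>V \<in> Dom. solves_resolvent_eq A \<nu> V F \<longrightarrow>
           (AE x in lborel. fst V x = fst U x \<and> snd V x = snd U x))"
    using assms unfolding resolvent_set_def by blast
  show thesis
  proof (rule that[of "C\<^sup>2"])
    fix F1 F2 assume "F1 \<in> L2" "F2 \<in> L2"
    then obtain U where U: "U \<in> Dom" "solves_resolvent_eq A \<nu> U (F1, F2)"
      "L2_norm2 U \<le> C * L2_norm2 (F1, F2)"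
      "\<forall>V \<in> Dom. solves_resolvent_eq A \<nu> V (F1, F2) \<longrightarrow>
           (AE x in lborel. fst V x = fst U x \<and> snd V x = snd U x)"
      using C[of "(F1, F2)"] by blast
    have "(L2_norm2 U)\<^sup>2 \<le> (C * L2_norm2 (F1, F2))\<^sup>2"
      using U(3) by (rule power_mono) (simp add: L2_norm2_eq)
    then have "sqnorm (fst U) + sqnorm (snd U) \<le> C\<^sup>2 * (sqnorm F1 + sqnorm F2)"
      by (simp add: L2_norm2_eq power_mult_distrib)
    with U show "\<exists>r q. (r, q) \<in> Dom \<and> solves_resolvent_eq A \<nu> (r, q) (F1, F2) \<and>
       sqnorm r + sqnorm q \<le> C\<^sup>2 * (sqnorm F1 + sqnorm F2) \<and>
       (\<forall>V\<in>Dom. solves_resolvent_eq A \<nu> V (F1, F2) \<longrightarrow>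
          (AE x in lborel. fst V x = r x \<and> snd V x = q x))"
      by (intro exI[of _ "fst U"] exI[of _ "snd U"]) simp
  qed simp
qed

lemma lin_domainD:
  assumes "(r, q) \<in> lin_domain"
  shows "r \<in> L2" "wderiv r \<in> L2" "wderiv (wderiv r) \<in> L2" "wderiv (wderiv (wderiv r)) \<in> L2"
    "q \<in> L2" "wderiv q \<in> L2"
    "has_weak_deriv r (wderiv r)" "has_weak_deriv (wderiv r) (wderiv (wderiv r))"
    "has_weak_deriv (wderiv (wderiv r)) (wderiv (wderiv (wderiv r)))" "has_weak_deriv q (wderiv q)"
proof -
  have r: "r \<in> sobolev (Suc (Suc (Suc 0)))" and q: "q \<in> sobolev (Suc 0)"
    using assms by (simp_all add: lin_domain_def numeral_3_eq_3 del: sobolev.simps)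
  note 1 = sobolev_SucD[OF r] note 2 = sobolev_SucD[OF 1(3)] note 3 = sobolev_SucD[OF 2(3)]
  note 4 = sobolev_SucD[OF q]
  show "r \<in> L2" "wderiv r \<in> L2" "wderiv (wderiv r) \<in> L2" "wderiv (wderiv (wderiv r)) \<in> L2"
    "q \<in> L2" "wderiv q \<in> L2"
    "has_weak_deriv r (wderiv r)" "has_weak_deriv (wderiv r) (wderiv (wderiv r))"
    "has_weak_deriv (wderiv (wderiv r)) (wderiv (wderiv (wderiv r)))" "has_weak_deriv q (wderiv q)"
    using 1 2 3 4 by simp_all
qed

lemma sobolev4_domain:
  assumes "q \<in> sobolev 4" shows "(\<lambda>x. c * wderiv q x, q) \<in> lin_domain"
proof -
  have q: "q \<in> sobolev (Suc 3)" using assms by simp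
  from sobolev_SucD(3)[OF this] have "wderiv q \<in> sobolev 3" .
  moreover have "q \<in> sobolev 1" using q sobolev_antimono[of 1 "Suc 3"] by (auto simp del: sobolev.simps)
  ultimately show ?thesis by (simp add: lin_domain_def sobolev_cmult del: sobolev.simps)
qed

lemma zero_domain: "(\<lambda>x. 0, \<lambda>x. 0) \<in> lin_domain"
  using sobolev_zero by (simp add: lin_domain_def del: sobolev.simps)

lemma emeasure_lborel_ray:
  "emeasure lborel {..a::real} = \<infinity>" "emeasure lborel {a::real..} = \<infinity>"
proof -
  have "ennreal (real n) \<le> emeasure lborel {..a}" "ennreal (real n) \<le> emeasure lborel {a..}" for n
    using emeasure_mono[of "{a - real n..a}" "{..a}" lborel] emeasure_mono[of "{a..a + real n}" "{a..}" lborel]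
    by auto
  then show "emeasure lborel {..a} = \<infinity>" "emeasure lborel {a..} = \<infinity>"
    by (metis ennreal_top_eq_mult_iff infinity_ennreal_def ennreal_Ex_less_of_nat ennreal_of_nat_eq_real_of_nat leD top.not_eq_extremum)+
qed

text \<open>The common shape of the two linearizations, with \<open>\<sigma> = -1\<close> in the
  Eulerian and \<open>\<sigma> = 1\<close> in the Lagrangian case. \<open>snd_A\<close> speaks of
  arbitrary weak derivatives instead of \<open>wderiv\<close>, so that explicit derivatives of sums,
  multiples and averages can be inserted.\<close>

locale third_order_operator =
  fixes A :: "pair_fn \<Rightarrow> pair_fn" and \<sigma> :: complex
    and k0 k1 k2 k3 l0 l1 :: "real \<Rightarrow> complex" and K :: real
  assumes \<sigma>: "\<sigma> \<noteq> 0"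
    and fst_A: "\<And>r q. fst (A (r, q)) = (\<lambda>x. \<sigma> * wderiv q x)"
    and snd_A: "\<And>r r1 r2 r3 q q1. \<lbrakk>has_weak_deriv r r1; has_weak_deriv r1 r2; has_weak_deriv r2 r3;
        has_weak_deriv q q1; r \<in> borel_measurable borel; q \<in> borel_measurable borel\<rbrakk> \<Longrightarrow>
      AE x in lborel. snd (A (r, q)) x =
        k0 x * r x + (k1 x * r1 x + (k2 x * r2 x + (k3 x * r3 x + (l0 x * q x + l1 x * q1 x))))"
    and coeff_measurable: "k0 \<in> borel_measurable borel" "k1 \<in> borel_measurable borel"
      "k2 \<in> borel_measurable borel" "k3 \<in> borel_measurable borel"
      "l0 \<in> borel_measurable borel" "l1 \<in> borel_measurable borel"
    and coeff_bounded: "\<And>x. cmod (k0 x) \<le> K" "\<And>x. cmod (k1 x) \<le> K" "\<And>x. cmod (k2 x) \<le> K"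
      "\<And>x. cmod (k3 x) \<le> K" "\<And>x. cmod (l0 x) \<le> K" "\<And>x. cmod (l1 x) \<le> K"
begin

definition form :: "(real \<Rightarrow> complex) \<Rightarrow> (real \<Rightarrow> complex) \<Rightarrow> (real \<Rightarrow> complex) \<Rightarrow> (real \<Rightarrow> complex) \<Rightarrow>
    (real \<Rightarrow> complex) \<Rightarrow> (real \<Rightarrow> complex) \<Rightarrow> real \<Rightarrow> complex" where
  "form r r1 r2 r3 q q1 x =
     k0 x * r x + (k1 x * r1 x + (k2 x * r2 x + (k3 x * r3 x + (l0 x * q x + l1 x * q1 x))))"

lemma form_L2:
  assumes "r \<in> L2" "r1 \<in> L2" "r2 \<in> L2" "r3 \<in> L2" "q \<in> L2" "q1 \<in> L2"
  shows "form r r1 r2 r3 q q1 \<in> L2"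
  unfolding form_def using assms coeff_measurable coeff_bounded
  by (intro L2_add L2_mult(1)[where C = K])

text \<open>The estimate \<open>sqnorm (f + g) \<le> 2 * sqnorm f + 2 * sqnorm g\<close>, iterated
  along the right-nested sum of six terms, produces the weights 2, 4, 8, 16, 32, 32, with total
  94.\<close>

lemma form_sqnorm:
  assumes "r \<in> L2" "r1 \<in> L2" "r2 \<in> L2" "r3 \<in> L2" "q \<in> L2" "q1 \<in> L2"
    and B: "sqnorm r \<le> B" "sqnorm r1 \<le> B" "sqnorm r2 \<le> B" "sqnorm r3 \<le> B" "sqnorm q \<le> B" "sqnorm q1 \<le> B"
  shows "sqnorm (form r r1 r2 r3 q q1) \<le> 94 * K\<^sup>2 * B"
proof -
  have add: "(\<lambda>x. f x + g x) \<in> L2 \<and> sqnorm (\<lambda>x. f x + g x) \<le> 2 * a + 2 * b"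
    if "f \<in> L2 \<and> sqnorm f \<le> a" "g \<in> L2 \<and> sqnorm g \<le> b" for f g a b
    using L2_add[of f g] that by auto
  have mul: "(\<lambda>x. k x * f x) \<in> L2 \<and> sqnorm (\<lambda>x. k x * f x) \<le> K\<^sup>2 * B"
    if "f \<in> L2" "sqnorm f \<le> B" "k \<in> borel_measurable borel" "\<And>x. cmod (k x) \<le> K" for k f
    using L2_mult[OF that(1,3,4)] that(2) by (meson mult_left_mono order_trans zero_le_power2)
  have "form r r1 r2 r3 q q1 \<in> L2 \<and> sqnorm (form r r1 r2 r3 q q1) \<le>
     2 * (K\<^sup>2 * B) + 2 * (2 * (K\<^sup>2 * B) + 2 * (2 * (K\<^sup>2 * B) + 2 * (2 * (K\<^sup>2 * B) + 2 * (2 * (K\<^sup>2 * B) + 2 * (K\<^sup>2 * B)))))"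
    unfolding form_def using assms coeff_measurable coeff_bounded by (intro add mul)
  then show ?thesis by (simp add: algebra_simps)
qed

lemma snd_A_form:
  assumes "has_weak_deriv r r1" "has_weak_deriv r1 r2" "has_weak_deriv r2 r3"
        "has_weak_deriv q q1" "r \<in> L2" "q \<in> L2"
  shows "AE x in lborel. snd (A (r, q)) x = form r r1 r2 r3 q q1 x"
  unfolding form_def using assms by (intro snd_A L2_measurable)

lemma snd_A_dom:
  assumes "(r, q) \<in> lin_domain"
  shows "AE x in lborel. snd (A (r, q)) x =
    form r (wderiv r) (wderiv (wderiv r)) (wderiv (wderiv (wderiv r))) q (wderiv q) x"
  using lin_domainD[OF assms] by (intro snd_A_form)

lemma snd_A_add:
  assumes "(r, q) \<in> lin_domain" "(r', q') \<in> lin_domain"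
  shows "AE x in lborel. snd (A (\<lambda>x. r x + r' x, \<lambda>x. q x + q' x)) x = snd (A (r, q)) x + snd (A (r', q')) x"
proof -
  note d = lin_domainD[OF assms(1)] and d' = lin_domainD[OF assms(2)]
  have "AE x in lborel. snd (A (\<lambda>x. r x + r' x, \<lambda>x. q x + q' x)) x = form (\<lambda>x. r x + r' x)
      (\<lambda>x. wderiv r x + wderiv r' x) (\<lambda>x. wderiv (wderiv r) x + wderiv (wderiv r') x)
      (\<lambda>x. wderiv (wderiv (wderiv r)) x + wderiv (wderiv (wderiv r')) x)
      (\<lambda>x. q x + q' x) (\<lambda>x. wderiv q x + wderiv q' x) x"
    by (intro snd_A_form has_weak_deriv_add d d' L2_add)
  then show ?thesis using snd_A_dom[OF assms(1)] snd_A_dom[OF assms(2)]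
    by eventually_elim (simp add: form_def algebra_simps)
qed

lemma snd_A_cmult:
  assumes "(r, q) \<in> lin_domain"
  shows "AE x in lborel. snd (A (\<lambda>x. c * r x, \<lambda>x. c * q x)) x = c * snd (A (r, q)) x"
proof -
  note d = lin_domainD[OF assms(1)]
  have "AE x in lborel. snd (A (\<lambda>x. c * r x, \<lambda>x. c * q x)) x = form (\<lambda>x. c * r x)
      (\<lambda>x. c * wderiv r x) (\<lambda>x. c * wderiv (wderiv r) x) (\<lambda>x. c * wderiv (wderiv (wderiv r)) x)
      (\<lambda>x. c * q x) (\<lambda>x. c * wderiv q x) x"
    by (intro snd_A_form has_weak_deriv_cmult d L2_cmult)
  then show ?thesis using snd_A_dom[OF assms(1)]
    by eventually_elim (simp add: form_def algebra_simps)
qed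

lemma snd_A_cong:
  assumes "(r, q) \<in> lin_domain" "AE x in lborel. r x = r' x" "AE x in lborel. q x = q' x"
    "r' \<in> borel_measurable borel" "q' \<in> borel_measurable borel"
  shows "AE x in lborel. snd (A (r', q')) x = snd (A (r, q)) x"
proof -
  note d = lin_domainD[OF assms(1)]
  have "AE x in lborel. snd (A (r', q')) x = form r' (wderiv r) (wderiv (wderiv r))
      (wderiv (wderiv (wderiv r))) q' (wderiv q) x"
    using d L2_cong[OF d(1) assms(2,4)] L2_cong[OF d(5) assms(3,5)]
    by (intro snd_A_form) (simp_all add: has_weak_deriv_cong_left[OF assms(2)] has_weak_deriv_cong_left[OF assms(3)])
  then show ?thesis using snd_A_dom[OF assms(1)] assms(2,3)
    by eventually_elim (simp add: form_def)
qed

text \<open>If the first component of the data is zero, the first resolvent equation forces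
  \<open>r = \<sigma> / \<nu> * q'\<close>; this is the left-hand side of the second equation after
  that elimination.\<close>

definition reduced :: "complex \<Rightarrow> (real \<Rightarrow> complex) \<Rightarrow> real \<Rightarrow> complex" where
  "reduced \<nu> q = (\<lambda>x. snd (A (\<lambda>x. \<sigma> / \<nu> * wderiv q x, q)) x - \<nu> * q x)"

lemma solves_iff:
  "solves_resolvent_eq A \<nu> (r, q) (F1, F2) \<longleftrightarrow>
     (AE x in lborel. \<sigma> * wderiv q x - \<nu> * r x = F1 x) \<and> (AE x in lborel. snd (A (r, q)) x - \<nu> * q x = F2 x)"
  unfolding solves_resolvent_eq_def by (simp add: fst_A)

section \<open>The resolvent problem and the scalar problem are equivalent for nonzero
  \<open>\<nu>\<close>\<close>

context
  fixes \<nu> :: complex assumes \<nu>: "\<nu> \<noteq> 0"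
begin

lemma reduced_solves:
  assumes "q \<in> sobolev 4"
  shows "solves_resolvent_eq A \<nu> (\<lambda>x. \<sigma> / \<nu> * wderiv q x, q) (\<lambda>x. 0, f) \<longleftrightarrow>
    (AE x in lborel. reduced \<nu> q x = f x)"
  unfolding solves_iff reduced_def using \<nu> by simp

text \<open>The first equation reads \<open>q' = \<nu> / \<sigma> * r\<close> almost everywhere, so
  \<open>q'\<close> inherits the three derivatives of \<open>r\<close> and \<open>q\<close> gains
  order four.\<close>

lemma solves_reduced:
  assumes "(r, q) \<in> lin_domain" "solves_resolvent_eq A \<nu> (r, q) (\<lambda>x. 0, f)"
  shows "q \<in> sobolev 4" "AE x in lborel. r x = \<sigma> / \<nu> * wderiv q x" "AE x in lborel. reduced \<nu> q x = f x"
proof -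
  note d = lin_domainD[OF assms(1)]
  have e: "AE x in lborel. \<sigma> * wderiv q x - \<nu> * r x = 0" "AE x in lborel. snd (A (r, q)) x - \<nu> * q x = f x"
    using assms(2) by (auto simp: solves_iff)
  show r: "AE x in lborel. r x = \<sigma> / \<nu> * wderiv q x"
    using e(1) by eventually_elim (use \<nu> in \<open>simp add: field_simps\<close>)
  then have "AE x in lborel. \<nu> / \<sigma> * r x = wderiv q x"
    by eventually_elim (use \<nu> \<sigma> in simp)
  then have "wderiv q \<in> sobolev 3"
    using sobolev_cmult[of r 3 "\<nu> / \<sigma>"] assms(1) has_weak_deriv_measurable[OF d(10)]
    by (auto intro: sobolev_cong simp: lin_domain_def simp del: sobolev.simps)
  then have "q \<in> sobolev (Suc 3)" by (rule sobolev_SucI[OF d(5,10)])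
  then show "q \<in> sobolev 4" by simp
  have "AE x in lborel. snd (A (\<lambda>x. \<sigma> / \<nu> * wderiv q x, q)) x = snd (A (r, q)) x"
    using has_weak_deriv_measurable[OF d(10)] L2_measurable[OF d(5)]
    by (intro snd_A_cong[OF assms(1) r]) auto
  then show "AE x in lborel. reduced \<nu> q x = f x"
    using e(2) unfolding reduced_def by eventually_elim simp
qed

lemma resolvent_imp_reduced:
  assumes "\<nu> \<in> resolvent_set lin_domain A"
  shows "reduced_solvable (reduced \<nu>)"
proof -
  obtain C where "C \<ge> 0" and C: "\<And>F1 F2. F1 \<in> L2 \<Longrightarrow> F2 \<in> L2 \<Longrightarrow>
     \<exists>r q. (r, q) \<in> lin_domain \<and> solves_resolvent_eq A \<nu> (r, q) (F1, F2) \<and>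
       sqnorm r + sqnorm q \<le> C * (sqnorm F1 + sqnorm F2) \<and>
       (\<forall>V\<in>lin_domain. solves_resolvent_eq A \<nu> V (F1, F2) \<longrightarrow>
          (AE x in lborel. fst V x = r x \<and> snd V x = q x))"
    using resolvent_setE[OF assms] by blast
  \<comment> \<open>The factor in the estimate of \<open>q' = \<nu> / \<sigma> * r\<close> by
    \<open>r\<close>.\<close>
  define D where "D = (cmod (\<nu> / \<sigma>))\<^sup>2"
  show ?thesis unfolding reduced_solvable_def
  proof (intro exI[of _ "(1 + D) * C"] conjI ballI)
    show "0 \<le> (1 + D) * C" using \<open>C \<ge> 0\<close> by (simp add: D_def)
    fix f assume f: "f \<in> L2"
    obtain r q where rq: "(r, q) \<in> lin_domain" and s: "solves_resolvent_eq A \<nu> (r, q) (\<lambda>x. 0, f)"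
      and le: "sqnorm r + sqnorm q \<le> C * (sqnorm (\<lambda>x. 0) + sqnorm f)"
      and u: "\<forall>V\<in>lin_domain. solves_resolvent_eq A \<nu> V (\<lambda>x. 0, f) \<longrightarrow>
          (AE x in lborel. fst V x = r x \<and> snd V x = q x)"
      using C[OF L2_zero f] by blast
    note q = solves_reduced[OF rq s] and d = lin_domainD[OF rq]
    show "\<exists>q\<in>sobolev 4. (AE x in lborel. reduced \<nu> q x = f x) \<and>
       sqnorm q + sqnorm (wderiv q) \<le> (1 + D) * C * sqnorm f \<and>
       (\<forall>p\<in>sobolev 4. (AE x in lborel. reduced \<nu> p x = f x) \<longrightarrow> (AE x in lborel. p x = q x))"
    proof (intro bexI[OF _ q(1)] conjI ballI impI q(3))
      have "AE x in lborel. cmod (wderiv q x) \<le> cmod (\<nu> / \<sigma>) * cmod (r x)"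
        using q(2)
      proof eventually_elim
        case (elim x)
        have "wderiv q x = \<nu> / \<sigma> * r x" unfolding elim using \<nu> \<sigma> by simp
        then show ?case by (simp only: norm_mult order_refl)
      qed
      then have "sqnorm (wderiv q) \<le> D * sqnorm r"
        unfolding D_def using has_weak_deriv_measurable[OF d(10)] by (intro L2_dominated(2)[OF d(1)])
      then have "sqnorm q + sqnorm (wderiv q) \<le> sqnorm q + D * sqnorm r" by simp
      also have "\<dots> \<le> (1 + D) * (sqnorm r + sqnorm q)"
        by (simp add: D_def algebra_simps)
      also have "\<dots> \<le> (1 + D) * (C * sqnorm f)"
        using le by (intro mult_left_mono) (auto simp: sqnorm_def D_def)
      finally show "sqnorm q + sqnorm (wderiv q) \<le> (1 + D) * C * sqnorm f" by simp
    next
      fix p assume p: "p \<in> sobolev 4" "AE x in lborel. reduced \<nu> p x = f x"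
      have "solves_resolvent_eq A \<nu> (\<lambda>x. \<sigma> / \<nu> * wderiv p x, p) (\<lambda>x. 0, f)"
        using reduced_solves[OF p(1), of f] p(2) by (simp only:)
      with u sobolev4_domain[OF p(1)] have "AE x in lborel. fst (\<lambda>x. \<sigma> / \<nu> * wderiv p x, p) x = r x
          \<and> snd (\<lambda>x. \<sigma> / \<nu> * wderiv p x, p) x = q x"
        by blast
      then show "AE x in lborel. p x = q x" by eventually_elim simp
    qed
  qed
qed

text \<open>Let \<open>K1\<close>, \<open>K2\<close>, \<open>K3\<close> be the iterated averages of
  \<open>F\<close>. Each has as derivative its predecessor minus itself, so the derivative of
  \<open>K1 + K2 + K3\<close> telescopes to \<open>F - K3\<close>; this suggests
  \<open>q = (K1 + K2 + K3) / \<sigma>\<close> and \<open>r = - K3 / \<nu>\<close>. The derivatives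
  are returned with bounds because the second component of \<open>A\<close> will be evaluated at
  \<open>(r, q)\<close>.\<close>

lemma first_component_solution:
  assumes F: "F \<in> L2"
  obtains r r1 r2 r3 q q1 where "(r, q) \<in> lin_domain"
    "AE x in lborel. \<sigma> * wderiv q x - \<nu> * r x = F x"
    "has_weak_deriv r r1" "has_weak_deriv r1 r2" "has_weak_deriv r2 r3" "has_weak_deriv q q1"
    "r \<in> L2" "r1 \<in> L2" "r2 \<in> L2" "r3 \<in> L2" "q \<in> L2" "q1 \<in> L2"
    "\<forall>f\<in>{r, r1, r2, r3, q, q1}. sqnorm f \<le> 118 * ((cmod (1 / \<nu>))\<^sup>2 + (cmod (1 / \<sigma>))\<^sup>2) * sqnorm F"
proof -
  define B where "B = sqnorm F"
  define good where "good f b \<longleftrightarrow> f \<in> L2 \<and> sqnorm f \<le> b" for f b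
  have add: "good (\<lambda>x. f x + g x) (2 * a + 2 * b)" if "good f a" "good g b" for f g a b
    using L2_add[of f g] that by (auto simp: good_def)
  have mul: "good (\<lambda>x. c * f x) ((cmod c)\<^sup>2 * a)" if "good f a" for f a c
    using L2_mult[of f "\<lambda>_. c" "cmod c"] that mult_left_mono[of "sqnorm f" a "(cmod c)\<^sup>2"]
    by (auto simp: good_def)
  have uminus: "good (\<lambda>x. - f x) a" if "good f a" for f a
    using mul[OF that, of "-1"] by simp
  have diff: "good (\<lambda>x. f x - g x) (2 * a + 2 * b)" if "good f a" "good g b" for f g a b
    using add[OF that(1) uminus[OF that(2)]] by simp
  have K: "good (exp_avg f) b" if "good f b" for f b
    using that exp_avg_L2[of f] by (auto simp: good_def)
  define K1 where "K1 = exp_avg F" define K2 where "K2 = exp_avg K1" define K3 where "K3 = exp_avg K2"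
  have g0: "good F B" using F by (simp add: good_def B_def)
  note g1 = K[OF g0, folded K1_def] note g2 = K[OF g1, folded K2_def] note g3 = K[OF g2, folded K3_def]
  have w1: "has_weak_deriv K1 (\<lambda>x. F x - K1 x)" and w2: "has_weak_deriv K2 (\<lambda>x. K1 x - K2 x)"
    and w3: "has_weak_deriv K3 (\<lambda>x. K2 x - K3 x)"
    using exp_avg_weak_deriv g0 g1 g2 unfolding K1_def K2_def K3_def good_def by auto
  have wd: "has_weak_deriv (\<lambda>x. f x - g x) (\<lambda>x. f' x - g' x)" if "has_weak_deriv f f'" "has_weak_deriv g g'" for f f' g g'
    using has_weak_deriv_add[OF that(1) has_weak_deriv_cmult[OF that(2), of "-1"]] by simp
  define r where "r = (\<lambda>x. - (1 / \<nu>) * K3 x)"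
  define r1 where "r1 = (\<lambda>x. - (1 / \<nu>) * (K2 x - K3 x))"
  define r2 where "r2 = (\<lambda>x. - (1 / \<nu>) * (K1 x - K2 x - (K2 x - K3 x)))"
  define r3 where "r3 = (\<lambda>x. - (1 / \<nu>) * (F x - K1 x - (K1 x - K2 x) - (K1 x - K2 x - (K2 x - K3 x))))"
  define q where "q = (\<lambda>x. (1 / \<sigma>) * (K1 x + (K2 x + K3 x)))"
  define q1 where "q1 = (\<lambda>x. (1 / \<sigma>) * (F x - K1 x + (K1 x - K2 x + (K2 x - K3 x))))"
  have wr: "has_weak_deriv r r1" "has_weak_deriv r1 r2" "has_weak_deriv r2 r3"
    unfolding r_def r1_def r2_def r3_def by (intro has_weak_deriv_cmult wd w1 w2 w3)+
  have wq: "has_weak_deriv q q1"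
    unfolding q_def q1_def by (intro has_weak_deriv_cmult has_weak_deriv_add w1 w2 w3)
  have "K1 \<in> sobolev (Suc 0)" unfolding K1_def using F by (intro exp_avg_sobolev) simp
  then have "K2 \<in> sobolev (Suc (Suc 0))" unfolding K2_def by (rule exp_avg_sobolev)
  then have "K3 \<in> sobolev (Suc (Suc (Suc 0)))" unfolding K3_def by (rule exp_avg_sobolev)
  have gr: "good r ((cmod (1 / \<nu>))\<^sup>2 * B)" "good r1 ((cmod (1 / \<nu>))\<^sup>2 * (4 * B))"
    "good r2 ((cmod (1 / \<nu>))\<^sup>2 * (16 * B))"
    using mul[OF g3, of "- (1 / \<nu>)"] mul[OF diff[OF g2 g3], of "- (1 / \<nu>)"]
      mul[OF diff[OF diff[OF g1 g2] diff[OF g2 g3]], of "- (1 / \<nu>)"]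
    unfolding r_def r1_def r2_def by (simp_all add: norm_divide)
  \<comment> \<open>The third derivative is a multiple of \<open>F - 3 K1 + 3 K2 - K3\<close>.
    Adding its terms one at a time costs \<open>2 + 2 * (18 + 2 * (18 + 2)) = 118\<close>, the
    largest of the six constants.\<close>
  have "(\<lambda>x. - (1 / \<nu>) * (F x + (-3 * K1 x + (3 * K2 x + -1 * K3 x)))) = r3"
    unfolding r3_def by (auto simp: algebra_simps)
  then have gr3: "good r3 ((cmod (1 / \<nu>))\<^sup>2 * (2 * B + 2 * (2 * (9 * B) + 2 * (2 * (9 * B) + 2 * B))))"
    using mul[OF add[OF g0 add[OF mul[OF g1, of "-3"] add[OF mul[OF g2, of 3] mul[OF g3, of "-1"]]]], of "- (1 / \<nu>)"]
    by (simp add: norm_divide)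
  have "(\<lambda>x. (1 / \<sigma>) * (F x - K3 x)) = q1" unfolding q1_def by (auto simp: algebra_simps)
  then have gq: "good q ((cmod (1 / \<sigma>))\<^sup>2 * (10 * B))" "good q1 ((cmod (1 / \<sigma>))\<^sup>2 * (4 * B))"
    using mul[OF add[OF g1 add[OF g2 g3]], of "1 / \<sigma>"] mul[OF diff[OF g0 g3], of "1 / \<sigma>"]
    unfolding q_def by simp_all
  have B: "0 \<le> B" by (simp add: B_def)
  have le: "(cmod (1 / \<nu>))\<^sup>2 * (c * B) \<le> 118 * ((cmod (1 / \<nu>))\<^sup>2 + (cmod (1 / \<sigma>))\<^sup>2) * B"
    "(cmod (1 / \<sigma>))\<^sup>2 * (c * B) \<le> 118 * ((cmod (1 / \<nu>))\<^sup>2 + (cmod (1 / \<sigma>))\<^sup>2) * B" if "c \<le> 118" for c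
  proof -
    have "a * (c * B) \<le> 118 * (a + b) * B" "b * (c * B) \<le> 118 * (a + b) * B" if "0 \<le> a" "0 \<le> b" for a b
    proof -
      have "a * (c * B) \<le> a * (118 * B)" "b * (c * B) \<le> b * (118 * B)" "0 \<le> a * B" "0 \<le> b * B"
        using that B \<open>c \<le> 118\<close> by (auto intro!: mult_left_mono mult_right_mono)
      then show "a * (c * B) \<le> 118 * (a + b) * B" "b * (c * B) \<le> 118 * (a + b) * B"
        by (auto simp: algebra_simps)
    qed
    then show "(cmod (1 / \<nu>))\<^sup>2 * (c * B) \<le> 118 * ((cmod (1 / \<nu>))\<^sup>2 + (cmod (1 / \<sigma>))\<^sup>2) * B"
      "(cmod (1 / \<sigma>))\<^sup>2 * (c * B) \<le> 118 * ((cmod (1 / \<nu>))\<^sup>2 + (cmod (1 / \<sigma>))\<^sup>2) * B" by auto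
  qed
  have gr3': "good r3 ((cmod (1 / \<nu>))\<^sup>2 * (118 * B))" using gr3 by (simp add: algebra_simps)
  have "\<forall>f\<in>{r, r1, r2, r3, q, q1}. sqnorm f \<le> 118 * ((cmod (1 / \<nu>))\<^sup>2 + (cmod (1 / \<sigma>))\<^sup>2) * B"
    using gr gr3' gq le[of 1] le[of 4] le[of 16] le[of 118] le[of 10] unfolding good_def
    by auto
  moreover have "(r, q) \<in> lin_domain"
  proof -
    have "r \<in> sobolev 3" unfolding r_def numeral_3_eq_3
      by (rule sobolev_cmult) fact
    moreover have "q \<in> sobolev (Suc 0)"
      by (rule sobolev_SucI[OF _ wq]) (use gq in \<open>auto simp: good_def\<close>)
    ultimately show ?thesis by (simp add: lin_domain_def del: sobolev.simps)
  qed
  moreover have "AE x in lborel. \<sigma> * wderiv q x - \<nu> * r x = F x"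
    using wderiv_AE[OF wq]
    by eventually_elim (use \<nu> \<sigma> in \<open>simp add: q1_def r_def\<close>)
  ultimately show thesis
    using that[of r q r1 r2 r3 q1] wr wq gr gr3 gq unfolding good_def B_def by blast
qed

lemma zero_solves: "solves_resolvent_eq A \<nu> (\<lambda>x. 0, \<lambda>x. 0) (\<lambda>x. 0, \<lambda>x. 0)"
proof -
  have "AE x in lborel. snd (A (\<lambda>x. 0, \<lambda>x. 0)) x = form (\<lambda>x. 0) (\<lambda>x. 0) (\<lambda>x. 0) (\<lambda>x. 0) (\<lambda>x. 0) (\<lambda>x. 0) x"
    by (intro snd_A_form has_weak_deriv_zero L2_zero)
  then have "AE x in lborel. snd (A (\<lambda>x. 0, \<lambda>x. 0)) x = 0" by eventually_elim (simp add: form_def)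
  then show ?thesis using wderiv_AE[OF has_weak_deriv_zero] by (simp add: solves_iff)
qed

text \<open>Superposition: \<open>(r, q)\<close> takes care of \<open>F1\<close>, and
  \<open>(u, p)\<close>, obtained from the scalar problem, removes the residual \<open>f\<close> in
  the second equation without disturbing the first. The difference of two solutions solves the
  homogeneous problem, where scalar uniqueness applies.\<close>

lemma reduced_imp_resolvent:
  assumes "reduced_solvable (reduced \<nu>)"
  shows "\<nu> \<in> resolvent_set lin_domain A"
proof -
  obtain C where "C \<ge> 0" and C: "\<And>f. f \<in> L2 \<Longrightarrow> \<exists>q\<in>sobolev 4. (AE x in lborel. reduced \<nu> q x = f x) \<and>
     sqnorm q + sqnorm (wderiv q) \<le> C * sqnorm f \<and>
     (\<forall>p\<in>sobolev 4. (AE x in lborel. reduced \<nu> p x = f x) \<longrightarrow> (AE x in lborel. p x = q x))"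
    using assms unfolding reduced_solvable_def by blast
  define b where "b = 118 * ((cmod (1 / \<nu>))\<^sup>2 + (cmod (1 / \<sigma>))\<^sup>2)"
  define s where "s = (cmod (\<sigma> / \<nu>))\<^sup>2"
  \<comment> \<open>\<open>m\<close> bounds the residual \<open>f\<close>: the summand 2 accounts
    for \<open>F2\<close>, the term with 94 for the second component of \<open>A\<close> at
    \<open>(r, q)\<close>, and the last term for \<open>\<nu> * q\<close>.\<close>
  define m where "m = 2 + 2 * (2 * (94 * K\<^sup>2 * b) + 2 * ((cmod \<nu>)\<^sup>2 * b))"
  have nonneg: "0 \<le> b" "0 \<le> s" "0 \<le> m" by (auto simp: b_def s_def m_def)
  show ?thesis
  proof (rule resolvent_setI)
    show "0 \<le> 4 * b + 2 * (1 + s) * (C * m)" using nonneg \<open>C \<ge> 0\<close> by simp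
    fix F1 F2 assume F: "F1 \<in> L2" "F2 \<in> L2"
    define B1 where "B1 = sqnorm F1" define B2 where "B2 = sqnorm F2"
    have B: "0 \<le> B1" "0 \<le> B2" by (auto simp: B1_def B2_def)
    obtain r r1 r2 r3 q q1 where dom: "(r, q) \<in> lin_domain"
      and eq1: "AE x in lborel. \<sigma> * wderiv q x - \<nu> * r x = F1 x"
      and w: "has_weak_deriv r r1" "has_weak_deriv r1 r2" "has_weak_deriv r2 r3" "has_weak_deriv q q1"
      and l: "r \<in> L2" "r1 \<in> L2" "r2 \<in> L2" "r3 \<in> L2" "q \<in> L2" "q1 \<in> L2"
      and bd: "\<forall>f\<in>{r, r1, r2, r3, q, q1}. sqnorm f \<le> b * B1"
      by (rule first_component_solution[OF F(1), folded b_def B1_def]) (rule that)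
    define g where "g = form r r1 r2 r3 q q1"
    have g: "g \<in> L2" "sqnorm g \<le> 94 * K\<^sup>2 * (b * B1)"
      unfolding g_def using l bd by (auto intro!: form_L2 form_sqnorm)
    have gA: "AE x in lborel. snd (A (r, q)) x = g x" unfolding g_def by (intro snd_A_form w l)
    define f where "f = (\<lambda>x. F2 x + (- 1 * g x + \<nu> * q x))"
    have g': "(\<lambda>x. - 1 * g x) \<in> L2" "sqnorm (\<lambda>x. -1 * g x) \<le> 94 * K\<^sup>2 * (b * B1)"
      using g by (simp_all add: L2_uminus sqnorm_def)
    have "sqnorm (\<lambda>x. \<nu> * q x) \<le> (cmod \<nu>)\<^sup>2 * sqnorm q"
      using L2_mult(2)[OF l(5), of "\<lambda>_. \<nu>" "cmod \<nu>"] by simp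
    also have "\<dots> \<le> (cmod \<nu>)\<^sup>2 * (b * B1)" using bd by (intro mult_left_mono) auto
    finally have q': "sqnorm (\<lambda>x. \<nu> * q x) \<le> (cmod \<nu>)\<^sup>2 * (b * B1)" .
    note gq = L2_add[OF g'(1) L2_cmult[OF l(5), of \<nu>]]
    note ff = L2_add[OF F(2) gq(1), folded f_def]
    note ff(2)
    also have "2 * sqnorm F2 + 2 * sqnorm (\<lambda>x. - 1 * g x + \<nu> * q x) \<le>
        2 * B2 + 2 * (2 * sqnorm (\<lambda>x. - 1 * g x) + 2 * sqnorm (\<lambda>x. \<nu> * q x))"
      unfolding B2_def by (intro add_left_mono mult_left_mono gq(2)) simp
    also have "\<dots> \<le> 2 * B2 + 2 * (2 * (94 * K\<^sup>2 * (b * B1)) + 2 * ((cmod \<nu>)\<^sup>2 * (b * B1)))"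
      by (intro add_mono mult_left_mono order_refl g'(2) q') simp_all
    also have "\<dots> = 2 * B2 + (m - 2) * B1" by (simp add: m_def algebra_simps)
    also have "\<dots> \<le> m * (B1 + B2)"
    proof -
      have "0 \<le> (m - 2) * B2" unfolding m_def using nonneg B by simp
      then show ?thesis using B by (simp add: algebra_simps)
    qed
    finally have fle: "sqnorm f \<le> m * (B1 + B2)" .
    obtain p where p: "p \<in> sobolev 4" "AE x in lborel. reduced \<nu> p x = f x"
      and ple: "sqnorm p + sqnorm (wderiv p) \<le> C * sqnorm f"
      using C[OF ff(1)] by blast
    define u where "u = (\<lambda>x. \<sigma> / \<nu> * wderiv p x)"
    have up: "(u, p) \<in> lin_domain" unfolding u_def by (rule sobolev4_domain[OF p(1)])
    note d = lin_domainD[OF dom] and d' = lin_domainD[OF up]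
    have sol: "solves_resolvent_eq A \<nu> (\<lambda>x. r x + u x, \<lambda>x. q x + p x) (F1, F2)"
      unfolding solves_iff
    proof
      show "AE x in lborel. \<sigma> * wderiv (\<lambda>x. q x + p x) x - \<nu> * (r x + u x) = F1 x"
        using wderiv_AE[OF has_weak_deriv_add[OF d(10) d'(10)]] eq1
        by eventually_elim (use \<nu> in \<open>simp add: u_def algebra_simps\<close>)
      show "AE x in lborel. snd (A (\<lambda>x. r x + u x, \<lambda>x. q x + p x)) x - \<nu> * (q x + p x) = F2 x"
        using snd_A_add[OF dom up] gA p(2) unfolding reduced_def u_def[symmetric] f_def
        by eventually_elim (simp add: algebra_simps)
    qed
    have dom': "(\<lambda>x. r x + u x, \<lambda>x. q x + p x) \<in> lin_domain"
      using dom up by (simp add: lin_domain_def sobolev_add del: sobolev.simps)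
    have "sqnorm u \<le> s * sqnorm (wderiv p)"
      unfolding u_def s_def using L2_mult(2)[OF d'(6), of "\<lambda>_. \<sigma> / \<nu>" "cmod (\<sigma> / \<nu>)"] by simp
    then have "sqnorm (\<lambda>x. r x + u x) + sqnorm (\<lambda>x. q x + p x) \<le>
        4 * (b * B1) + 2 * (s * sqnorm (wderiv p) + sqnorm p)"
      using L2_add(2)[OF d(1) d'(1)] L2_add(2)[OF d(5) d'(5)] bd by simp
    also have "\<dots> \<le> 4 * (b * B1) + 2 * ((1 + s) * (sqnorm p + sqnorm (wderiv p)))"
      using nonneg by (simp add: algebra_simps)
    also have "\<dots> \<le> 4 * (b * B1) + 2 * ((1 + s) * (C * (m * (B1 + B2))))"
      using ple mult_left_mono[OF fle \<open>C \<ge> 0\<close>] nonneg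
      by (intro add_left_mono mult_left_mono) auto
    also have "\<dots> \<le> 4 * (b * (B1 + B2)) + 2 * ((1 + s) * (C * (m * (B1 + B2))))"
      using nonneg B by (intro add_right_mono mult_left_mono) auto
    also have "\<dots> = (4 * b + 2 * (1 + s) * (C * m)) * (sqnorm F1 + sqnorm F2)"
      by (simp add: B1_def B2_def algebra_simps)
    finally have le: "sqnorm (\<lambda>x. r x + u x) + sqnorm (\<lambda>x. q x + p x) \<le>
       (4 * b + 2 * (1 + s) * (C * m)) * (sqnorm F1 + sqnorm F2)" .
    have "AE x in lborel. fst V x = r x + u x \<and> snd V x = q x + p x"
      if V: "V \<in> lin_domain" "solves_resolvent_eq A \<nu> V (F1, F2)" for V
    proof -
      obtain r' q' where V_eq: "V = (r', q')" by force
      let ?r = "\<lambda>x. - 1 * (r x + u x)" and ?q = "\<lambda>x. - 1 * (q x + p x)"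
      have V': "(r', q') \<in> lin_domain" and neg: "(?r, ?q) \<in> lin_domain"
        using V(1) dom' sobolev_cmult[of "\<lambda>x. r x + u x" 3 "-1"] sobolev_cmult[of "\<lambda>x. q x + p x" 1 "-1"]
        unfolding V_eq by (auto simp: lin_domain_def simp del: sobolev.simps)
      let ?dr = "\<lambda>x. r' x + ?r x" and ?dq = "\<lambda>x. q' x + ?q x"
      have D: "(?dr, ?dq) \<in> lin_domain"
        using V' neg unfolding lin_domain_def mem_Sigma_iff by (intro conjI sobolev_add) auto
      have "solves_resolvent_eq A \<nu> (?dr, ?dq) (\<lambda>x. 0, \<lambda>x. 0)"
        unfolding solves_iff
      proof
        have e1: "AE x in lborel. \<sigma> * wderiv q' x - \<nu> * r' x = F1 x"
          "AE x in lborel. \<sigma> * wderiv (\<lambda>x. q x + p x) x - \<nu> * (r x + u x) = F1 x"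
          using V(2) sol unfolding V_eq solves_iff by auto
        show "AE x in lborel. \<sigma> * wderiv ?dq x - \<nu> * ?dr x = 0"
          using wderiv_AE[OF has_weak_deriv_add[OF lin_domainD(10)[OF V'] has_weak_deriv_cmult[OF lin_domainD(10)[OF dom'], of "-1"]]] e1
          by eventually_elim algebra
        have e2: "AE x in lborel. snd (A (r', q')) x - \<nu> * q' x = F2 x"
          "AE x in lborel. snd (A (\<lambda>x. r x + u x, \<lambda>x. q x + p x)) x - \<nu> * (q x + p x) = F2 x"
          using V(2) sol unfolding V_eq solves_iff by auto
        show "AE x in lborel. snd (A (?dr, ?dq)) x - \<nu> * ?dq x = 0"
          using snd_A_add[OF V' neg] snd_A_cmult[OF dom', of "-1"] e2
          by eventually_elim (simp add: algebra_simps)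
      qed
      note dq = solves_reduced[OF D this] and z = solves_reduced[OF zero_domain zero_solves]
      \<comment> \<open>Uniqueness is invoked for zero data: \<open>?dq\<close> and the zero
        function both agree with the solution \<open>q0\<close>.\<close>
      obtain q0 where q0: "\<And>p. p \<in> sobolev 4 \<Longrightarrow> AE x in lborel. reduced \<nu> p x = 0 \<Longrightarrow> AE x in lborel. p x = q0 x"
        using C[OF L2_zero] by blast
      have "AE x in lborel. ?dq x = 0" using q0[OF dq(1,3)] q0[OF z(1,3)] by eventually_elim simp
      moreover from this have "AE x in lborel. wderiv ?dq x = 0"
        using wderiv_AE[OF has_weak_deriv_zero] by (subst wderiv_cong[of _ "\<lambda>x. 0"])
      ultimately show ?thesis using dq(2) unfolding V_eq
        by eventually_elim (simp add: algebra_simps)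
    qed
    with dom' sol le show "\<exists>r q. (r, q) \<in> lin_domain \<and> solves_resolvent_eq A \<nu> (r, q) (F1, F2) \<and>
       sqnorm r + sqnorm q \<le> (4 * b + 2 * (1 + s) * (C * m)) * (sqnorm F1 + sqnorm F2) \<and>
       (\<forall>V\<in>lin_domain. solves_resolvent_eq A \<nu> V (F1, F2) \<longrightarrow>
          (AE x in lborel. fst V x = r x \<and> snd V x = q x))"
      by blast
  qed
qed

theorem resolvent_iff_reduced:
  "\<nu> \<in> resolvent_set lin_domain A \<longleftrightarrow> reduced_solvable (reduced \<nu>)"
  using reduced_imp_resolvent resolvent_imp_reduced by blast

end

text \<open>The data \<open>indicator {0..1}\<close> in the first equation make the continuous
  representative of \<open>q\<close> constant on each ray outside the interval, with values
  differing by \<open>1 / \<sigma>\<close>; square integrability would force both values to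
  vanish.\<close>

lemma zero_notin_resolvent_set: "0 \<notin> resolvent_set lin_domain A"
proof
  assume "0 \<in> resolvent_set lin_domain A"
  moreover have F: "(\<lambda>x. indicator {0..1} x) \<in> L2"
  proof -
    have "(\<lambda>x. (cmod (indicator {0..1::real} x))\<^sup>2) = (indicator {0..1} :: real \<Rightarrow> real)"
      by (auto simp: indicator_def)
    then show ?thesis
      by (simp add: L2_iff integrable_indicator_iff)
  qed
  ultimately obtain r q where dom: "(r, q) \<in> lin_domain"
    and "solves_resolvent_eq A 0 (r, q) (\<lambda>x. indicator {0..1} x, \<lambda>x. 0)"
    using resolvent_setE[of 0 lin_domain A] L2_zero by metis
  then have "AE x in lborel. \<sigma> * wderiv q x = indicator {0..1} x" by (simp add: solves_iff)
  then have ae: "AE x in lborel. wderiv q x = 1 / \<sigma> * indicator {0..1} x"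
    by eventually_elim (use \<sigma> in \<open>simp add: field_simps\<close>)
  note d = lin_domainD[OF dom]
  have "has_weak_deriv q (\<lambda>x. 1 / \<sigma> * indicator {0..1} x)"
    by (rule has_weak_deriv_cong_right[OF d(10) ae]) simp
  then obtain h where qh: "AE x in lborel. q x = h x"
    and h: "antiderivative h (\<lambda>x. 1 / \<sigma> * indicator {0..1} x)"
    unfolding has_weak_deriv_antiderivative by blast
  have not_L2: "c = 0" if c: "\<And>x. x \<in> S \<Longrightarrow> h x = c" and S: "S \<in> sets borel" "emeasure lborel S = \<infinity>" for c S
  proof (rule ccontr)
    assume "c \<noteq> 0"
    have "integrable lborel (\<lambda>x. (cmod (q x))\<^sup>2)" using d(5) by (simp add: L2_iff)
    then have "integrable lborel (\<lambda>x. indicator S x *\<^sub>R (cmod (q x))\<^sup>2)"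
      using S by (intro integrable_mult_indicator) auto
    then have "integrable lborel (\<lambda>x. (cmod c)\<^sup>2 * indicator S x)"
      by (rule integrable_cong_AE_imp) (use S qh in \<open>auto simp: indicator_def c elim!: eventually_mono\<close>)
    then show False using \<open>c \<noteq> 0\<close> S by (simp add: integrable_indicator_iff)
  qed
  have "h x = h 0" if "x \<in> {..0}" for x
  proof -
    have "h 0 - h x = (LINT t:{x..0}|lborel. 1 / \<sigma> * indicator {0..1} t)"
      using antiderivativeD(2)[OF h, of x 0] that by simp
    also have "\<dots> = (LINT t|(lborel :: real measure). 0)" unfolding set_lebesgue_integral_def
      by (rule integral_cong_AE) (use AE_lborel_singleton[of 0] in \<open>auto simp: indicator_def elim!: eventually_mono\<close>)
    finally show ?thesis by simp
  qed
  from not_L2[of "{..0}", OF this _ emeasure_lborel_ray(1)] have h0: "h 0 = 0" by simp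
  have h1: "h 1 = 1 / \<sigma>"
  proof -
    have "h 1 - h 0 = (LINT t:{0..1::real}|lborel. 1 / \<sigma> * indicator {0..1} t)"
      using antiderivativeD(2)[OF h, of 0 1] by simp
    also have "\<dots> = (LINT t:{0..1::real}|lborel. 1 / \<sigma>)"
      by (rule set_lebesgue_integral_cong) auto
    also have "\<dots> = 1 / \<sigma>" by (simp add: set_integral_const)
    finally show ?thesis using h0 by simp
  qed
  have "h x = 1 / \<sigma>" if "x \<in> {1..}" for x
  proof -
    have "h x - h 1 = (LINT t:{1..x}|lborel. 1 / \<sigma> * indicator {0..1} t)"
      using antiderivativeD(2)[OF h, of 1 x] that by simp
    also have "\<dots> = (LINT t|(lborel :: real measure). 0)" unfolding set_lebesgue_integral_def
      by (rule integral_cong_AE) (use AE_lborel_singleton[of 1] in \<open>auto simp: indicator_def elim!: eventually_mono\<close>)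
    finally show ?thesis using h1 by simp
  qed
  from not_L2[of "{1..}", OF this _ emeasure_lborel_ray(2)] \<sigma> show False by simp
qed

end

section \<open>Bounded smooth coefficients\<close>

text \<open>\<open>C^k\<close> with bounded derivatives up to order \<open>k\<close>. The recursion
  passes to a witness for the derivative, so closure under sums, products and quotients is a plain
  induction without iterated \<open>deriv\<close>.\<close>

fun bounded_diff :: "nat \<Rightarrow> (real \<Rightarrow> real) \<Rightarrow> bool" where
  "bounded_diff 0 c \<longleftrightarrow> continuous_on UNIV c \<and> bounded (range c)"
| "bounded_diff (Suc k) c \<longleftrightarrow>
     bounded (range c) \<and> (\<exists>c'. (\<forall>x. (c has_real_derivative c' x) (at x)) \<and> bounded_diff k c')"

lemma bounded_diff_bounded: "bounded_diff k c \<Longrightarrow> bounded (range c)"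
  by (cases k) auto

lemma bounded_diff_Suc_imp: "bounded_diff (Suc k) c \<Longrightarrow> bounded_diff k c"
proof (induction k arbitrary: c)
  case 0
  then show ?case by (auto intro: DERIV_continuous_on)
next
  case (Suc k)
  then show ?case by (metis bounded_diff.simps(2))
qed

lemma bounded_range_add:
  fixes c d :: "real \<Rightarrow> real"
  assumes "bounded (range c)" "bounded (range d)" shows "bounded (range (\<lambda>x. c x + d x))"
  using bounded_plus_comp[OF assms] by simp

lemma bounded_range_mult:
  fixes c d :: "real \<Rightarrow> real"
  assumes "bounded (range c)" "bounded (range d)" shows "bounded (range (\<lambda>x. c x * d x))"
proof -
  obtain C D where "\<And>x. \<bar>c x\<bar> \<le> C" "\<And>x. \<bar>d x\<bar> \<le> D" using assms by (auto simp: bounded_iff)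
  then have "\<bar>c x * d x\<bar> \<le> C * D" for x
    unfolding abs_mult by (intro mult_mono) (auto intro: order_trans[OF abs_ge_zero])
  then show ?thesis by (auto simp: bounded_iff)
qed

lemma bounded_diff_const: "bounded_diff k (\<lambda>x. a)"
proof (induction k arbitrary: a)
  case (Suc k)
  show ?case using Suc[of 0] by (auto intro!: exI[of _ "\<lambda>x. 0"])
qed simp

lemma bounded_diff_add: "bounded_diff k c \<Longrightarrow> bounded_diff k d \<Longrightarrow> bounded_diff k (\<lambda>x. c x + d x)"
proof (induction k arbitrary: c d)
  case 0
  then show ?case by (auto intro: continuous_on_add bounded_range_add)
next
  case (Suc k)
  obtain c' d' where "\<forall>x. (c has_real_derivative c' x) (at x)" "bounded_diff k c'"
    "\<forall>x. (d has_real_derivative d' x) (at x)" "bounded_diff k d'" using Suc.prems by auto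
  then show ?case using Suc.prems Suc.IH
    by (auto intro!: exI[of _ "\<lambda>x. c' x + d' x"] DERIV_add bounded_range_add)
qed

lemma bounded_diff_mult: "bounded_diff k c \<Longrightarrow> bounded_diff k d \<Longrightarrow> bounded_diff k (\<lambda>x. c x * d x)"
proof (induction k arbitrary: c d)
  case 0
  then show ?case by (auto intro: continuous_on_mult bounded_range_mult)
next
  case (Suc k)
  obtain c' d' where "\<forall>x. (c has_real_derivative c' x) (at x)" "bounded_diff k c'"
    "\<forall>x. (d has_real_derivative d' x) (at x)" "bounded_diff k d'" using Suc.prems by auto
  then show ?case using Suc.prems Suc.IH bounded_diff_Suc_imp[of k c] bounded_diff_Suc_imp[of k d]
    by (auto intro!: exI[of _ "\<lambda>x. c' x * d x + d' x * c x"] DERIV_mult bounded_range_mult bounded_diff_add)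
qed

lemma bounded_diff_inverse:
  assumes "\<delta> > 0" "\<And>x. \<delta> \<le> c x"
  shows "bounded_diff k c \<Longrightarrow> bounded_diff k (\<lambda>x. 1 / c x)"
proof -
  have bdd: "bounded (range (\<lambda>x. 1 / c x))"
  proof -
    have "\<bar>1 / c x\<bar> \<le> 1 / \<delta>" for x
      using assms(1) assms(2)[of x] by (auto simp: frac_le)
    then show ?thesis by (auto simp: bounded_iff)
  qed
  have nz: "c x \<noteq> 0" for x using assms(1) assms(2)[of x] by auto
  show "bounded_diff k c \<Longrightarrow> bounded_diff k (\<lambda>x. 1 / c x)"
  proof (induction k)
    case 0
    then show ?case using bdd nz by (auto intro!: continuous_intros)
  next
    case (Suc k)
    then obtain c' where c': "\<forall>x. (c has_real_derivative c' x) (at x)" "bounded_diff k c'" by auto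
    have i: "bounded_diff k (\<lambda>x. 1 / c x)" using Suc bounded_diff_Suc_imp by blast
    have "bounded_diff k (\<lambda>x. -1 * (c' x * (1 / c x * (1 / c x))))"
      by (intro bounded_diff_mult bounded_diff_const c' i)
    moreover have "((\<lambda>x. 1 / c x) has_real_derivative -1 * (c' x * (1 / c x * (1 / c x)))) (at x)" for x
      using c' nz by (auto intro!: derivative_eq_intros)
    ultimately show ?case using bdd unfolding bounded_diff.simps
      by (intro conjI exI[of _ "\<lambda>x. -1 * (c' x * (1 / c x * (1 / c x)))"] allI)
  qed
qed

definition bounded_smooth :: "(real \<Rightarrow> real) \<Rightarrow> bool" where
  "bounded_smooth c \<longleftrightarrow> (\<forall>k. bounded_diff k c)"

lemma bounded_smooth_deriv:
  assumes "bounded_smooth c"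
  shows "(c has_real_derivative deriv c x) (at x)" "bounded_smooth (deriv c)"
proof -
  have *: "\<exists>c'. (\<forall>x. (c has_real_derivative c' x) (at x)) \<and> bounded_diff k c'" for k
    using assms unfolding bounded_smooth_def by (metis bounded_diff.simps(2))
  then show 1: "(c has_real_derivative deriv c x) (at x)" for x
    using DERIV_deriv_iff_real_differentiable real_differentiable_def by blast
  have "bounded_diff k (deriv c)" for k
  proof -
    obtain c' where c': "\<And>x. (c has_real_derivative c' x) (at x)" "bounded_diff k c'" using * by blast
    then have "deriv c = c'" by (auto intro: DERIV_imp_deriv)
    then show ?thesis using c' by simp
  qed
  then show "bounded_smooth (deriv c)" by (simp add: bounded_smooth_def)
qed

lemma bounded_smooth_continuous: "bounded_smooth c \<Longrightarrow> continuous_on UNIV c"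
  unfolding bounded_smooth_def by (metis bounded_diff.simps(1))

lemma bounded_smooth_measurable: "bounded_smooth c \<Longrightarrow> c \<in> borel_measurable borel"
  by (intro borel_measurable_continuous_onI bounded_smooth_continuous)

lemma bounded_smooth_bounded: "bounded_smooth c \<Longrightarrow> \<exists>C. \<forall>x. \<bar>c x\<bar> \<le> C"
  using bounded_diff_bounded unfolding bounded_smooth_def by (fastforce simp: bounded_iff)

lemma bounded_smooth_const: "bounded_smooth (\<lambda>x. a)"
  and bounded_smooth_add: "bounded_smooth c \<Longrightarrow> bounded_smooth d \<Longrightarrow> bounded_smooth (\<lambda>x. c x + d x)"
  and bounded_smooth_mult: "bounded_smooth c \<Longrightarrow> bounded_smooth d \<Longrightarrow> bounded_smooth (\<lambda>x. c x * d x)"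
  by (simp_all add: bounded_smooth_def bounded_diff_const bounded_diff_add bounded_diff_mult)

lemma bounded_smooth_uminus: "bounded_smooth c \<Longrightarrow> bounded_smooth (\<lambda>x. - c x)"
  using bounded_smooth_mult[OF bounded_smooth_const[of "-1"], of c] by simp

lemma bounded_smooth_diff: "bounded_smooth c \<Longrightarrow> bounded_smooth d \<Longrightarrow> bounded_smooth (\<lambda>x. c x - d x)"
  using bounded_smooth_add[OF _ bounded_smooth_uminus, of c d] by simp

lemma bounded_smooth_power: "bounded_smooth c \<Longrightarrow> bounded_smooth (\<lambda>x. c x ^ n)"
  by (induction n) (simp_all add: bounded_smooth_const bounded_smooth_mult)

lemma bounded_smooth_inverse: "bounded_smooth c \<Longrightarrow> \<delta> > 0 \<Longrightarrow> (\<And>x. \<delta> \<le> c x) \<Longrightarrow> bounded_smooth (\<lambda>x. 1 / c x)"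
  unfolding bounded_smooth_def using bounded_diff_inverse by blast

lemma bounded_smooth_divide:
  assumes "bounded_smooth d" "bounded_smooth c" "\<delta> > 0" "\<And>x. \<delta> \<le> c x" shows "bounded_smooth (\<lambda>x. d x / c x)"
  using bounded_smooth_mult[OF assms(1) bounded_smooth_inverse[OF assms(2-4)]] by simp

text \<open>Translation by \<open>\<lfloor>x / p\<rfloor>\<close> periods shows that every value is
  taken on the compact interval \<open>{0..p}\<close>.\<close>

lemma periodic_bounded:
  fixes u :: "real \<Rightarrow> real"
  assumes "p > 0" "\<And>x. u (x + p) = u x" "continuous_on UNIV u"
  shows "bounded (range u)"
proof -
  interpret periodic_fun_simple u p by unfold_locales (rule assms(2))
  have "range u \<subseteq> u ` {0..p}"
  proof
    fix y assume "y \<in> range u"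
    then obtain x where y: "y = u x" by auto
    have "x = (x - of_int \<lfloor>x / p\<rfloor> * p) + of_int \<lfloor>x / p\<rfloor> * p" by simp
    then have "u x = u (x - of_int \<lfloor>x / p\<rfloor> * p)" by (metis plus_of_int)
    moreover have "x - of_int \<lfloor>x / p\<rfloor> * p \<in> {0..p}"
      using floor_divide_lower[OF assms(1), of x] floor_divide_upper[OF assms(1), of x]
      by (auto simp: algebra_simps)
    ultimately show "y \<in> u ` {0..p}" using y by blast
  qed
  moreover have "bounded (u ` {0..p})"
    using assms(3) by (intro compact_imp_bounded compact_continuous_image) (auto intro: continuous_on_subset)
  ultimately show ?thesis by (rule bounded_subset[rotated])
qed

text \<open>Differentiation preserves periodicity, so boundedness of continuous periodic functions
  applies at every order.\<close>

lemma periodic_bounded_smooth: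
  assumes "p > 0"
  shows "smooth_fn u \<Longrightarrow> (\<And>x. u (x + p) = u x) \<Longrightarrow> bounded_smooth u"
proof -
  have "smooth_fn u \<Longrightarrow> (\<And>x. u (x + p) = u x) \<Longrightarrow> bounded_diff k u" for k
  proof (induction k arbitrary: u)
    case 0
    have "continuous_on UNIV u"
      using smooth_fnD(1)[OF 0(1)] by (meson DERIV_isCont continuous_at_imp_continuous_on)
    then show ?case using periodic_bounded[of p u] assms 0(2) by simp
  next
    case (Suc k)
    have c: "continuous_on UNIV u"
      using smooth_fnD(1)[OF Suc.prems(1)] by (meson DERIV_isCont continuous_at_imp_continuous_on)
    have "deriv u (x + p) = deriv u x" for x
    proof -
      have "((\<lambda>x. u (x + p)) has_real_derivative deriv u (x + p)) (at x)"
        using smooth_fnD(1)[OF Suc.prems(1), of "x + p"] by (simp add: DERIV_shift)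
      then have "(u has_real_derivative deriv u (x + p)) (at x)" using Suc.prems(2) by simp
      then show ?thesis by (metis DERIV_imp_deriv)
    qed
    then have "bounded_diff k (deriv u)" by (intro Suc.IH smooth_fnD(2) Suc.prems)
    then show ?case using periodic_bounded[of p u] assms Suc.prems(2) c smooth_fnD(1)[OF Suc.prems(1)] by auto
  qed
  then show "smooth_fn u \<Longrightarrow> (\<And>x. u (x + p) = u x) \<Longrightarrow> bounded_smooth u" by (simp add: bounded_smooth_def)
qed

lemma has_weak_deriv_bounded_smooth:
  assumes "bounded_smooth c" "has_weak_deriv f g" "f \<in> borel_measurable borel"
  shows "has_weak_deriv (\<lambda>x. of_real (c x) * f x) (\<lambda>x. of_real (deriv c x) * f x + of_real (c x) * g x)"
  using assms by (intro has_weak_deriv_mult bounded_smooth_deriv bounded_smooth_continuous)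

lemma sobolev_bounded_smooth: "bounded_smooth c \<Longrightarrow> f \<in> sobolev k \<Longrightarrow> (\<lambda>x. of_real (c x) * f x) \<in> sobolev k"
proof (induction k arbitrary: c f)
  case 0
  obtain C where "\<forall>x. \<bar>c x\<bar> \<le> C" using bounded_smooth_bounded[OF 0(1)] by blast
  then show ?case using 0 bounded_smooth_measurable[OF 0(1)] by (auto intro!: L2_mult(1)[where C = C])
next
  case (Suc k)
  note f = sobolev_SucD[OF Suc.prems(2)]
  obtain C where "\<forall>x. \<bar>c x\<bar> \<le> C" using bounded_smooth_bounded[OF Suc.prems(1)] by blast
  then have "(\<lambda>x. of_real (c x) * f x) \<in> L2"
    using f(1) bounded_smooth_measurable[OF Suc.prems(1)] by (auto intro!: L2_mult(1)[where C = C])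
  moreover have "(\<lambda>x. of_real (deriv c x) * f x + of_real (c x) * wderiv f x) \<in> sobolev k"
    using Suc.prems(2) sobolev_Suc_subset[of k] f(3)
    by (intro sobolev_add Suc.IH bounded_smooth_deriv Suc.prems) (auto simp del: sobolev.simps)
  ultimately show ?case
    by (intro sobolev_SucI[OF _ has_weak_deriv_bounded_smooth[OF Suc.prems(1) f(2) L2_measurable[OF f(1)]]])
qed

section \<open>The linearized operators\<close>

locale energy_profile =
  fixes E :: "real \<Rightarrow> real \<Rightarrow> real" and u :: "real \<Rightarrow> real" and \<delta> :: real
  assumes E: "smooth2_on ({0<..} \<times> UNIV) E"
    and u: "bounded_smooth u" and \<delta>: "\<delta> > 0" "\<And>x. \<delta> \<le> u x"
begin

lemma u_pos: "0 < u x" using \<delta>(1) \<delta>(2)[of x] by simp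

lemma along_deriv:
  assumes "smooth2_on ({0<..} \<times> UNIV) f"
  shows "((\<lambda>x. f (u x) (deriv u x)) has_real_derivative
    pd1 f (u x) (deriv u x) * deriv u x + pd2 f (u x) (deriv u x) * deriv (deriv u) x) (at x)"
  by (intro smooth2_chain assms u_pos bounded_smooth_deriv u)

text \<open>The pair \<open>(u, u')\<close> stays in a compact rectangle
  \<open>[\<delta>, C] \<times> [-D, D]\<close> inside the domain of \<open>f\<close>; this is where
  the positive lower bound on \<open>u\<close> enters. The derivative along the profile again
  consists of partial derivatives of \<open>f\<close> along the profile and of derivatives of
  \<open>u\<close>, so the induction runs over all smooth \<open>f\<close> at once.\<close>

lemma along_bounded_smooth:
  assumes "smooth2_on ({0<..} \<times> UNIV) f"
  shows "bounded_smooth (\<lambda>x. f (u x) (deriv u x))"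
proof -
  obtain C D where C: "\<And>x. \<bar>u x\<bar> \<le> C" and D: "\<And>x. \<bar>deriv u x\<bar> \<le> D"
    using bounded_smooth_bounded[OF u] bounded_smooth_bounded[OF bounded_smooth_deriv(2)[OF u]] by blast
  have bdd: "bounded (range (\<lambda>x. f (u x) (deriv u x)))" if f: "smooth2_on ({0<..} \<times> UNIV) f" for f
  proof -
    have "continuous_on ({\<delta>..C} \<times> {-D..D}) (\<lambda>(a, b). f a b)"
      by (rule continuous_on_subset[OF smooth2_onD(1)[OF f]]) (use \<delta>(1) in auto)
    then have "bounded ((\<lambda>(a, b). f a b) ` ({\<delta>..C} \<times> {-D..D}))"
      by (intro compact_imp_bounded compact_continuous_image compact_Times) auto
    moreover have "u x \<in> {\<delta>..C} \<and> deriv u x \<in> {-D..D}" for x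
      using C[of x] D[of x] \<delta>(2)[of x] by auto
    then have "range (\<lambda>x. f (u x) (deriv u x)) \<subseteq> (\<lambda>(a, b). f a b) ` ({\<delta>..C} \<times> {-D..D})"
      by (auto intro!: image_eqI[where x = "(u _, deriv u _)"])
    ultimately show ?thesis by (rule bounded_subset)
  qed
  have "smooth2_on ({0<..} \<times> UNIV) f \<Longrightarrow> bounded_diff k (\<lambda>x. f (u x) (deriv u x))" for k f
  proof (induction k arbitrary: f)
    case (0 f)
    then show ?case using bdd along_deriv[OF 0]
      by (auto intro!: continuous_at_imp_continuous_on DERIV_isCont)
  next
    case (Suc k f)
    have "bounded_diff k (\<lambda>x. pd1 f (u x) (deriv u x) * deriv u x + pd2 f (u x) (deriv u x) * deriv (deriv u) x)"
      using bounded_smooth_deriv(2)[OF u] bounded_smooth_deriv(2)[OF bounded_smooth_deriv(2)[OF u]]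
      by (intro bounded_diff_add bounded_diff_mult Suc.IH[OF smooth2_onD(4)[OF Suc.prems]]
          Suc.IH[OF smooth2_onD(5)[OF Suc.prems]]) (simp_all add: bounded_smooth_def)
    then show ?case unfolding bounded_diff.simps
      using bdd[OF Suc.prems] along_deriv[OF Suc.prems] by (intro conjI exI allI)
  qed
  then show ?thesis using assms by (simp add: bounded_smooth_def)
qed

abbreviation "E1 x \<equiv> pd1 E (u x) (deriv u x)"
abbreviation "E2 x \<equiv> pd2 E (u x) (deriv u x)"
abbreviation "E11 x \<equiv> pd1 (pd1 E) (u x) (deriv u x)"
abbreviation "E21 x \<equiv> pd2 (pd1 E) (u x) (deriv u x)"
abbreviation "E12 x \<equiv> pd1 (pd2 E) (u x) (deriv u x)"
abbreviation "E22 x \<equiv> pd2 (pd2 E) (u x) (deriv u x)"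

lemma along_partials_bounded_smooth:
  "bounded_smooth E1" "bounded_smooth E2" "bounded_smooth E11" "bounded_smooth E21" "bounded_smooth E12" "bounded_smooth E22"
  by (intro along_bounded_smooth smooth2_onD E)+

lemma euler_eq: "euler E u x = E1 x - deriv E2 x"
  by (simp add: euler_def)

text \<open>The stress may be exchanged for any almost everywhere equal \<open>P\<close> with known
  weak derivative. This freedom allows the Eulerian stress to be rewritten in Lagrangian quantities
  before it is differentiated.\<close>

lemma lin_euler_AE':
  assumes "has_weak_deriv h h1" "has_weak_deriv P P1"
    and "AE x in lborel. of_real (E12 x) * h x + of_real (E22 x) * h1 x = P x"
  shows "AE x in lborel. lin_euler wderiv E u h x = of_real (E11 x) * h x + of_real (E21 x) * h1 x - P1 x"
proof -
  have "AE x in lborel. of_real (E12 x) * h x + of_real (E22 x) * wderiv h x = P x"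
    using assms(3) wderiv_AE[OF assms(1)] by eventually_elim simp
  then have eq: "wderiv (\<lambda>x. of_real (E12 x) * h x + of_real (E22 x) * wderiv h x) = wderiv P"
    by (rule wderiv_cong)
  show ?thesis
    using wderiv_AE[OF assms(1)] wderiv_AE[OF assms(2)]
    unfolding lin_euler_def eq by eventually_elim simp
qed

lemma stress_weak_deriv:
  assumes "has_weak_deriv h h1" "has_weak_deriv h1 h2" "h \<in> borel_measurable borel"
  shows "has_weak_deriv (\<lambda>x. of_real (E12 x) * h x + of_real (E22 x) * h1 x)
    (\<lambda>x. of_real (deriv E12 x) * h x + of_real (E12 x) * h1 x +
      (of_real (deriv E22 x) * h1 x + of_real (E22 x) * h2 x))"
  using assms has_weak_deriv_measurable[OF assms(1)]
  by (intro has_weak_deriv_add has_weak_deriv_bounded_smooth along_partials_bounded_smooth) auto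

lemma lin_euler_AE:
  assumes "has_weak_deriv h h1" "has_weak_deriv h1 h2" "h \<in> borel_measurable borel"
  shows "AE x in lborel. lin_euler wderiv E u h x = of_real (E11 x - deriv E12 x) * h x
    + of_real (E21 x - E12 x - deriv E22 x) * h1 x + of_real (- E22 x) * h2 x"
proof -
  from lin_euler_AE'[OF assms(1) stress_weak_deriv[OF assms] AE_I2[OF refl]]
  show ?thesis by eventually_elim (simp add: algebra_simps)
qed

end

text \<open>Leibniz rule for a flux of order two in \<open>r\<close> and zero in \<open>q\<close>;
  the bound \<open>K\<close> is the maximum of the bounds of the six resulting coefficients.\<close>

lemma flux_third_order_operator:
  fixes fl :: "(real \<Rightarrow> complex) \<Rightarrow> (real \<Rightarrow> complex) \<Rightarrow> real \<Rightarrow> complex"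
  assumes c: "bounded_smooth c0" "bounded_smooth c1" "bounded_smooth c2" "bounded_smooth d" and \<sigma>: "(\<sigma>::real) \<noteq> 0"
    and fl: "\<And>r r1 r2 q. \<lbrakk>has_weak_deriv r r1; has_weak_deriv r1 r2; r \<in> borel_measurable borel\<rbrakk> \<Longrightarrow>
       AE x in lborel. fl r q x = of_real (c0 x) * r x + of_real (c1 x) * r1 x + of_real (c2 x) * r2 x + of_real (d x) * q x"
  obtains k0 k1 k2 k3 l0 l1 K where "third_order_operator
    (\<lambda>(r, q). (\<lambda>x. of_real \<sigma> * wderiv q x, \<lambda>x. of_real \<sigma> * wderiv (fl r q) x)) (of_real \<sigma>) k0 k1 k2 k3 l0 l1 K"
proof -
  let ?k0 = "\<lambda>x. \<sigma> * deriv c0 x" and ?k1 = "\<lambda>x. \<sigma> * (c0 x + deriv c1 x)"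
  let ?k2 = "\<lambda>x. \<sigma> * (c1 x + deriv c2 x)" and ?k3 = "\<lambda>x. \<sigma> * c2 x"
  let ?l0 = "\<lambda>x. \<sigma> * deriv d x" and ?l1 = "\<lambda>x. \<sigma> * d x"
  have k: "bounded_smooth ?k0" "bounded_smooth ?k1" "bounded_smooth ?k2" "bounded_smooth ?k3" "bounded_smooth ?l0" "bounded_smooth ?l1"
    by (intro bounded_smooth_mult bounded_smooth_const bounded_smooth_add bounded_smooth_deriv c)+
  obtain K0 K1 K2 K3 K4 K5 where K: "\<And>x. \<bar>?k0 x\<bar> \<le> K0" "\<And>x. \<bar>?k1 x\<bar> \<le> K1" "\<And>x. \<bar>?k2 x\<bar> \<le> K2"
    "\<And>x. \<bar>?k3 x\<bar> \<le> K3" "\<And>x. \<bar>?l0 x\<bar> \<le> K4" "\<And>x. \<bar>?l1 x\<bar> \<le> K5"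
    using k[THEN bounded_smooth_bounded] by blast
  define K where "K = Max {K0, K1, K2, K3, K4, K5}"
  have K_le: "K0 \<le> K" "K1 \<le> K" "K2 \<le> K" "K3 \<le> K" "K4 \<le> K" "K5 \<le> K"
    unfolding K_def by auto
  show thesis
  proof (rule that[of "\<lambda>x. of_real (?k0 x)" "\<lambda>x. of_real (?k1 x)" "\<lambda>x. of_real (?k2 x)"
        "\<lambda>x. of_real (?k3 x)" "\<lambda>x. of_real (?l0 x)" "\<lambda>x. of_real (?l1 x)" K], unfold_locales)
    fix r r1 r2 r3 q q1
    assume w: "has_weak_deriv r r1" "has_weak_deriv r1 r2" "has_weak_deriv r2 r3" "has_weak_deriv q q1"
      and m: "r \<in> borel_measurable borel" "q \<in> borel_measurable borel"
    have "wderiv (fl r q) = wderiv (\<lambda>x. of_real (c0 x) * r x + of_real (c1 x) * r1 x + of_real (c2 x) * r2 x + of_real (d x) * q x)"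
      by (rule wderiv_cong) (rule fl[OF w(1,2) m(1)])
    moreover have "has_weak_deriv (\<lambda>x. of_real (c0 x) * r x + of_real (c1 x) * r1 x + of_real (c2 x) * r2 x + of_real (d x) * q x)
       (\<lambda>x. (of_real (deriv c0 x) * r x + of_real (c0 x) * r1 x) + (of_real (deriv c1 x) * r1 x + of_real (c1 x) * r2 x)
         + (of_real (deriv c2 x) * r2 x + of_real (c2 x) * r3 x) + (of_real (deriv d x) * q x + of_real (d x) * q1 x))"
      using w m has_weak_deriv_measurable[OF w(1)] has_weak_deriv_measurable[OF w(2)]
      by (intro has_weak_deriv_add has_weak_deriv_bounded_smooth c)
    note wderiv_AE[OF this]
    ultimately show "AE x in lborel. snd ((\<lambda>(r, q). (\<lambda>x. of_real \<sigma> * wderiv q x, \<lambda>x. of_real \<sigma> * wderiv (fl r q) x)) (r, q)) x =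
        of_real (?k0 x) * r x + (of_real (?k1 x) * r1 x + (of_real (?k2 x) * r2 x + (of_real (?k3 x) * r3 x +
        (of_real (?l0 x) * q x + of_real (?l1 x) * q1 x))))"
      by (auto elim!: eventually_mono simp: algebra_simps)
  next
    show "(\<lambda>x. complex_of_real (?k0 x)) \<in> borel_measurable borel" "(\<lambda>x. complex_of_real (?k1 x)) \<in> borel_measurable borel"
     "(\<lambda>x. complex_of_real (?k2 x)) \<in> borel_measurable borel" "(\<lambda>x. complex_of_real (?k3 x)) \<in> borel_measurable borel"
     "(\<lambda>x. complex_of_real (?l0 x)) \<in> borel_measurable borel" "(\<lambda>x. complex_of_real (?l1 x)) \<in> borel_measurable borel"
      using k[THEN bounded_smooth_measurable] by (auto intro!: borel_measurable_of_real simp del: of_real_mult of_real_add)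
  next
    fix x
    show "cmod (of_real (?k0 x)) \<le> K" "cmod (of_real (?k1 x)) \<le> K" "cmod (of_real (?k2 x)) \<le> K"
      "cmod (of_real (?k3 x)) \<le> K" "cmod (of_real (?l0 x)) \<le> K" "cmod (of_real (?l1 x)) \<le> K"
      unfolding norm_of_real by (rule order_trans[OF K(1) K_le(1)] order_trans[OF K(2) K_le(2)]
        order_trans[OF K(3) K_le(3)] order_trans[OF K(4) K_le(4)] order_trans[OF K(5) K_le(5)]
        order_trans[OF K(6) K_le(6)])+
  qed (use \<sigma> in auto)
qed

context energy_profile
begin

text \<open>\<open>c0\<close>, \<open>c1\<close>, \<open>c2\<close>, \<open>d\<close> are the
  collected coefficients of \<open>r\<close>, \<open>r'\<close>, \<open>r''\<close>,
  \<open>q\<close> in the linearized flux. The two terms with \<open>E2\<close> in the linearized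
  Legendre part cancel.\<close>

lemma EKE_third_order:
  obtains k0 k1 k2 k3 l0 l1 K where "third_order_operator (EKE_lin E j u) (-1) k0 k1 k2 k3 l0 l1 K"
proof -
  define c0 where "c0 = (\<lambda>x. euler E u x - j\<^sup>2 / (u x)\<^sup>2 + u x * (E11 x - deriv E12 x) + deriv u x * E12 x - E1 x)"
  define c1 where "c1 = (\<lambda>x. u x * (E21 x - E12 x - deriv E22 x) + deriv u x * E22 x)"
  define c2 where "c2 = (\<lambda>x. - (u x * E22 x))"
  define d where "d = (\<lambda>x. 2 * j / u x)"
  have "bounded_smooth (\<lambda>x. j\<^sup>2 / (u x)\<^sup>2)"
    by (rule bounded_smooth_divide[OF bounded_smooth_const bounded_smooth_power[OF u], of "\<delta>\<^sup>2"])
      (use \<delta> in \<open>auto intro: power_mono\<close>)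
  then have coeffs: "bounded_smooth c0" "bounded_smooth c1" "bounded_smooth c2" "bounded_smooth d"
    unfolding c0_def c1_def c2_def d_def euler_eq
    by (intro bounded_smooth_add bounded_smooth_diff bounded_smooth_mult bounded_smooth_uminus
        bounded_smooth_divide[OF bounded_smooth_const u \<delta>] bounded_smooth_deriv
        along_partials_bounded_smooth u; assumption)+
  have "AE x in lborel. lin_EKE_flux wderiv E j u r q x =
      of_real (c0 x) * r x + of_real (c1 x) * r1 x + of_real (c2 x) * r2 x + of_real (d x) * q x"
    if "has_weak_deriv r r1" "has_weak_deriv r1 r2" "r \<in> borel_measurable borel" for r r1 r2 q
    using lin_euler_AE[OF that] wderiv_AE[OF that(1)]
    unfolding lin_EKE_flux_def lin_legendre_def
  proof eventually_elim
    case (elim x)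
    show ?case unfolding elim by (simp add: c0_def c1_def c2_def d_def algebra_simps)
  qed
  note fl = this
  obtain k0 k1 k2 k3 l0 l1 K where
    "third_order_operator (\<lambda>(r, q). (\<lambda>x. of_real (-1) * wderiv q x,
       \<lambda>x. of_real (-1) * wderiv (lin_EKE_flux wderiv E j u r q) x)) (of_real (-1)) k0 k1 k2 k3 l0 l1 K"
    by (rule flux_third_order_operator[OF coeffs _ fl, of "-1"]) (simp, assumption, assumption, assumption, rule that)
  then show thesis using that unfolding EKE_lin_def by simp
qed

lemma EKL_third_order:
  obtains k0 k1 k2 k3 l0 l1 K where "third_order_operator (EKL_lin E j u) 1 k0 k1 k2 k3 l0 l1 K"
proof -
  define c0 where "c0 = (\<lambda>x. E11 x - deriv E12 x - j\<^sup>2)"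
  define c1 where "c1 = (\<lambda>x. E21 x - E12 x - deriv E22 x)"
  define c2 where "c2 = (\<lambda>x. - E22 x)"
  define d where "d = (\<lambda>x::real. - (2 * j))"
  have coeffs: "bounded_smooth c0" "bounded_smooth c1" "bounded_smooth c2" "bounded_smooth d"
    unfolding c0_def c1_def c2_def d_def
    by (intro bounded_smooth_diff bounded_smooth_uminus bounded_smooth_deriv bounded_smooth_const along_partials_bounded_smooth)+
  have "AE x in lborel. lin_EKL_flux wderiv E j u r q x =
      of_real (c0 x) * r x + of_real (c1 x) * r1 x + of_real (c2 x) * r2 x + of_real (d x) * q x"
    if "has_weak_deriv r r1" "has_weak_deriv r1 r2" "r \<in> borel_measurable borel" for r r1 r2 q
    using lin_euler_AE[OF that]
    unfolding lin_EKL_flux_def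
    by eventually_elim (simp add: c0_def c1_def c2_def d_def algebra_simps)
  note fl = this
  obtain k0 k1 k2 k3 l0 l1 K where
    "third_order_operator (\<lambda>(r, q). (\<lambda>x. of_real 1 * wderiv q x,
       \<lambda>x. of_real 1 * wderiv (lin_EKL_flux wderiv E j u r q) x)) (of_real 1) k0 k1 k2 k3 l0 l1 K"
    by (rule flux_third_order_operator[OF coeffs _ fl, of "1"]) (simp, assumption, assumption, assumption, rule that)
  then show thesis using that unfolding EKL_lin_def by simp
qed

end

section \<open>The Eulerian and the Lagrangian energy\<close>

text \<open>In the next two identities \<open>R, R1, R2\<close> stand for \<open>\<rho>, \<rho>', \<rho>''\<close>, \<open>Z0, Z1, Z2\<close> for \<open>z, z', z''\<close> at
  \<open>Y x\<close>, and \<open>n\<close> for \<open>- 1 / \<nu>\<close>; the factors of \<open>e12\<close> and \<open>e22\<close> in \<open>G\<close> are \<open>v'\<close> and \<open>v''\<close> at \<open>Y x\<close>.\<close>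

lemma stress_identity:
  fixes R R1 R2 e2 e12 e22 Z0 Z1 Z2 n G :: complex
  assumes "R \<noteq> 0" "G = e12 * (- R1 / R ^ 3) + e22 * (- R2 / R ^ 4 + 3 * R1\<^sup>2 / R ^ 5)"
  shows "(2 * e2 / R ^ 3 + e12 / R ^ 4 - 3 * R1 * e22 / R ^ 6) * (n * (R1 * Z0 + R\<^sup>2 * Z1))
      + e22 / R ^ 5 * (n * (R2 * Z0 + 3 * R * R1 * Z1 + R ^ 3 * Z2)) =
    2 * e2 / R ^ 3 * (n * (R1 * Z0 + R\<^sup>2 * Z1)) - 1 / R\<^sup>2 * (- n * (e12 * Z1 + e22 * Z2)) - G / R\<^sup>2 * (n * (R * Z0))"
  unfolding assms(2) using assms(1) by (simp add: field_simps power2_eq_square eval_nat_numeral)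

lemma flux_identity:
  fixes R R1 R2 e2 e11 e12 e22 Z0 Z1 Z2 n G j Q Q1 :: complex
  assumes R: "R \<noteq> 0" and G: "G = e12 * (- R1 / R ^ 3) + e22 * (- R2 / R ^ 4 + 3 * R1\<^sup>2 / R ^ 5)"
    and Q: "Q = - n * (e12 * Z1 + e22 * Z2)"
    and r: "r = n * (R1 * Z0 + R\<^sup>2 * Z1)" and r1: "r1 = n * (R2 * Z0 + 3 * R * R1 * Z1 + R ^ 3 * Z2)"
    and N: "N = n * (R * Z0)"
    and P: "P = 2 * e2 / R ^ 3 * r - 1 / R\<^sup>2 * Q - G / R\<^sup>2 * N"
    and P1: "P1 = (- 6 * R1 * e2 / R ^ 4 + 2 * G / R\<^sup>2) * r + 2 * e2 / R ^ 3 * r1 - (- 2 * R1 / R ^ 3 * Q + 1 / R\<^sup>2 * (R * Q1))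
      - ((- 2 * R1 * G / R ^ 3 + (e11 * (- R1 / R ^ 3) + e12 * (- R2 / R ^ 4 + 3 * R1\<^sup>2 / R ^ 5) - j\<^sup>2 * (- R1 / R ^ 3)) / R) * N + G / R\<^sup>2 * r)"
  shows "- (j\<^sup>2 / R\<^sup>2) * r - (2 * R1 * e2 / R ^ 3 - G / R) * r
     + R * ((- 6 * R1 * e2 / R ^ 4 + e11 / R ^ 3 - 6 * R1 * e12 / R ^ 5 + 9 * R1\<^sup>2 * e22 / R ^ 7) * r
     + (2 * e2 / R ^ 3 + e12 / R ^ 4 - 3 * R1 * e22 / R ^ 6) * r1 - P1) + R1 * P =
    - (e11 * (- n * Z1) + e12 * (- n * Z2) - Q1 - j\<^sup>2 * (- n * Z1))"
  unfolding P P1 Q r r1 N G using R by (simp add: field_simps power2_eq_square eval_nat_numeral)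

section \<open>Partial derivatives of the Eulerian energy in terms of the Lagrangian one\<close>

lemma pd1_eqI:
  assumes "\<And>t. t > 0 \<Longrightarrow> F t s = g t" "(g has_real_derivative D) (at r)" "r > 0"
  shows "pd1 F r s = D"
proof -
  \<comment> \<open>The relation between the energies is available for positive density only, so it
    is used on a neighbourhood of \<open>r\<close>.\<close>
  have "\<forall>\<^sub>F t in nhds r. F t s = g t"
    using eventually_nhds_in_open[of "{0<..}" r] assms(1,3) by (auto elim: eventually_mono)
  then have "((\<lambda>t. F t s) has_real_derivative D) (at r)"
    using assms(2) by (subst DERIV_cong_ev[OF refl _ refl])
  then show ?thesis unfolding pd1_def by (rule DERIV_imp_deriv)
qed

lemma pd2_eqI:
  assumes "\<And>t. F r t = g t" "(g has_real_derivative D) (at s)"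
  shows "pd2 F r s = D"
proof -
  have "F r = g" using assms(1) by (rule ext)
  then show ?thesis unfolding pd2_def using DERIV_imp_deriv[OF assms(2)] by simp
qed

lemma mass_coordinate_derivs:
  assumes f: "smooth2_on ({0<..} \<times> UNIV) f" and r: "r > 0"
  shows "((\<lambda>t. f (1 / t) (- s / t ^ 3)) has_real_derivative
      - pd1 f (1 / r) (- s / r ^ 3) / r\<^sup>2 + 3 * s * pd2 f (1 / r) (- s / r ^ 3) / r ^ 4) (at r)"
    and "((\<lambda>t. f (1 / r) (- t / r ^ 3)) has_real_derivative - pd2 f (1 / r) (- s / r ^ 3) / r ^ 3) (at s)"
proof -
  have "((\<lambda>t. 1 / t) has_real_derivative - 1 / r\<^sup>2) (at r)"
    using r by (auto intro!: derivative_eq_intros simp: power2_eq_square)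
  moreover have "((\<lambda>t. - s / t ^ 3) has_real_derivative 3 * s / r ^ 4) (at r)"
    using r by (auto intro!: derivative_eq_intros simp: field_simps eval_nat_numeral)
  ultimately show "((\<lambda>t. f (1 / t) (- s / t ^ 3)) has_real_derivative
      - pd1 f (1 / r) (- s / r ^ 3) / r\<^sup>2 + 3 * s * pd2 f (1 / r) (- s / r ^ 3) / r ^ 4) (at r)"
    using smooth2_chain[OF f, of "\<lambda>t. 1 / t" r "- 1 / r\<^sup>2" "\<lambda>t. - s / t ^ 3" "3 * s / r ^ 4"] r
    by (simp add: mult.commute)
  have "((\<lambda>t. - t / r ^ 3) has_real_derivative - 1 / r ^ 3) (at s)"
    by (rule DERIV_cong[OF DERIV_cdivide[OF DERIV_minus[OF DERIV_ident]]]) simp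
  then show "((\<lambda>t. f (1 / r) (- t / r ^ 3)) has_real_derivative - pd2 f (1 / r) (- s / r ^ 3) / r ^ 3) (at s)"
    using smooth2_chain[OF f, of "\<lambda>t. 1 / r" s 0 "\<lambda>t. - t / r ^ 3" "- 1 / r ^ 3"] r by simp
qed

context
  fixes E e :: "real \<Rightarrow> real \<Rightarrow> real"
  assumes e: "smooth2_on ({0<..} \<times> UNIV) e"
    and E_eq: "\<And>r s. r > 0 \<Longrightarrow> E r s = r * e (1 / r) (- s / r ^ 3)"
begin

lemma pd2_E: "r > 0 \<Longrightarrow> pd2 E r s = - pd2 e (1 / r) (- s / r ^ 3) / r\<^sup>2"
  by (rule pd2_eqI, rule E_eq, assumption, rule DERIV_cong[OF DERIV_cmult[OF mass_coordinate_derivs(2)[OF e]]])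
    (simp_all add: eval_nat_numeral)

lemma pd1_E: "r > 0 \<Longrightarrow> pd1 E r s = e (1 / r) (- s / r ^ 3) - pd1 e (1 / r) (- s / r ^ 3) / r
    + 3 * s * pd2 e (1 / r) (- s / r ^ 3) / r ^ 3"
  by (rule pd1_eqI, erule E_eq, rule DERIV_cong[OF DERIV_mult[OF DERIV_ident mass_coordinate_derivs(1)[OF e]]])
    (simp_all add: field_simps eval_nat_numeral)

lemma pd22_E: "r > 0 \<Longrightarrow> pd2 (pd2 E) r s = pd2 (pd2 e) (1 / r) (- s / r ^ 3) / r ^ 5"
  by (rule pd2_eqI, rule pd2_E, assumption,
      rule DERIV_cong[OF DERIV_cdivide[OF DERIV_minus[OF mass_coordinate_derivs(2)[OF smooth2_onD(5)[OF e]]]]])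
    (simp_all add: field_simps eval_nat_numeral)

lemma pd12_E: "r > 0 \<Longrightarrow> pd1 (pd2 E) r s = 2 * pd2 e (1 / r) (- s / r ^ 3) / r ^ 3
    + pd1 (pd2 e) (1 / r) (- s / r ^ 3) / r ^ 4 - 3 * s * pd2 (pd2 e) (1 / r) (- s / r ^ 3) / r ^ 6"
  by (rule pd1_eqI, erule pd2_E,
      rule DERIV_cong[OF DERIV_divide[OF DERIV_minus[OF mass_coordinate_derivs(1)[OF smooth2_onD(5)[OF e]]] DERIV_pow]])
    (simp_all add: field_simps eval_nat_numeral)

lemma pd11_E: "r > 0 \<Longrightarrow> pd1 (pd1 E) r s = - 6 * s * pd2 e (1 / r) (- s / r ^ 3) / r ^ 4
    + pd1 (pd1 e) (1 / r) (- s / r ^ 3) / r ^ 3 - 6 * s * pd1 (pd2 e) (1 / r) (- s / r ^ 3) / r ^ 5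
    + 9 * s\<^sup>2 * pd2 (pd2 e) (1 / r) (- s / r ^ 3) / r ^ 7"
  by (rule pd1_eqI, erule pd1_E,
      rule DERIV_cong[OF DERIV_add[OF DERIV_diff[OF mass_coordinate_derivs(1)[OF e]
        DERIV_divide[OF mass_coordinate_derivs(1)[OF smooth2_onD(4)[OF e]] DERIV_ident]]
        DERIV_divide[OF DERIV_cmult[OF mass_coordinate_derivs(1)[OF smooth2_onD(5)[OF e]]] DERIV_pow]]])
    (simp_all add: pd_commute[OF e] field_simps eval_nat_numeral)

end

section \<open>Transfer of the reduced problem\<close>

context line_diffeo
begin

text \<open>\<open>Y\<close> maps onto the line and is thus unbounded, but the chain rule involves
  only its derivative \<open>\<rho>\<close>.\<close>

lemma bounded_diff_comp:
  assumes "bounded_smooth \<rho>"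
  shows "bounded_diff k c \<Longrightarrow> bounded_diff k (\<lambda>x. c (Y x))"
proof (induction k arbitrary: c)
  case 0
  have "bounded (range (\<lambda>x. c (Y x)))" by (rule bounded_subset[of "range c"]) (use 0 in auto)
  then show ?case using 0 Y_continuous by (auto intro: continuous_on_compose2[of UNIV c])
next
  case (Suc k)
  then obtain c' where c': "\<forall>x. (c has_real_derivative c' x) (at x)" "bounded_diff k c'" by auto
  have "bounded_diff k (\<lambda>x. c' (Y x) * \<rho> x)"
    using assms by (intro bounded_diff_mult Suc.IH c') (simp add: bounded_smooth_def)
  moreover have "((\<lambda>x. c (Y x)) has_real_derivative c' (Y x) * \<rho> x) (at x)" for x
    using c' Y_deriv by (intro DERIV_chain2) auto
  moreover have "bounded (range (\<lambda>x. c (Y x)))"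
    by (rule bounded_subset[of "range c"]) (use Suc.prems in auto)
  ultimately show ?case unfolding bounded_diff.simps by (intro conjI exI allI)
qed

lemma bounded_smooth_comp:
  "bounded_smooth \<rho> \<Longrightarrow> bounded_smooth c \<Longrightarrow> bounded_smooth (\<lambda>x. c (Y x))"
  using bounded_diff_comp unfolding bounded_smooth_def by blast

text \<open>The substitution rule needs a weight \<open>\<rho>\<close>, which is introduced at the
  cost of \<open>1 / m\<close> because \<open>1 \<le> \<rho> / m\<close>.\<close>

lemma L2_comp:
  assumes f: "f \<in> L2" and m: "m > 0" "\<And>x. m \<le> \<rho> x"
  shows "(\<lambda>x. f (Y x)) \<in> L2" "sqnorm (\<lambda>x. f (Y x)) \<le> 1 / m * sqnorm f"
proof -
  have [measurable]: "f \<in> borel_measurable borel" using f by (rule L2_measurable)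
  have i: "integrable lborel (\<lambda>x. \<rho> x *\<^sub>R (cmod (f (Y x)))\<^sup>2)"
    using f integrable_comp[of "\<lambda>y. (cmod (f y))\<^sup>2"] by (simp add: L2_iff)
  have eq: "(LINT x|lborel. \<rho> x *\<^sub>R (cmod (f (Y x)))\<^sup>2) = sqnorm f"
    unfolding sqnorm_def using integral_comp[of "\<lambda>y. (cmod (f y))\<^sup>2"] by simp
  have i2: "integrable lborel (\<lambda>x. 1 / m * (\<rho> x *\<^sub>R (cmod (f (Y x)))\<^sup>2))" using i by simp
  have le: "(cmod (f (Y x)))\<^sup>2 \<le> 1 / m * (\<rho> x *\<^sub>R (cmod (f (Y x)))\<^sup>2)" for x
    using m(1) mult_right_mono[OF m(2)[of x], of "(cmod (f (Y x)))\<^sup>2"] by (simp add: field_simps)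
  have i3: "integrable lborel (\<lambda>x. (cmod (f (Y x)))\<^sup>2)"
    by (rule Bochner_Integration.integrable_bound[OF i2]) (auto intro!: AE_I2 order_trans[OF le] divide_right_mono mult_right_mono simp: abs_mult m less_imp_le)
  then show "(\<lambda>x. f (Y x)) \<in> L2" by (simp add: L2_iff)
  show "sqnorm (\<lambda>x. f (Y x)) \<le> 1 / m * sqnorm f"
    using integral_mono[OF i3 i2 le] unfolding integral_mult_right_zero eq sqnorm_def[of "\<lambda>x. f (Y x)"] .
qed

lemma sobolev_comp:
  assumes \<rho>: "bounded_smooth \<rho>" and m: "m > 0" "\<And>x. m \<le> \<rho> x"
  shows "f \<in> sobolev k \<Longrightarrow> (\<lambda>x. f (Y x)) \<in> sobolev k"
proof (induction k arbitrary: f)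
  case 0
  then show ?case using L2_comp(1)[OF _ m] by simp
next
  case (Suc k)
  note f = sobolev_SucD[OF Suc.prems]
  show ?case
    by (rule sobolev_SucI[OF L2_comp(1)[OF f(1) m] has_weak_deriv_comp[OF f(2)]])
      (intro sobolev_bounded_smooth \<rho> Suc.IH f)
qed

definition pullback :: "(real \<Rightarrow> complex) \<Rightarrow> real \<Rightarrow> complex" where
  "pullback z = (\<lambda>x. of_real (\<rho> x) * z (Y x))"

lemma pullback_sobolev:
  assumes \<rho>: "bounded_smooth \<rho>" and m: "m > 0" "\<And>x. m \<le> \<rho> x" and z: "z \<in> sobolev k"
  shows "pullback z \<in> sobolev k"
  unfolding pullback_def by (intro sobolev_bounded_smooth sobolev_comp[OF \<rho> m] z \<rho>)

lemma pullback_AE_cong: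
  assumes "AE y in lborel. z y = z' y" shows "AE x in lborel. pullback z x = pullback z' x"
  using AE_comp[OF assms] by eventually_elim (simp add: pullback_def)

lemma pullback_weak_deriv:
  assumes \<rho>: "bounded_smooth \<rho>" and "has_weak_deriv z z1" and [measurable]: "z \<in> borel_measurable borel"
  shows "has_weak_deriv (pullback z) (\<lambda>x. of_real (deriv \<rho> x) * z (Y x) + of_real ((\<rho> x)\<^sup>2) * z1 (Y x))"
proof -
  have "has_weak_deriv (pullback z) (\<lambda>x. of_real (deriv \<rho> x) * z (Y x) + of_real (\<rho> x) * (of_real (\<rho> x) * z1 (Y x)))"
    unfolding pullback_def by (intro has_weak_deriv_bounded_smooth \<rho> has_weak_deriv_comp assms) measurable
  then show ?thesis by (simp add: power2_eq_square mult.assoc)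
qed

text \<open>The norms in \<open>reduced_solvable\<close> involve one derivative, so bounds for
  \<open>\<rho>\<close>, \<open>\<rho>'\<close> and \<open>\<rho>\<^sup>2\<close> suffice besides
  the lower bound \<open>m\<close>.\<close>

lemma pullback_bounds:
  assumes \<rho>: "bounded_smooth \<rho>" and m: "m > 0" "\<And>x. m \<le> \<rho> x"
  obtains C where "C \<ge> 0" "\<And>z. z \<in> L2 \<Longrightarrow> sqnorm (pullback z) \<le> C * sqnorm z"
    "\<And>z. z \<in> sobolev 4 \<Longrightarrow> sqnorm (pullback z) + sqnorm (wderiv (pullback z)) \<le> C * (sqnorm z + sqnorm (wderiv z))"
proof -
  obtain C0 where C0: "\<And>x. \<bar>\<rho> x\<bar> \<le> C0" using bounded_smooth_bounded[OF \<rho>] by blast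
  obtain C1 where C1: "\<And>x. \<bar>deriv \<rho> x\<bar> \<le> C1" using bounded_smooth_bounded[OF bounded_smooth_deriv(2)[OF \<rho>]] by blast
  obtain C2 where C2: "\<And>x. \<bar>(\<rho> x)\<^sup>2\<bar> \<le> C2" using bounded_smooth_bounded[OF bounded_smooth_power[OF \<rho>]] by blast
  have mult: "(\<lambda>x. of_real (c x) * z (Y x)) \<in> L2 \<and> sqnorm (\<lambda>x. of_real (c x) * z (Y x)) \<le> K\<^sup>2 / m * sqnorm z"
    if "z \<in> L2" "bounded_smooth c" "\<And>x. \<bar>c x\<bar> \<le> K" for z c K
  proof -
    have c: "(\<lambda>x. complex_of_real (c x)) \<in> borel_measurable borel"
      using bounded_smooth_measurable[OF that(2)] by measurable
    have "sqnorm (\<lambda>x. of_real (c x) * z (Y x)) \<le> K\<^sup>2 * sqnorm (\<lambda>x. z (Y x))"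
      using that(3) by (intro L2_mult(2) L2_comp(1)[OF that(1) m] c) simp
    also have "\<dots> \<le> K\<^sup>2 * (1 / m * sqnorm z)" by (intro mult_left_mono L2_comp(2)[OF that(1) m]) simp
    finally show ?thesis using that(3) L2_mult(1)[OF L2_comp(1)[OF that(1) m] c, of K] by simp
  qed
  let ?C = "C0\<^sup>2 / m + (2 * (C1\<^sup>2 / m) + 2 * (C2\<^sup>2 / m))"
  have nn: "0 \<le> C0\<^sup>2 / m" "0 \<le> C1\<^sup>2 / m" "0 \<le> C2\<^sup>2 / m" using m by auto
  have b0: "sqnorm (pullback z) \<le> C0\<^sup>2 / m * sqnorm z" if "z \<in> L2" for z
    unfolding pullback_def using mult[OF that \<rho> C0] by simp
  show thesis
  proof (rule that[of ?C])
    show "0 \<le> ?C" using nn by simp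
    fix z
    show "sqnorm (pullback z) \<le> ?C * sqnorm z" if "z \<in> L2"
      by (rule order_trans[OF b0[OF that]], rule mult_right_mono) (use nn in auto)
    assume "z \<in> sobolev 4"
    then have "z \<in> sobolev (Suc 3)" by simp
    note z = sobolev_SucD[OF this]
    note z1 = sobolev_L2[OF z(3)]
    note p = mult[OF z(1) bounded_smooth_deriv(2)[OF \<rho>] C1] mult[OF z1 bounded_smooth_power[OF \<rho>] C2]
    note w = pullback_weak_deriv[OF \<rho> z(2) L2_measurable[OF z(1)]]
    have "sqnorm (wderiv (pullback z)) = sqnorm (\<lambda>x. of_real (deriv \<rho> x) * z (Y x) + of_real ((\<rho> x)\<^sup>2) * wderiv z (Y x))"
      by (rule sqnorm_cong[OF wderiv_AE[OF w] has_weak_deriv_measurable[OF has_weak_deriv_wderiv[OF w]] has_weak_deriv_measurable[OF w]])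
    also have "\<dots> \<le> 2 * (C1\<^sup>2 / m * sqnorm z) + 2 * (C2\<^sup>2 / m * sqnorm (wderiv z))"
      using L2_add(2)[OF p(1)[THEN conjunct1] p(2)[THEN conjunct1]] p by linarith
    finally have "sqnorm (pullback z) + sqnorm (wderiv (pullback z)) \<le>
      C0\<^sup>2 / m * sqnorm z + (2 * (C1\<^sup>2 / m * sqnorm z) + 2 * (C2\<^sup>2 / m * sqnorm (wderiv z)))"
      using b0[OF z(1)] by linarith
    also have "\<dots> \<le> ?C * (sqnorm z + sqnorm (wderiv z))"
    proof -
      have aux: "a * s + (2 * (b * s) + 2 * (c * t)) \<le> (a + (2 * b + 2 * c)) * (s + t)"
        if "0 \<le> a" "0 \<le> b" "0 \<le> c" "0 \<le> s" "0 \<le> t" for a b c s t :: real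
        using that by (simp add: algebra_simps)
      show ?thesis by (rule aux) (use nn in simp_all)
    qed
    finally show "sqnorm (pullback z) + sqnorm (wderiv (pullback z)) \<le> ?C * (sqnorm z + sqnorm (wderiv z))" .
  qed
qed

end

text \<open>By the intertwining \<open>S' T = T S\<close>, the equation \<open>S' q = f\<close> is
  solved by \<open>q = T z\<close> with \<open>S z = T' f\<close>. \<open>T\<close> is estimated on
  solutions together with their derivatives, \<open>T'\<close> on the data; for uniqueness, a
  competing solution \<open>p\<close> is carried back to \<open>T' p\<close>.\<close>

lemma reduced_solvable_transfer:
  assumes S: "reduced_solvable S" and "C \<ge> 0" "C' \<ge> 0"
    and T4: "\<And>z. z \<in> sobolev 4 \<Longrightarrow> T z \<in> sobolev 4"
    and T_bd: "\<And>z. z \<in> sobolev 4 \<Longrightarrow> sqnorm (T z) + sqnorm (wderiv (T z)) \<le> C * (sqnorm z + sqnorm (wderiv z))"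
    and T'4: "\<And>z. z \<in> sobolev 4 \<Longrightarrow> T' z \<in> sobolev 4"
    and T'_L2: "\<And>f. f \<in> L2 \<Longrightarrow> T' f \<in> L2"
    and T'_bd: "\<And>f. f \<in> L2 \<Longrightarrow> sqnorm (T' f) \<le> C' * sqnorm f"
    and T_cong: "\<And>f g. AE x in lborel. f x = g x \<Longrightarrow> AE x in lborel. T f x = T g x"
    and T'_cong: "\<And>f g. AE x in lborel. f x = g x \<Longrightarrow> AE x in lborel. T' f x = T' g x"
    and TT': "\<And>f. T (T' f) = f" and T'T: "\<And>f. T' (T f) = f"
    and ST: "\<And>z. z \<in> sobolev 4 \<Longrightarrow> AE x in lborel. S' (T z) x = T (S z) x"
  shows "reduced_solvable S'"
proof -
  obtain D where "D \<ge> 0" and D: "\<And>f. f \<in> L2 \<Longrightarrow> \<exists>q\<in>sobolev 4. (AE x in lborel. S q x = f x) \<and>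
     sqnorm q + sqnorm (wderiv q) \<le> D * sqnorm f \<and>
     (\<forall>p\<in>sobolev 4. (AE x in lborel. S p x = f x) \<longrightarrow> (AE x in lborel. p x = q x))"
    using S unfolding reduced_solvable_def by blast
  show ?thesis unfolding reduced_solvable_def
  proof (intro exI[of _ "C * (D * C')"] conjI ballI)
    show "0 \<le> C * (D * C')" using \<open>C \<ge> 0\<close> \<open>C' \<ge> 0\<close> \<open>D \<ge> 0\<close> by simp
    fix f assume f: "f \<in> L2"
    obtain z where z: "z \<in> sobolev 4" "AE x in lborel. S z x = T' f x"
      and le: "sqnorm z + sqnorm (wderiv z) \<le> D * sqnorm (T' f)"
      and un: "\<And>p. p \<in> sobolev 4 \<Longrightarrow> AE x in lborel. S p x = T' f x \<Longrightarrow> AE x in lborel. p x = z x"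
      using D[OF T'_L2[OF f]] by blast
    show "\<exists>q\<in>sobolev 4. (AE x in lborel. S' q x = f x) \<and>
       sqnorm q + sqnorm (wderiv q) \<le> C * (D * C') * sqnorm f \<and>
       (\<forall>p\<in>sobolev 4. (AE x in lborel. S' p x = f x) \<longrightarrow> (AE x in lborel. p x = q x))"
    proof (intro bexI[OF _ T4[OF z(1)]] conjI ballI impI)
      show "AE x in lborel. S' (T z) x = f x"
        using ST[OF z(1)] T_cong[OF z(2)] unfolding TT' by eventually_elim simp
      have "sqnorm (T z) + sqnorm (wderiv (T z)) \<le> C * (sqnorm z + sqnorm (wderiv z))" by (rule T_bd[OF z(1)])
      also have "\<dots> \<le> C * (D * sqnorm (T' f))" by (rule mult_left_mono[OF le \<open>C \<ge> 0\<close>])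
      also have "\<dots> \<le> C * (D * (C' * sqnorm f))"
        by (intro mult_left_mono T'_bd f \<open>C \<ge> 0\<close> \<open>D \<ge> 0\<close>)
      finally show "sqnorm (T z) + sqnorm (wderiv (T z)) \<le> C * (D * C') * sqnorm f" by (simp add: mult.assoc)
      fix p assume p: "p \<in> sobolev 4" "AE x in lborel. S' p x = f x"
      have "AE x in lborel. T (S (T' p)) x = f x"
        using ST[OF T'4[OF p(1)]] p(2) unfolding TT' by eventually_elim simp
      from T'_cong[OF this] have "AE x in lborel. S (T' p) x = T' f x" unfolding T'T .
      from T_cong[OF un[OF T'4[OF p(1)] this]] show "AE x in lborel. p x = T z x" unfolding TT' .
    qed
  qed
qed

text \<open>Applying \<open>T'\<close> to the intertwining relation turns it into
  \<open>S T' = T' S'\<close>, so the transfer works in both directions.\<close>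

lemma reduced_solvable_transfer_iff:
  assumes "C \<ge> 0" "C' \<ge> 0"
    and T4: "\<And>z. z \<in> sobolev 4 \<Longrightarrow> T z \<in> sobolev 4" and T'4: "\<And>z. z \<in> sobolev 4 \<Longrightarrow> T' z \<in> sobolev 4"
    and T_bd: "\<And>z. z \<in> sobolev 4 \<Longrightarrow> sqnorm (T z) + sqnorm (wderiv (T z)) \<le> C * (sqnorm z + sqnorm (wderiv z))"
    and T'_bd: "\<And>z. z \<in> sobolev 4 \<Longrightarrow> sqnorm (T' z) + sqnorm (wderiv (T' z)) \<le> C' * (sqnorm z + sqnorm (wderiv z))"
    and T_L2: "\<And>f. f \<in> L2 \<Longrightarrow> T f \<in> L2" and T'_L2: "\<And>f. f \<in> L2 \<Longrightarrow> T' f \<in> L2"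
    and T_bd0: "\<And>f. f \<in> L2 \<Longrightarrow> sqnorm (T f) \<le> C * sqnorm f"
    and T'_bd0: "\<And>f. f \<in> L2 \<Longrightarrow> sqnorm (T' f) \<le> C' * sqnorm f"
    and T_cong: "\<And>f g. AE x in lborel. f x = g x \<Longrightarrow> AE x in lborel. T f x = T g x"
    and T'_cong: "\<And>f g. AE x in lborel. f x = g x \<Longrightarrow> AE x in lborel. T' f x = T' g x"
    and TT': "\<And>f. T (T' f) = f" and T'T: "\<And>f. T' (T f) = f"
    and ST: "\<And>z. z \<in> sobolev 4 \<Longrightarrow> AE x in lborel. S' (T z) x = T (S z) x"
  shows "reduced_solvable S' \<longleftrightarrow> reduced_solvable S"
proof
  assume S': "reduced_solvable S'"
  have ST': "AE x in lborel. S (T' q) x = T' (S' q) x" if q: "q \<in> sobolev 4" for q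
    using T'_cong[OF ST[OF T'4[OF q]]] unfolding TT' T'T by eventually_elim simp
  show "reduced_solvable S"
    by (rule reduced_solvable_transfer[OF S' assms(2,1) T'4 T'_bd T4 T_L2 T_bd0 T'_cong T_cong T'T TT' ST'])
next
  assume S: "reduced_solvable S"
  show "reduced_solvable S'"
    by (rule reduced_solvable_transfer[OF S assms(1,2) T4 T_bd T'4 T'_L2 T'_bd0 T_cong T'_cong TT' T'T ST])
qed

section \<open>Equality of the spectra\<close>

text \<open>\<open>\<mu>\<close> is the constant value of the Lagrangian flux at the stationary
  solution.\<close>

locale matched_profiles =
  line_diffeo Y X \<rho> v + Eul: energy_profile E \<rho> \<delta> + Lag: energy_profile e v \<delta>'
  for Y X \<rho> v E \<delta> e \<delta>' +
  fixes j \<mu> :: real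
  assumes E_eq: "\<And>r s. r > 0 \<Longrightarrow> E r s = r * e (1 / r) (- s / r ^ 3)"
    and v_Y: "\<And>x. v (Y x) = 1 / \<rho> x"
    and stationary: "\<And>y. euler e v y - j\<^sup>2 * v y = \<mu>"
begin

text \<open>Both sides of \<open>v \<circ> Y = 1 / \<rho>\<close> are differentiated and compared.
  The value is exactly the second argument of \<open>e\<close> in the relation between the energies,
  so the partial derivatives of \<open>e\<close> there are those along the Lagrangian
  profile.\<close>

lemma deriv_v_Y: "deriv v (Y x) = - deriv \<rho> x / (\<rho> x) ^ 3"
proof -
  have "((\<lambda>x. v (Y x)) has_real_derivative deriv v (Y x) * \<rho> x) (at x)"
    by (rule DERIV_chain2[OF bounded_smooth_deriv(1)[OF Lag.u] Y_deriv])
  moreover have "((\<lambda>x. v (Y x)) has_real_derivative - deriv \<rho> x / (\<rho> x)\<^sup>2) (at x)"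
    unfolding v_Y using \<rho>_pos[of x]
    by (auto intro!: derivative_eq_intros bounded_smooth_deriv(1)[OF Eul.u] simp: power2_eq_square)
  ultimately have "deriv v (Y x) * \<rho> x = - deriv \<rho> x / (\<rho> x)\<^sup>2" by (rule DERIV_unique)
  then show ?thesis using \<rho>_pos[of x] by (simp add: field_simps eval_nat_numeral)
qed

lemma deriv2_v_Y:
  "deriv (deriv v) (Y x) = - deriv (deriv \<rho>) x / (\<rho> x) ^ 4 + 3 * (deriv \<rho> x)\<^sup>2 / (\<rho> x) ^ 5"
proof -
  have "((\<lambda>x. deriv v (Y x)) has_real_derivative deriv (deriv v) (Y x) * \<rho> x) (at x)"
    by (rule DERIV_chain2[OF bounded_smooth_deriv(1)[OF bounded_smooth_deriv(2)[OF Lag.u]] Y_deriv])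
  moreover have "((\<lambda>x. deriv v (Y x)) has_real_derivative
      (- deriv (deriv \<rho>) x * \<rho> x ^ 3 - - deriv \<rho> x * (3 * (deriv \<rho> x * (\<rho> x)\<^sup>2))) / (\<rho> x ^ 3 * \<rho> x ^ 3)) (at x)"
    unfolding deriv_v_Y using \<rho>_pos[of x]
    by (intro DERIV_divide DERIV_minus bounded_smooth_deriv(1)[OF bounded_smooth_deriv(2)[OF Eul.u]]
        DERIV_cong[OF DERIV_power[OF bounded_smooth_deriv(1)[OF Eul.u]]]) auto
  ultimately have "deriv (deriv v) (Y x) * \<rho> x =
      (- deriv (deriv \<rho>) x * \<rho> x ^ 3 - - deriv \<rho> x * (3 * (deriv \<rho> x * (\<rho> x)\<^sup>2))) / (\<rho> x ^ 3 * \<rho> x ^ 3)"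
    by (rule DERIV_unique)
  then have eq: "deriv (deriv v) (Y x) =
      (- deriv (deriv \<rho>) x * \<rho> x ^ 3 - - deriv \<rho> x * (3 * (deriv \<rho> x * (\<rho> x)\<^sup>2))) / (\<rho> x ^ 3 * \<rho> x ^ 3) / \<rho> x"
    using \<rho>_pos[of x] by (metis less_irrefl nonzero_mult_div_cancel_right)
  show ?thesis unfolding eq using \<rho>_pos[of x] by (simp add: field_simps eval_nat_numeral)
qed

lemma Eul_partials:
  "Eul.E2 x = - Lag.E2 (Y x) / (\<rho> x)\<^sup>2"
  "Eul.E22 x = Lag.E22 (Y x) / \<rho> x ^ 5"
  "Eul.E12 x = 2 * Lag.E2 (Y x) / \<rho> x ^ 3 + Lag.E12 (Y x) / \<rho> x ^ 4 - 3 * deriv \<rho> x * Lag.E22 (Y x) / \<rho> x ^ 6"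
  "Eul.E11 x = - 6 * deriv \<rho> x * Lag.E2 (Y x) / \<rho> x ^ 4 + Lag.E11 (Y x) / \<rho> x ^ 3
     - 6 * deriv \<rho> x * Lag.E12 (Y x) / \<rho> x ^ 5 + 9 * (deriv \<rho> x)\<^sup>2 * Lag.E22 (Y x) / \<rho> x ^ 7"
  unfolding v_Y deriv_v_Y using \<rho>_pos[of x]
  by (simp_all only: pd2_E[OF Lag.E E_eq] pd22_E[OF Lag.E E_eq] pd12_E[OF Lag.E E_eq] pd11_E[OF Lag.E E_eq])

lemma E21: "Eul.E21 x = Eul.E12 x" "Lag.E21 y = Lag.E12 y"
  using pd_commute[OF Eul.E Eul.u_pos] pd_commute[OF Lag.E Lag.u_pos] by auto

text \<open>By stationarity \<open>G\<close> is the derivative of \<open>e\<^sub>2\<close> along the profile; this form shows that its own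
  derivative involves no third derivative of \<open>e\<close>.\<close>

definition G :: "real \<Rightarrow> real" where
  "G y = Lag.E1 y - j\<^sup>2 * v y - \<mu>"

lemma G_eq: "G y = Lag.E12 y * deriv v y + Lag.E22 y * deriv (deriv v) y"
proof -
  have "deriv Lag.E2 y = Lag.E12 y * deriv v y + Lag.E22 y * deriv (deriv v) y"
    by (rule DERIV_imp_deriv, rule Lag.along_deriv, rule smooth2_onD(5)[OF Lag.E])
  then show ?thesis using stationary[of y] unfolding Lag.euler_eq G_def by simp
qed

lemma Lag_E2_deriv: "(Lag.E2 has_real_derivative G y) (at y)"
  unfolding G_eq by (rule Lag.along_deriv[OF smooth2_onD(5)[OF Lag.E]])

lemma G_deriv: "(G has_real_derivative
    Lag.E11 y * deriv v y + Lag.E12 y * deriv (deriv v) y - j\<^sup>2 * deriv v y) (at y)"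
proof -
  have "((\<lambda>y. Lag.E1 y - j\<^sup>2 * v y - \<mu>) has_real_derivative
    (Lag.E11 y * deriv v y + Lag.E21 y * deriv (deriv v) y) - j\<^sup>2 * deriv v y - 0) (at y)"
    by (intro DERIV_diff DERIV_cmult DERIV_const Lag.along_deriv[OF smooth2_onD(4)[OF Lag.E]]
        bounded_smooth_deriv(1)[OF Lag.u])
  then show ?thesis unfolding E21 G_def[abs_def] by simp
qed

lemma G_bounded_smooth: "bounded_smooth G"
  unfolding G_def[abs_def]
  by (intro bounded_smooth_diff bounded_smooth_mult bounded_smooth_const Lag.along_partials_bounded_smooth Lag.u)

lemma \<rho>_power_bounded_smooth: "bounded_smooth (\<lambda>x. 1 / \<rho> x ^ n)"
  by (rule bounded_smooth_inverse[OF bounded_smooth_power[OF Eul.u], of "\<delta> ^ n"])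
    (use Eul.\<delta> in \<open>auto intro: power_mono\<close>)

lemma \<rho>_power_deriv: "((\<lambda>x. 1 / \<rho> x ^ n) has_real_derivative - (real n * deriv \<rho> x / \<rho> x ^ (n + 1))) (at x)"
proof (rule DERIV_cong)
  show "((\<lambda>x. 1 / \<rho> x ^ n) has_real_derivative
      (0 * \<rho> x ^ n - 1 * (real n * (deriv \<rho> x * \<rho> x ^ (n - Suc 0)))) / (\<rho> x ^ n * \<rho> x ^ n)) (at x)"
    using \<rho>_pos[of x] by (intro DERIV_divide DERIV_const DERIV_power bounded_smooth_deriv(1)[OF Eul.u]) auto
  show "(0 * \<rho> x ^ n - 1 * (real n * (deriv \<rho> x * \<rho> x ^ (n - Suc 0)))) / (\<rho> x ^ n * \<rho> x ^ n) =
      - (real n * deriv \<rho> x / \<rho> x ^ (n + 1))"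
    using \<rho>_pos[of x] by (cases n) (simp_all add: field_simps)
qed

text \<open>With the displacement \<open>N = - q / \<nu>\<close>, so that \<open>r = N'\<close>, the linearized stresses
  \<open>P = E\<^sub>1\<^sub>2 r + E\<^sub>2\<^sub>2 r'\<close> and \<open>Q = e\<^sub>1\<^sub>2 w + e\<^sub>2\<^sub>2 w'\<close> satisfy \<open>P = A\<^sub>1 r - A\<^sub>2 (Q \<circ> Y) - A\<^sub>3 N\<close>.\<close>

definition A1 :: "real \<Rightarrow> real" where "A1 x = 2 * Lag.E2 (Y x) * (1 / \<rho> x ^ 3)"
definition A2 :: "real \<Rightarrow> real" where "A2 x = 1 / \<rho> x ^ 2"
definition A3 :: "real \<Rightarrow> real" where "A3 x = G (Y x) * (1 / \<rho> x ^ 2)"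

lemma A_bounded_smooth: "bounded_smooth A1" "bounded_smooth A2" "bounded_smooth A3"
  unfolding A1_def[abs_def] A2_def[abs_def] A3_def[abs_def]
  by (intro bounded_smooth_mult bounded_smooth_const \<rho>_power_bounded_smooth
      bounded_smooth_comp[OF Eul.u, of Lag.E2] bounded_smooth_comp[OF Eul.u, of G] G_bounded_smooth
      Lag.along_partials_bounded_smooth)+

lemma A1_deriv: "deriv A1 x = - 6 * deriv \<rho> x * Lag.E2 (Y x) / \<rho> x ^ 4 + 2 * G (Y x) / (\<rho> x)\<^sup>2"
proof -
  have "(A1 has_real_derivative (2 * (G (Y x) * \<rho> x)) * (1 / \<rho> x ^ 3) +
      - (real 3 * deriv \<rho> x / \<rho> x ^ (3 + 1)) * (2 * Lag.E2 (Y x))) (at x)"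
    unfolding A1_def[abs_def]
    by (intro DERIV_mult DERIV_cmult \<rho>_power_deriv DERIV_chain2[OF Lag_E2_deriv Y_deriv])
  then have "deriv A1 x = (2 * (G (Y x) * \<rho> x)) * (1 / \<rho> x ^ 3) +
      - (real 3 * deriv \<rho> x / \<rho> x ^ (3 + 1)) * (2 * Lag.E2 (Y x))" by (rule DERIV_imp_deriv)
  then show ?thesis using \<rho>_pos[of x] by (simp add: field_simps eval_nat_numeral)
qed

lemma A2_deriv: "deriv A2 x = - 2 * deriv \<rho> x / \<rho> x ^ 3"
proof -
  have "(A2 has_real_derivative - (real 2 * deriv \<rho> x / \<rho> x ^ (2 + 1))) (at x)"
    unfolding A2_def[abs_def] by (rule \<rho>_power_deriv)
  then have "deriv A2 x = - (real 2 * deriv \<rho> x / \<rho> x ^ (2 + 1))" by (rule DERIV_imp_deriv)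
  then show ?thesis by simp
qed

lemma A3_deriv: "deriv A3 x = - 2 * deriv \<rho> x * G (Y x) / \<rho> x ^ 3
    + (Lag.E11 (Y x) * deriv v (Y x) + Lag.E12 (Y x) * deriv (deriv v) (Y x) - j\<^sup>2 * deriv v (Y x)) / \<rho> x"
proof -
  let ?G' = "Lag.E11 (Y x) * deriv v (Y x) + Lag.E12 (Y x) * deriv (deriv v) (Y x) - j\<^sup>2 * deriv v (Y x)"
  have "(A3 has_real_derivative (?G' * \<rho> x) * (1 / \<rho> x ^ 2) +
      - (real 2 * deriv \<rho> x / \<rho> x ^ (2 + 1)) * G (Y x)) (at x)"
    unfolding A3_def[abs_def]
    by (intro DERIV_mult \<rho>_power_deriv DERIV_chain2[OF G_deriv Y_deriv])
  then have "deriv A3 x = (?G' * \<rho> x) * (1 / \<rho> x ^ 2) +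
      - (real 2 * deriv \<rho> x / \<rho> x ^ (2 + 1)) * G (Y x)" by (rule DERIV_imp_deriv)
  \<comment> \<open>The expression \<open>?G'\<close> is replaced by the letter \<open>a\<close>, so
    that only powers of \<open>\<rho>\<close> have to be rearranged.\<close>
  moreover have "(a * R) * (1 / R ^ 2) + - (real 2 * b / R ^ (2 + 1)) * c = - 2 * b * c / R ^ 3 + a / R"
    if "R > 0" for a b c R :: real using that by (simp add: field_simps eval_nat_numeral)
  ultimately show ?thesis using \<rho>_pos[of x] by metis
qed

lemma deriv_Eul_E2: "deriv Eul.E2 x = 2 * deriv \<rho> x * Lag.E2 (Y x) / \<rho> x ^ 3 - G (Y x) / \<rho> x"
proof -
  have eq: "Eul.E2 = (\<lambda>x. - 1 * (Lag.E2 (Y x) * (1 / \<rho> x ^ 2)))"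
    by (rule ext) (simp add: Eul_partials(1) power2_eq_square)
  have "(Eul.E2 has_real_derivative - 1 * ((G (Y x) * \<rho> x) * (1 / \<rho> x ^ 2) +
      - (real 2 * deriv \<rho> x / \<rho> x ^ (2 + 1)) * Lag.E2 (Y x))) (at x)"
    unfolding eq by (intro DERIV_cmult DERIV_mult \<rho>_power_deriv DERIV_chain2[OF Lag_E2_deriv Y_deriv])
  then have "deriv Eul.E2 x = - 1 * ((G (Y x) * \<rho> x) * (1 / \<rho> x ^ 2) +
      - (real 2 * deriv \<rho> x / \<rho> x ^ (2 + 1)) * Lag.E2 (Y x))" by (rule DERIV_imp_deriv)
  then show ?thesis using \<rho>_pos[of x] by (simp add: field_simps eval_nat_numeral)
qed

text \<open>For \<open>n = - 1 / \<nu>\<close> the displacement is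
  \<open>N = n * pullback z\<close>, and \<open>r = N'\<close>. This is the linearization of the
  relation between the nonlinear fluxes, checked pointwise by \<open>flux_identity\<close>.
  Stationarity enters through \<open>G\<close> and its derivative, and no displacement term survives
  on the right.\<close>

lemma flux_pullback:
  assumes z: "has_weak_deriv z z1" "has_weak_deriv z1 z2" "has_weak_deriv z2 z3" "z \<in> borel_measurable borel"
    and r: "AE x in lborel. r x = n * wderiv (pullback z) x" and w: "AE y in lborel. w y = - n * wderiv z y"
    and [measurable]: "w \<in> borel_measurable borel"
  shows "AE x in lborel. lin_EKE_flux wderiv E j \<rho> r (pullback z) x = - lin_EKL_flux wderiv e j v w z (Y x)"
proof -
  have [measurable]: "z \<in> borel_measurable borel" "z1 \<in> borel_measurable borel" "z2 \<in> borel_measurable borel"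
    using z has_weak_deriv_measurable by auto
  have w_eq: "AE y in lborel. w y = - n * z1 y"
    using w wderiv_AE[OF z(1)] by eventually_elim simp
  have w1: "has_weak_deriv w (\<lambda>y. - n * z2 y)"
    unfolding has_weak_deriv_cong_left[OF w_eq] by (rule has_weak_deriv_cmult[OF z(2)])
  have w2: "has_weak_deriv (\<lambda>y. - n * z2 y) (\<lambda>y. - n * z3 y)"
    by (rule has_weak_deriv_cmult[OF z(3)])
  define Q where "Q = (\<lambda>y. of_real (Lag.E12 y) * w y + of_real (Lag.E22 y) * (- n * z2 y))"
  \<comment> \<open>\<open>Q1\<close> stays abstract: it occurs with the same factor on both sides
    of the flux identity, so the third derivative of \<open>z\<close> is never expanded.\<close>
  obtain Q1 where Q1: "has_weak_deriv Q Q1"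
    unfolding Q_def using Lag.stress_weak_deriv[OF w1 w2] by auto
  have [measurable]: "Q \<in> borel_measurable borel"
    unfolding Q_def using Lag.along_partials_bounded_smooth[THEN bounded_smooth_measurable] by measurable
  have L: "AE y in lborel. lin_euler wderiv e v w y =
      of_real (Lag.E11 y) * w y + of_real (Lag.E21 y) * (- n * z2 y) - Q1 y"
    by (rule Lag.lin_euler_AE'[OF w1 Q1]) (simp add: Q_def)
  let ?\<rho>1 = "deriv \<rho>" and ?\<rho>2 = "deriv (deriv \<rho>)"
  define q1 where "q1 = (\<lambda>x. of_real (?\<rho>1 x) * z (Y x) + of_real ((\<rho> x)\<^sup>2) * z1 (Y x))"
  define q2 where "q2 = (\<lambda>x. of_real (?\<rho>2 x) * z (Y x) + of_real (?\<rho>1 x) * (of_real (\<rho> x) * z1 (Y x)) +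
      (of_real (deriv (\<lambda>x. (\<rho> x)\<^sup>2) x) * z1 (Y x) + of_real ((\<rho> x)\<^sup>2) * (of_real (\<rho> x) * z2 (Y x))))"
  have q: "has_weak_deriv (pullback z) q1"
    unfolding q1_def by (rule pullback_weak_deriv[OF Eul.u z(1,4)])
  have q': "has_weak_deriv q1 q2" unfolding q1_def q2_def
    by (intro has_weak_deriv_add has_weak_deriv_bounded_smooth bounded_smooth_power Eul.u bounded_smooth_deriv
        has_weak_deriv_comp z) measurable
  have \<rho>2: "deriv (\<lambda>x. (\<rho> x)\<^sup>2) x = 2 * \<rho> x * ?\<rho>1 x" for x
    by (rule DERIV_imp_deriv) (auto intro!: derivative_eq_intros bounded_smooth_deriv(1)[OF Eul.u])
  have r_eq: "AE x in lborel. r x = n * q1 x" using r wderiv_AE[OF q] by eventually_elim simp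
  have r1: "has_weak_deriv r (\<lambda>x. n * q2 x)"
    unfolding has_weak_deriv_cong_left[OF r_eq] by (rule has_weak_deriv_cmult[OF q'])
  have [measurable]: "q1 \<in> borel_measurable borel" "pullback z \<in> borel_measurable borel"
    using has_weak_deriv_measurable[OF q] unfolding pullback_def by measurable
  \<comment> \<open>The linearization of \<open>E2 = - (e2 \<circ> Y) / \<rho>\<^sup>2\<close>:
    \<open>A1\<close> arises from varying \<open>\<rho>\<close>, \<open>A2\<close> from varying the
    Lagrangian profile, and \<open>A3\<close> from displacing \<open>Y\<close>, \<open>G\<close>
    being the derivative of \<open>e2\<close> along the profile.\<close>
  define P where "P = (\<lambda>x. of_real (A1 x) * (n * q1 x) + - 1 * (of_real (A2 x) * Q (Y x)) +
     - 1 * (of_real (A3 x) * (n * pullback z x)))"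
  define P1 where "P1 = (\<lambda>x. (of_real (deriv A1 x) * (n * q1 x) + of_real (A1 x) * (n * q2 x)) +
     - 1 * (of_real (deriv A2 x) * Q (Y x) + of_real (A2 x) * (of_real (\<rho> x) * Q1 (Y x))) +
     - 1 * (of_real (deriv A3 x) * (n * pullback z x) + of_real (A3 x) * (n * q1 x)))"
  have P: "has_weak_deriv P P1" unfolding P_def P1_def
    by (intro has_weak_deriv_add has_weak_deriv_cmult has_weak_deriv_bounded_smooth A_bounded_smooth
        has_weak_deriv_comp q q' Q1) measurable
  have Q_Y: "AE x in lborel. w (Y x) = - n * z1 (Y x)" by (rule AE_comp[OF w_eq])
  have G_Y: "complex_of_real (G (Y x)) = of_real (Lag.E12 (Y x)) * (- of_real (?\<rho>1 x) / of_real (\<rho> x) ^ 3)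
     + of_real (Lag.E22 (Y x)) * (- of_real (?\<rho>2 x) / of_real (\<rho> x) ^ 4 + 3 * (of_real (?\<rho>1 x))\<^sup>2 / of_real (\<rho> x) ^ 5)" for x
    unfolding G_eq deriv_v_Y deriv2_v_Y by simp
  have q1_eq: "q1 x = of_real (?\<rho>1 x) * z (Y x) + (of_real (\<rho> x))\<^sup>2 * z1 (Y x)" for x
    by (simp add: q1_def)
  have q2_eq: "q2 x = of_real (?\<rho>2 x) * z (Y x) + 3 * of_real (\<rho> x) * of_real (?\<rho>1 x) * z1 (Y x)
      + of_real (\<rho> x) ^ 3 * z2 (Y x)" for x
    unfolding q2_def \<rho>2 by (simp add: algebra_simps eval_nat_numeral)
  have nz: "complex_of_real (\<rho> x) \<noteq> 0" for x using \<rho>_pos[of x] by simp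
  have stress: "AE x in lborel. of_real (Eul.E12 x) * r x + of_real (Eul.E22 x) * (n * q2 x) = P x"
    using r_eq Q_Y
  proof eventually_elim
    case (elim x)
    have "P x = 2 * of_real (Lag.E2 (Y x)) / of_real (\<rho> x) ^ 3 * (n * (of_real (?\<rho>1 x) * z (Y x) + (of_real (\<rho> x))\<^sup>2 * z1 (Y x)))
       - 1 / (of_real (\<rho> x))\<^sup>2 * (- n * (of_real (Lag.E12 (Y x)) * z1 (Y x) + of_real (Lag.E22 (Y x)) * z2 (Y x)))
       - of_real (G (Y x)) / (of_real (\<rho> x))\<^sup>2 * (n * (of_real (\<rho> x) * z (Y x)))"
      by (simp add: P_def A1_def A2_def A3_def Q_def elim(2) q1_eq pullback_def algebra_simps)
    then show ?case
      unfolding elim(1) Eul_partials q1_eq q2_eq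
      using stress_identity[OF nz[of x] G_Y[of x], of "of_real (Lag.E2 (Y x))" n "z (Y x)" "z1 (Y x)" "z2 (Y x)"]
      by simp
  qed
  have Eu: "AE x in lborel. lin_euler wderiv E \<rho> r x =
      of_real (Eul.E11 x) * r x + of_real (Eul.E21 x) * (n * q2 x) - P1 x"
    by (rule Eul.lin_euler_AE'[OF r1 P stress])
  show ?thesis
    using Eu stress r_eq Q_Y AE_comp[OF L] wderiv_AE[OF r1]
  proof eventually_elim
    case (elim x)
    \<comment> \<open>The terms with \<open>Eul.E2\<close> cancel here. The remaining
      \<open>- Eul.E1 x * r x\<close> will cancel against \<open>Eul.E1\<close> in
      \<open>euler E \<rho>\<close>, so \<open>Eul.E1\<close> needs no translation into Lagrangian
      quantities.\<close>
    have leg: "lin_legendre wderiv E \<rho> r x = of_real (?\<rho>1 x) * P x - of_real (Eul.E1 x) * r x"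
      unfolding lin_legendre_def elim(2)[symmetric] elim(6) by (simp add: algebra_simps)
    let ?R = "complex_of_real (\<rho> x)" and ?R1 = "complex_of_real (?\<rho>1 x)" and ?R2 = "complex_of_real (?\<rho>2 x)"
    let ?e2 = "complex_of_real (Lag.E2 (Y x))" and ?e11 = "complex_of_real (Lag.E11 (Y x))"
    let ?e12 = "complex_of_real (Lag.E12 (Y x))" and ?e22 = "complex_of_real (Lag.E22 (Y x))"
    let ?G = "complex_of_real (G (Y x))" and ?J = "complex_of_real j"
    have Qx: "Q (Y x) = - n * (?e12 * z1 (Y x) + ?e22 * z2 (Y x))"
      by (simp add: Q_def elim(4) algebra_simps)
    have rx: "r x = n * (?R1 * z (Y x) + ?R\<^sup>2 * z1 (Y x))" by (simp add: elim(3) q1_eq)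
    have r1x: "n * q2 x = n * (?R2 * z (Y x) + 3 * ?R * ?R1 * z1 (Y x) + ?R ^ 3 * z2 (Y x))" by (simp add: q2_eq)
    have Nx: "n * pullback z x = n * (?R * z (Y x))" by (simp add: pullback_def)
    have Px: "P x = 2 * ?e2 / ?R ^ 3 * r x - 1 / ?R\<^sup>2 * Q (Y x) - ?G / ?R\<^sup>2 * (n * pullback z x)"
      by (simp add: P_def A1_def A2_def A3_def elim(3))
    have P1x: "P1 x = (- 6 * ?R1 * ?e2 / ?R ^ 4 + 2 * ?G / ?R\<^sup>2) * r x + 2 * ?e2 / ?R ^ 3 * (n * q2 x)
      - (- 2 * ?R1 / ?R ^ 3 * Q (Y x) + 1 / ?R\<^sup>2 * (?R * Q1 (Y x)))
      - ((- 2 * ?R1 * ?G / ?R ^ 3 + (?e11 * (- ?R1 / ?R ^ 3) + ?e12 * (- ?R2 / ?R ^ 4 + 3 * ?R1\<^sup>2 / ?R ^ 5)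
        - ?J\<^sup>2 * (- ?R1 / ?R ^ 3)) / ?R) * (n * pullback z x) + ?G / ?R\<^sup>2 * r x)"
      unfolding P1_def A1_deriv A2_deriv A3_deriv A1_def A2_def A3_def elim(3) deriv_v_Y deriv2_v_Y by simp
    note id = flux_identity[OF nz[of x] G_Y[of x] Qx rx r1x Nx Px P1x]
    have "lin_EKE_flux wderiv E j \<rho> r (pullback z) x =
       2 * ?J * z (Y x) + (- (?J\<^sup>2 / ?R\<^sup>2) * r x - (2 * ?R1 * ?e2 / ?R ^ 3 - ?G / ?R) * r x
     + ?R * ((- 6 * ?R1 * ?e2 / ?R ^ 4 + ?e11 / ?R ^ 3 - 6 * ?R1 * ?e12 / ?R ^ 5 + 9 * ?R1\<^sup>2 * ?e22 / ?R ^ 7) * r x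
     + (2 * ?e2 / ?R ^ 3 + ?e12 / ?R ^ 4 - 3 * ?R1 * ?e22 / ?R ^ 6) * (n * q2 x) - P1 x) + ?R1 * P x)"
    proof -
      have "of_real (2 * j / \<rho> x) * pullback z x = 2 * ?J * z (Y x)"
        using nz[of x] by (simp add: pullback_def)
      moreover have "complex_of_real (euler E \<rho> x) = of_real (Eul.E1 x) - (2 * ?R1 * ?e2 / ?R ^ 3 - ?G / ?R)"
        unfolding Eul.euler_eq deriv_Eul_E2 by simp
      moreover have "complex_of_real (Eul.E11 x) = - 6 * ?R1 * ?e2 / ?R ^ 4 + ?e11 / ?R ^ 3 - 6 * ?R1 * ?e12 / ?R ^ 5 + 9 * ?R1\<^sup>2 * ?e22 / ?R ^ 7"
        "complex_of_real (Eul.E21 x) = 2 * ?e2 / ?R ^ 3 + ?e12 / ?R ^ 4 - 3 * ?R1 * ?e22 / ?R ^ 6"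
        unfolding E21 Eul_partials by simp_all
      moreover have "complex_of_real (j\<^sup>2 / (\<rho> x)\<^sup>2) = ?J\<^sup>2 / ?R\<^sup>2" by simp
      ultimately show ?thesis
        unfolding lin_EKE_flux_def leg elim(1) by (simp only:) (simp add: left_diff_distrib)
    qed
    also have "\<dots> = - lin_EKL_flux wderiv e j v w z (Y x)"
      unfolding id lin_EKL_flux_def elim(5) elim(4) E21 by simp
    finally show ?case .
  qed
qed

end

text \<open>Composition with \<open>Y\<close> applies to a genuine weak derivative, whereas
  \<open>wderiv\<close> is informative only where one exists; existence follows from the explicit
  form of the flux of order two.\<close>

lemma (in energy_profile) EKL_flux_weak_deriv:
  assumes w: "has_weak_deriv w w1" "has_weak_deriv w1 w2" "has_weak_deriv w2 w3" "w \<in> borel_measurable borel"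
    and z: "has_weak_deriv z z1"
  obtains g where "has_weak_deriv (lin_EKL_flux wderiv E j u w z) g"
proof -
  have m: "w1 \<in> borel_measurable borel" "w2 \<in> borel_measurable borel"
    using w(1,2) by (auto intro: has_weak_deriv_measurable)
  let ?f = "\<lambda>x. (of_real (E11 x - deriv E12 x) * w x + of_real (E21 x - E12 x - deriv E22 x) * w1 x
      + of_real (- E22 x) * w2 x) + (- of_real (2 * j) * z x + - of_real (j\<^sup>2) * w x)"
  have ae: "AE x in lborel. lin_EKL_flux wderiv E j u w z x = ?f x"
    using lin_euler_AE[OF w(1,2,4)] unfolding lin_EKL_flux_def by eventually_elim simp
  have "\<exists>g. has_weak_deriv ?f g"
    by (rule exI w z m has_weak_deriv_add has_weak_deriv_cmult has_weak_deriv_bounded_smooth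
        along_partials_bounded_smooth bounded_smooth_diff bounded_smooth_uminus bounded_smooth_deriv)+
  then obtain g where "has_weak_deriv ?f g" ..
  then have "has_weak_deriv (lin_EKL_flux wderiv E j u w z) g"
    by (subst has_weak_deriv_cong_left[OF ae])
  then show thesis by (rule that)
qed

section \<open>Conjugation of the scalar problems and equality of the spectra\<close>

context matched_profiles
begin

text \<open>The pullback along the inverse diffeomorphism carries the weight \<open>v\<close>, and
  the two weights cancel because \<open>v (Y x) = 1 / \<rho> x\<close>.\<close>

lemma pullback_inverse:
  "pullback (line_diffeo.pullback X v q) = q" "line_diffeo.pullback X v (pullback z) = z"
proof -
  interpret L: line_diffeo X Y v \<rho> by (rule swap)
  show "pullback (L.pullback q) = q"
    unfolding pullback_def L.pullback_def using \<rho>_pos by (auto simp: X_Y v_Y less_imp_neq[symmetric])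
  have "\<rho> (X y) * v y = 1" for y using v_Y[of "X y"] \<rho>_pos[of "X y"] by (simp add: Y_X)
  then have "complex_of_real (v y) * of_real (\<rho> (X y)) = 1" for y
    by (metis mult.commute of_real_1 of_real_mult)
  then show "L.pullback (pullback z) = z"
    unfolding pullback_def L.pullback_def by (auto simp: Y_X simp flip: mult.assoc)
qed

text \<open>The minus sign in \<open>flux_pullback\<close> offsets the one in front of the Eulerian
  flux, and differentiating a composition with \<open>Y\<close> produces the factor
  \<open>\<rho>\<close> of \<open>pullback\<close>.\<close>

lemma reduced_pullback:
  assumes \<nu>: "\<nu> \<noteq> 0" and z: "z \<in> sobolev 4"
  shows "AE x in lborel. third_order_operator.reduced (EKE_lin E j \<rho>) (-1) \<nu> (pullback z) x =
    pullback (third_order_operator.reduced (EKL_lin e j v) 1 \<nu> z) x"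
proof -
  obtain k0 k1 k2 k3 l0 l1 K where "third_order_operator (EKE_lin E j \<rho>) (-1) k0 k1 k2 k3 l0 l1 K"
    by (rule Eul.EKE_third_order)
  then interpret A: third_order_operator "EKE_lin E j \<rho>" "-1" k0 k1 k2 k3 l0 l1 K .
  obtain k0' k1' k2' k3' l0' l1' K' where "third_order_operator (EKL_lin e j v) 1 k0' k1' k2' k3' l0' l1' K'"
    by (rule Lag.EKL_third_order)
  then interpret B: third_order_operator "EKL_lin e j v" 1 k0' k1' k2' k3' l0' l1' K' .
  have "z \<in> sobolev (Suc (Suc (Suc (Suc 0))))" using z by (simp add: eval_nat_numeral del: sobolev.simps)
  note s = sobolev_SucD[OF this] note s1 = sobolev_SucD[OF s(3)] note s2 = sobolev_SucD[OF s1(3)]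
    note s3 = sobolev_SucD[OF s2(3)]
  define w where "w = (\<lambda>y. 1 / \<nu> * wderiv z y)"
  define r where "r = (\<lambda>x. - 1 / \<nu> * wderiv (pullback z) x)"
  have w: "has_weak_deriv w (\<lambda>y. 1 / \<nu> * wderiv (wderiv z) y)"
    "has_weak_deriv (\<lambda>y. 1 / \<nu> * wderiv (wderiv z) y) (\<lambda>y. 1 / \<nu> * wderiv (wderiv (wderiv z)) y)"
    "has_weak_deriv (\<lambda>y. 1 / \<nu> * wderiv (wderiv (wderiv z)) y) (\<lambda>y. 1 / \<nu> * wderiv (wderiv (wderiv (wderiv z))) y)"
    unfolding w_def by (intro has_weak_deriv_cmult s1(2) s2(2) s3(2))+
  have wm: "w \<in> borel_measurable borel" unfolding w_def by (rule L2_measurable[OF L2_cmult[OF s1(1)]])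
  obtain g where g: "has_weak_deriv (lin_EKL_flux wderiv e j v w z) g"
    by (rule Lag.EKL_flux_weak_deriv[OF w wm s(2)])
  have "AE x in lborel. lin_EKE_flux wderiv E j \<rho> r (pullback z) x = - lin_EKL_flux wderiv e j v w z (Y x)"
    by (rule flux_pullback[OF s(2) s1(2) s2(2) L2_measurable[OF s(1)] _ _ wm, where n = "- 1 / \<nu>"])
      (simp_all add: r_def w_def)
  then have "AE x in lborel. lin_EKE_flux wderiv E j \<rho> r (pullback z) x = - 1 * lin_EKL_flux wderiv e j v w z (Y x)"
    by simp
  note eq = wderiv_cong[OF this]
  have "AE x in lborel. wderiv (lin_EKE_flux wderiv E j \<rho> r (pullback z)) x = - 1 * (of_real (\<rho> x) * g (Y x))"
    unfolding eq by (rule wderiv_AE[OF has_weak_deriv_cmult[OF has_weak_deriv_comp[OF g]]])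
  moreover have "AE x in lborel. wderiv (lin_EKL_flux wderiv e j v w z) (Y x) = g (Y x)"
    by (rule AE_comp[OF wderiv_AE[OF g]])
  ultimately show ?thesis
    unfolding A.reduced_def B.reduced_def r_def[symmetric] w_def[symmetric]
    unfolding EKE_lin_def EKL_lin_def prod.case snd_conv
    by eventually_elim (simp add: pullback_def algebra_simps)
qed

lemma L2_spectra_eq: "L2_spectrum lin_domain (EKE_lin E j \<rho>) = L2_spectrum lin_domain (EKL_lin e j v)"
proof -
  interpret L: line_diffeo X Y v \<rho> by (rule swap)
  obtain k0 k1 k2 k3 l0 l1 K where "third_order_operator (EKE_lin E j \<rho>) (-1) k0 k1 k2 k3 l0 l1 K"
    by (rule Eul.EKE_third_order)
  then interpret A: third_order_operator "EKE_lin E j \<rho>" "-1" k0 k1 k2 k3 l0 l1 K .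
  obtain k0' k1' k2' k3' l0' l1' K' where "third_order_operator (EKL_lin e j v) 1 k0' k1' k2' k3' l0' l1' K'"
    by (rule Lag.EKL_third_order)
  then interpret B: third_order_operator "EKL_lin e j v" 1 k0' k1' k2' k3' l0' l1' K' .
  obtain C where C: "C \<ge> 0" "\<And>z. z \<in> L2 \<Longrightarrow> sqnorm (pullback z) \<le> C * sqnorm z"
    "\<And>z. z \<in> sobolev 4 \<Longrightarrow> sqnorm (pullback z) + sqnorm (wderiv (pullback z)) \<le> C * (sqnorm z + sqnorm (wderiv z))"
    by (rule pullback_bounds[OF Eul.u Eul.\<delta>]) (rule that)
  obtain C' where C': "C' \<ge> 0" "\<And>z. z \<in> L2 \<Longrightarrow> sqnorm (L.pullback z) \<le> C' * sqnorm z"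
    "\<And>z. z \<in> sobolev 4 \<Longrightarrow> sqnorm (L.pullback z) + sqnorm (wderiv (L.pullback z)) \<le> C' * (sqnorm z + sqnorm (wderiv z))"
    by (rule L.pullback_bounds[OF Lag.u Lag.\<delta>]) (rule that)
  have L2: "pullback f \<in> L2" "L.pullback f \<in> L2" if "f \<in> L2" for f
    using pullback_sobolev[OF Eul.u Eul.\<delta>, of f 0] L.pullback_sobolev[OF Lag.u Lag.\<delta>, of f 0] that by auto
  have "\<nu> \<in> resolvent_set lin_domain (EKE_lin E j \<rho>) \<longleftrightarrow> \<nu> \<in> resolvent_set lin_domain (EKL_lin e j v)" for \<nu>
  proof (cases "\<nu> = 0")
    case True
    then show ?thesis using A.zero_notin_resolvent_set B.zero_notin_resolvent_set by simp
  next
    case False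
    have "reduced_solvable (A.reduced \<nu>) \<longleftrightarrow> reduced_solvable (B.reduced \<nu>)"
    proof (rule reduced_solvable_transfer_iff[where T = pullback and T' = L.pullback and C = C and C' = C'])
      fix z assume "z \<in> sobolev 4"
      then show "pullback z \<in> sobolev 4" "L.pullback z \<in> sobolev 4"
        "AE x in lborel. A.reduced \<nu> (pullback z) x = pullback (B.reduced \<nu> z) x"
        by (auto intro: pullback_sobolev[OF Eul.u Eul.\<delta>] L.pullback_sobolev[OF Lag.u Lag.\<delta>] reduced_pullback[OF False])
    qed (use C C' L2 pullback_inverse pullback_AE_cong L.pullback_AE_cong in auto)
    then show ?thesis using A.resolvent_iff_reduced[OF False] B.resolvent_iff_reduced[OF False] by simp
  qed
  then show ?thesis unfolding L2_spectrum_def by blast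
qed

end

text \<open>The lower bound on \<open>Y'\<close> gives \<open>Y b - Y a \<ge> c * (b - a)\<close>,
  whence \<open>Y\<close> is injective and onto; the inverse has derivative
  \<open>1 / \<rho>\<close> at the preimage, which is \<open>v\<close>.\<close>

lemma mass_coordinate_diffeo:
  fixes Y \<rho> :: "real \<Rightarrow> real"
  assumes Y: "\<And>x. (Y has_real_derivative \<rho> x) (at x)" and c: "c > 0" "\<And>x. c \<le> \<rho> x"
    and \<rho>: "continuous_on UNIV \<rho>" and v: "continuous_on UNIV v" and v_Y: "\<And>x. v (Y x) = 1 / \<rho> x"
  shows "line_diffeo Y (inv Y) \<rho> v"
proof -
  have pos: "0 < \<rho> x" for x using c(1) c(2)[of x] by linarith
  have growth: "c * (b - a) \<le> Y b - Y a" if "a \<le> b" for a b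
  proof (cases "a = b")
    case False
    then have "a < b" using that by simp
    then obtain z where "Y b - Y a = (b - a) * \<rho> z" using MVT2[of a b Y \<rho>] Y by blast
    then show ?thesis using mult_right_mono[OF c(2)[of z], of "b - a"] that by (simp add: mult.commute)
  qed simp
  have cont: "isCont Y x" for x using Y by (rule DERIV_isCont)
  have inj: "inj Y"
  proof (rule injI)
    fix a b assume "Y a = Y b"
    have False if "a < b" "Y a = Y b" for a b
      using growth[of a b] that c(1) by (simp add: mult_le_0_iff)
    then show "a = b" using \<open>Y a = Y b\<close> by (metis linorder_neqE_linordered_idom)
  qed
  have surj: "surj Y"
    unfolding surj_def
  proof
    fix y
    \<comment> \<open>Over a length \<open>t\<close> the function \<open>Y\<close> changes by at
      least \<open>|y - Y 0|\<close>, so \<open>y\<close> lies between \<open>Y (- t)\<close> and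
      \<open>Y t\<close>.\<close>
    define t where "t = \<bar>y - Y 0\<bar> / c"
    have t: "0 \<le> t" "c * t = \<bar>y - Y 0\<bar>" using c(1) by (auto simp: t_def)
    have "Y (- t) \<le> y" "y \<le> Y t" using growth[of "- t" 0] growth[of 0 t] t by auto
    then obtain x where "Y x = y" using IVT[of Y "- t" y t] t cont by auto
    then show "\<exists>x. y = Y x" by blast
  qed
  have Y_X: "Y (inv Y y) = y" for y using surj by (rule surj_f_inv_f)
  have X_Y: "inv Y (Y x) = x" for x using inj by (rule inv_f_f)
  have X_cont: "isCont (inv Y) y" for y
    using isCont_inverse_function[of 1 "inv Y y" "inv Y" Y] cont by (simp add: Y_X X_Y)
  have v_eq: "v y = 1 / \<rho> (inv Y y)" for y using v_Y[of "inv Y y"] by (simp add: Y_X)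
  show ?thesis
  proof
    fix y
    have "(inv Y has_real_derivative inverse (\<rho> (inv Y y))) (at y)"
      by (rule DERIV_inverse_function[of Y, where a = "y - 1" and b = "y + 1"])
        (use Y pos[of "inv Y y"] Y_X X_cont in auto)
    then show "(inv Y has_real_derivative v y) (at y)" by (simp add: v_eq inverse_eq_divide)
    show "0 < v y" using pos by (simp add: v_eq)
  qed (use Y_X X_Y Y pos \<rho> v in auto)
qed

theorem theorem6:
  fixes j \<Xi> \<Upsilon> :: real and E e :: "real \<Rightarrow> real \<Rightarrow> real" and \<rho> v Y :: "real \<Rightarrow> real"
  assumes "admissible_energy E" and "admissible_energy e"
    and "\<And>r s. r > 0 \<Longrightarrow> E r s = r * e (1 / r) (- s / r ^ 3)"
    and "smooth_fn \<rho>" and "smooth_fn v"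
    and "\<Xi> > 0" and "\<And>x. \<rho> (x + \<Xi>) = \<rho> x"
    and "\<Upsilon> = integral {0..\<Xi>} \<rho>" and "\<And>y. v (y + \<Upsilon>) = v y"
    and "\<exists>c>0. \<exists>C. \<forall>x. c \<le> \<rho> x \<and> \<rho> x \<le> C"
    and "\<exists>c>0. \<exists>C. \<forall>y. c \<le> v y \<and> v y \<le> C"
    and "\<And>x. \<rho> x = 1 / v (Y x)" and "\<And>x. (Y has_real_derivative \<rho> x) (at x)"
    and "EKE_solution E j (\<lambda>t. \<rho>) (\<lambda>t x. 0)"
    and "EKL_solution e j (\<lambda>s. v) (\<lambda>s y. 0)"
  shows "L2_spectrum lin_domain (EKE_lin E j \<rho>) = L2_spectrum lin_domain (EKL_lin e j v)"
proof -
  obtain c where c: "c > 0" "\<And>x. c \<le> \<rho> x" using assms(10) by blast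
  obtain d where d: "d > 0" "\<And>y. d \<le> v y" using assms(11) by blast
  have v_Y: "v (Y x) = 1 / \<rho> x" for x using assms(12)[of x] by simp
  \<comment> \<open>Identifying \<open>\<Upsilon>\<close> with the increment of \<open>Y\<close>
    over one period shows that it is positive, as the bounds for the periodic function
    \<open>v\<close> require.\<close>
  have "(\<rho> has_integral (Y \<Xi> - Y 0)) {0..\<Xi>}"
    using assms(6) by (intro fundamental_theorem_of_calculus)
      (auto intro!: has_field_derivative_at_within[OF assms(13)]
        simp flip: has_real_derivative_iff_has_vector_derivative)
  then have "\<Upsilon> = Y \<Xi> - Y 0" unfolding assms(8) by (rule integral_unique)
  moreover have "Y 0 < Y \<Xi>"
    by (rule DERIV_pos_imp_increasing[OF assms(6)]) (use assms(13) c in \<open>meson less_le_trans\<close>)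
  ultimately have "\<Upsilon> > 0" by simp
  have \<rho>: "bounded_smooth \<rho>" by (rule periodic_bounded_smooth[OF assms(6,4,7)])
  have v: "bounded_smooth v" by (rule periodic_bounded_smooth[OF \<open>\<Upsilon> > 0\<close> assms(5,9)])
  have Y: "line_diffeo Y (inv Y) \<rho> v"
    by (rule mass_coordinate_diffeo[OF assms(13) c bounded_smooth_continuous[OF \<rho>]
          bounded_smooth_continuous[OF v] v_Y])
  \<comment> \<open>Since \<open>z = 0\<close> at all times, the second equation makes the spatial
    derivative of the flux vanish; the constant value of the flux becomes
    \<open>\<mu>\<close>.\<close>
  have "(EKL_flux e j v (\<lambda>y. 0) has_real_derivative 0) (at y)" for y
  proof -
    obtain a b where "((\<lambda>\<tau>::real. 0) has_real_derivative a) (at 0)"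
      "(EKL_flux e j v (\<lambda>y. 0) has_real_derivative b) (at y)" "a = b"
      using assms(15) unfolding EKL_solution_def by blast
    moreover from this have "a = 0" using DERIV_unique DERIV_const by blast
    ultimately show ?thesis by simp
  qed
  then have "EKL_flux e j v (\<lambda>y. 0) y = EKL_flux e j v (\<lambda>y. 0) 0" for y
    by (intro DERIV_isconst_all) blast
  then have stat: "euler e v y - j\<^sup>2 * v y = EKL_flux e j v (\<lambda>y. 0) 0" for y
    by (simp add: EKL_flux_def)
  have E: "smooth2_on ({0<..} \<times> UNIV) E" and e: "smooth2_on ({0<..} \<times> UNIV) e"
    using assms(1,2) by (simp_all add: admissible_energy_def)
  have "matched_profiles Y (inv Y) \<rho> v E c e d j (EKL_flux e j v (\<lambda>y. 0) 0)"
    by (rule matched_profiles.intro[OF Y energy_profile.intro[OF E \<rho> c] energy_profile.intro[OF e v d]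
          matched_profiles_axioms.intro[OF assms(3) v_Y stat]])
  then show ?thesis by (rule matched_profiles.L2_spectra_eq)
qed

end
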